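(* Given $(X,G)\in\mathcal{M}_h$ and a tangent vector $(\eta,\zeta)\in\mathrm{T}_{(X,G)}\mathcal{M}_h$ with representations $(H,V)$ and $(K,V_p)$, respectively, the mapping $\mathrm{R}$ defined by $$\mathrm{R}_{(X,G)}(\eta,\zeta)=\Big(\big[\mathcal{P}_{\mathcal{H}^r}\big((X+\eta)W\big)\big]W^\top,\ I-WW^\top\Big)\quad\text{with}\quad W=L(L^\top L)^{-1/2},\quad L=V+V_p\big(I-K^\top HM_{H,\omega}^{-1}\big),$$ is a second-order retraction on $\mathcal{M}_h$.
   Context: Let $r\le\min\{m,n\}$ be a positive integer. The map $h:\mathbb{R}^{m\times n}\to\mathbb{R}^q$ is smooth and orthogonally invariant, i.e. $h(XQ)=h(X)$ for all $X$ and all $Q\in\mathcal{O}(n)=\{Q\in\mathbb{R}^{n\times n}:Q^\top Q=I_n\}$. Put $\mathcal{H}=\{X\in\mathbb{R}^{m\times n}:h(X)=0\}$; it is assumed that the differential $\mathrm{D}h_X$ has rank $q$ for all $X\in\mathcal{H}$. Define $\mathcal{H}^r=\{H\in\mathbb{R}^{m\times r}:h([H\ \ 0^{m\times(n-r)}])=0\}$, an embedded submanifold of $\mathbb{R}^{m\times r}$ when nonempty. $\mathrm{Sym}(n)$: symmetric $n\times n$ matrices; $\mathrm{Gr}(n,n-r)=\{G\in\mathrm{Sym}(n):G^2=G,\operatorname{rank}(G)=n-r\}$; $\mathrm{St}(n,r)=\{V\in\mathbb{R}^{n\times r}:V^\top V=I_r\}$. Define $\mathcal{M}_h=\{(X,G)\in\mathbb{R}^{m\times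 n}\times\mathrm{Gr}(n,n-r):XG=0,\ h(X)=0\}$, an embedded submanifold of $\mathcal{E}=\mathbb{R}^{m\times n}\times\mathrm{Sym}(n)$. A representation of $(X,G)\in\mathcal{M}_h$ is a pair $(H,V)\in\mathcal{H}^r\times\mathrm{St}(n,r)$ with $X=HV^\top$, $G=I-VV^\top$ (one always exists). The tangent space is $\mathrm{T}_{(X,G)}\mathcal{M}_h=\{(KV^\top+HV_p^\top,-V_pV^\top-VV_p^\top):K\in\mathrm{T}_H\mathcal{H}^r,\ V_p\in\mathbb{R}^{n\times r},\ V^\top V_p=0\}$; $(K,V_p)$ is said to represent the tangent vector $(\eta,\zeta)=(KV^\top+HV_p^\top,-V_pV^\top-VV_p^\top)$. For a fixed weight $\omega>0$, $\mathcal{M}_h$ carries the Riemannian metric inherited from $\langle(E_1,Z_1),(E_2,Z_2)\rangle_\omega=\langle E_1,E_2\rangle+\omega\langle Z_1,Z_2\rangle$ on $\mathcal{E}$, $\langle A,B\rangle=\mathrm{tr}(A^\top B)$. $M_{H,\omega}=2\omega I+H^\top H$. $\mathcal{P}_{\mathcal{H}^r}$ is the metric (Frobenius) projection onto $\mathcal{H}^r$; it is well-defined and smooth in a neighborhood of each $H\in\mathcal{H}^r$, and for general $h$ the mapping $\mathrm{R}$ (its definition and smoothness) is understood locally, i.e. for tangent vectors near zero, where this projection is well-defined and smooth. A smooth mapping $\mathrm{R}:\mathrm{T}\mathcal{M}\to\mathcal{M}$ is a retraction on $\mathcal{M}$ if for any $X\in\mathcal{M}$, $\xi\in\mathrm{T}_X\mathcal{M}$,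 the curve $\gamma(t)=\mathrm{R}_X(t\xi)$ satisfies $\gamma(0)=X$, $\gamma'(0)=\xi$. It is second-order if moreover $\gamma''(0)=0$ for all such curves, where $\gamma''$ denotes the intrinsic (Riemannian) acceleration, i.e. the orthogonal projection (with respect to the inner product $\langle\cdot,\cdot\rangle_\omega$ on $\mathcal{E}$) of the extrinsic acceleration onto the tangent space. *)

theory Defs
  imports "HOL-Analysis.Analysis"
begin

section \<open>Smooth maps, tangent spaces and retractions for subsets of Euclidean space\<close>

text \<open>For a Euclidean domain and open S, the first predicate says that f is k times continuously
  differentiable on S.\<close>

primrec Ck_on :: "nat \<Rightarrow> 'a::euclidean_space set \<Rightarrow> ('a \<Rightarrow> 'b::real_normed_vector) \<Rightarrow> bool" where
  "Ck_on 0 S f \<longleftrightarrow> continuous_on S f"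
| "Ck_on (Suc k) S f \<longleftrightarrow>
     (\<forall>x\<in>S. f differentiable (at x)) \<and> (\<forall>v. Ck_on k S (\<lambda>x. frechet_derivative f (at x) v))"

definition smooth_on :: "'a::euclidean_space set \<Rightarrow> ('a \<Rightarrow> 'b::real_normed_vector) \<Rightarrow> bool" where
  "smooth_on S f \<longleftrightarrow> open S \<and> (\<forall>k. Ck_on k S f)"

text \<open>Smoothness on a subset that need not be open: f has local smooth extensions. On (relatively
  open parts of) an embedded submanifold this is the usual smoothness.\<close>

definition smooth_map_on :: "'a::euclidean_space set \<Rightarrow> ('a \<Rightarrow> 'b::real_normed_vector) \<Rightarrow> bool" where
  "smooth_map_on S f \<longleftrightarrow>
     (\<forall>x\<in>S. \<exists>N g. x \<in> N \<and> smooth_on N g \<and> (\<forall>y\<in>S \<inter> N. g y = f y))"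

text \<open>Tangent vectors are the velocities of smooth curves in M.\<close>

definition tangent_space :: "'a::euclidean_space set \<Rightarrow> 'a \<Rightarrow> 'a set" where
  "tangent_space M x = {v. \<exists>(\<gamma>::real \<Rightarrow> 'a) \<epsilon>. \<epsilon> > 0 \<and> smooth_on {-\<epsilon><..<\<epsilon>} \<gamma> \<and>
     \<gamma> ` {-\<epsilon><..<\<epsilon>} \<subseteq> M \<and> \<gamma> 0 = x \<and> (\<gamma> has_vector_derivative v) (at 0)}"

definition tangent_bundle :: "'a::euclidean_space set \<Rightarrow> ('a \<times> 'a) set" where
  "tangent_bundle M = {(x, v). x \<in> M \<and> v \<in> tangent_space M x}"

definition orth_proj :: "('a::euclidean_space \<Rightarrow> 'a \<Rightarrow> real) \<Rightarrow> 'a set \<Rightarrow> 'a \<Rightarrow> 'a" where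
  "orth_proj ip T z = (THE p. p \<in> T \<and> (\<forall>t\<in>T. ip (z - p) t = 0))"

text \<open>For the Riemannian metric inherited from the inner product ip of the ambient space, the
  intrinsic acceleration is the tangential part of the extrinsic one.\<close>

definition intrinsic_acceleration ::
  "('a::euclidean_space \<Rightarrow> 'a \<Rightarrow> real) \<Rightarrow> 'a set \<Rightarrow> (real \<Rightarrow> 'a) \<Rightarrow> real \<Rightarrow> 'a" where
  "intrinsic_acceleration ip M \<gamma> t =
     orth_proj ip (tangent_space M (\<gamma> t))
       (vector_derivative (\<lambda>s. vector_derivative \<gamma> (at s)) (at t))"

definition zero_section_neighborhood :: "'a::euclidean_space set \<Rightarrow> ('a \<times> 'a) set \<Rightarrow> bool" where
  "zero_section_neighborhood M U \<longleftrightarrow>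
     openin (top_of_set (tangent_bundle M)) U \<and> (\<forall>x\<in>M. (x, 0) \<in> U)"

text \<open>Retractions that are only required to be defined on a neighborhood U of the zero section;
  a globally defined retraction is the case where U is the whole tangent bundle.\<close>

definition retraction_near_zero ::
  "'a::euclidean_space set \<Rightarrow> ('a \<times> 'a) set \<Rightarrow> ('a \<times> 'a \<Rightarrow> 'a) \<Rightarrow> bool" where
  "retraction_near_zero M U R \<longleftrightarrow>
     zero_section_neighborhood M U \<and> smooth_map_on U R \<and> R ` U \<subseteq> M \<and>
     (\<forall>x\<in>M. \<forall>v\<in>tangent_space M x.
        R (x, 0 *\<^sub>R v) = x \<and> ((\<lambda>t. R (x, t *\<^sub>R v)) has_vector_derivative v) (at 0))"

definition second_order_retraction_near_zero ::
  "('a::euclidean_space \<Rightarrow> 'a \<Rightarrow> real) \<Rightarrow> 'a set \<Rightarrow> ('a \<times> 'a) set \<Rightarrow> ('a \<times> 'a \<Rightarrow> 'a) \<Rightarrow> bool" where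
  "second_order_retraction_near_zero ip M U R \<longleftrightarrow>
     retraction_near_zero M U R \<and>
     (\<forall>x\<in>M. \<forall>v\<in>tangent_space M x. intrinsic_acceleration ip M (\<lambda>t. R (x, t *\<^sub>R v)) 0 = 0)"


section \<open>Matrices\<close>

definition frob_inner :: "real^'n^'m \<Rightarrow> real^'n^'m \<Rightarrow> real" where
  "frob_inner A B = trace (transpose A ** B)"

definition weighted_inner ::
  "real \<Rightarrow> (real^'n^'m) \<times> (real^'n^'n) \<Rightarrow> (real^'n^'m) \<times> (real^'n^'n) \<Rightarrow> real" where
  "weighted_inner \<omega> A B = frob_inner (fst A) (fst B) + \<omega> * frob_inner (snd A) (snd B)"

definition psd_sqrt :: "real^'n^'n \<Rightarrow> real^'n^'n" where
  "psd_sqrt A = (THE B. transpose B = B \<and> (\<forall>x. 0 \<le> x \<bullet> (B *v x)) \<and> B ** B = A)"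

definition Gr :: "nat \<Rightarrow> (real^'n^'n) set" where
  "Gr k = {G. transpose G = G \<and> G ** G = G \<and> rank G = k}"

definition St :: "(real^'r^'n) set" where
  "St = {V. transpose V ** V = mat 1}"


section \<open>The constraint sets\<close>

text \<open>The columns of H are placed at the positions selected by an injection e of the column
  indices, and all other columns are zero. For the inclusion of the first r columns this is the
  block matrix [H 0].\<close>

definition pad :: "('r \<Rightarrow> 'n) \<Rightarrow> real^'r^'m \<Rightarrow> real^'n^'m" where
  "pad e H = (\<chi> i j. if j \<in> range e then H $ i $ (inv e j) else 0)"

definition Hset :: "(real^'n^'m \<Rightarrow> real^'q) \<Rightarrow> (real^'n^'m) set" where
  "Hset h = {X. h X = 0}"

definition Hr :: "(real^'n^'m \<Rightarrow> real^'q) \<Rightarrow> ('r \<Rightarrow> 'n) \<Rightarrow> (real^'r^'m) set" where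
  "Hr h e = {H. h (pad e H) = 0}"

text \<open>The type of e only serves to supply r.\<close>

definition Mh :: "(real^'n^'m \<Rightarrow> real^'q) \<Rightarrow> ('r::finite \<Rightarrow> 'n) \<Rightarrow> ((real^'n^'m) \<times> (real^'n^'n)) set" where
  "Mh h e = {(X, G). G \<in> Gr (CARD('n) - CARD('r)) \<and> X ** G = 0 \<and> h X = 0}"

definition represents_point ::
  "(real^'n^'m \<Rightarrow> real^'q) \<Rightarrow> ('r::finite \<Rightarrow> 'n) \<Rightarrow> real^'r^'m \<Rightarrow> real^'r^'n \<Rightarrow>
   (real^'n^'m) \<times> (real^'n^'n) \<Rightarrow> bool" where
  "represents_point h e H V p \<longleftrightarrow>
     H \<in> Hr h e \<and> V \<in> St \<and> p = (H ** transpose V, mat 1 - V ** transpose V)"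

definition represents_tangent ::
  "(real^'n^'m \<Rightarrow> real^'q) \<Rightarrow> ('r::finite \<Rightarrow> 'n) \<Rightarrow> real^'r^'m \<Rightarrow> real^'r^'n \<Rightarrow>
   real^'r^'m \<Rightarrow> real^'r^'n \<Rightarrow> (real^'n^'m) \<times> (real^'n^'n) \<Rightarrow> bool" where
  "represents_tangent h e H V K Vp \<xi> \<longleftrightarrow>
     K \<in> tangent_space (Hr h e) H \<and> transpose V ** Vp = 0 \<and>
     \<xi> = (K ** transpose V + H ** transpose Vp, - (Vp ** transpose V) - V ** transpose Vp)"


section \<open>The mapping R\<close>

definition Mmat :: "real \<Rightarrow> real^'r^'m \<Rightarrow> real^'r^'r" where
  "Mmat \<omega> H = (2 * \<omega>) *\<^sub>R mat 1 + transpose H ** H"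

definition Lmat ::
  "real \<Rightarrow> real^'r^'m \<Rightarrow> real^'r^'n \<Rightarrow> real^'r^'m \<Rightarrow> real^'r^'n \<Rightarrow> real^'r^'n" where
  "Lmat \<omega> H V K Vp = V + Vp ** (mat 1 - transpose K ** H ** matrix_inv (Mmat \<omega> H))"

definition Wmat ::
  "real \<Rightarrow> real^'r^'m \<Rightarrow> real^'r^'n \<Rightarrow> real^'r^'m \<Rightarrow> real^'r^'n \<Rightarrow> real^'r^'n" where
  "Wmat \<omega> H V K Vp =
     (let L = Lmat \<omega> H V K Vp in L ** matrix_inv (psd_sqrt (transpose L ** L)))"

definition R_value ::
  "(real^'n^'m \<Rightarrow> real^'q) \<Rightarrow> ('r::finite \<Rightarrow> 'n) \<Rightarrow> real \<Rightarrow>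
   real^'r^'m \<Rightarrow> real^'r^'n \<Rightarrow> real^'r^'m \<Rightarrow> real^'r^'n \<Rightarrow>
   (real^'n^'m) \<times> (real^'n^'n) \<Rightarrow> (real^'n^'m) \<times> (real^'n^'n) \<Rightarrow> (real^'n^'m) \<times> (real^'n^'n)" where
  "R_value h e \<omega> H V K Vp p \<xi> =
     (let W = Wmat \<omega> H V K Vp in
       (closest_point (Hr h e) ((fst p + fst \<xi>) ** W) ** transpose W, mat 1 - W ** transpose W))"

text \<open>The common value of the defining expression over all representations.\<close>

definition R_map ::
  "(real^'n^'m \<Rightarrow> real^'q) \<Rightarrow> ('r::finite \<Rightarrow> 'n) \<Rightarrow> real \<Rightarrow>
   ((real^'n^'m) \<times> (real^'n^'n)) \<times> ((real^'n^'m) \<times> (real^'n^'n)) \<Rightarrow> (real^'n^'m) \<times> (real^'n^'n)" where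
  "R_map h e \<omega> = (\<lambda>(p, \<xi>). THE y. \<exists>H V K Vp.
     represents_point h e H V p \<and> represents_tangent h e H V K Vp \<xi> \<and> y = R_value h e \<omega> H V K Vp p \<xi>)"

text \<open>R is well defined at (p, \<xi>): representations exist, and for each of them the metric projection
  involved is single-valued and the defining expression yields the value of R. (The library's
  closest\_point makes a choice when nearest points are not unique.)\<close>

definition R_well_defined_at ::
  "(real^'n^'m \<Rightarrow> real^'q) \<Rightarrow> ('r::finite \<Rightarrow> 'n) \<Rightarrow> real \<Rightarrow>
   (real^'n^'m) \<times> (real^'n^'n) \<Rightarrow> (real^'n^'m) \<times> (real^'n^'n) \<Rightarrow> bool" where
  "R_well_defined_at h e \<omega> p \<xi> \<longleftrightarrow>
     (\<exists>H V K Vp. represents_point h e H V p \<and> represents_tangent h e H V K Vp \<xi>) \<and>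
     (\<forall>H V K Vp. represents_point h e H V p \<and> represents_tangent h e H V K Vp \<xi> \<longrightarrow>
        (\<exists>!Y. Y \<in> Hr h e \<and>
              (\<forall>Z\<in>Hr h e. dist ((fst p + fst \<xi>) ** Wmat \<omega> H V K Vp) Y
                          \<le> dist ((fst p + fst \<xi>) ** Wmat \<omega> H V K Vp) Z)) \<and>
        R_map h e \<omega> (p, \<xi>) = R_value h e \<omega> H V K Vp p \<xi>)"

end

theory Submission
  imports Defs
begin

text \<open>The retraction is a composition of two kinds of maps: algebraic ones with a polar factor
  $L \mapsto L (L^T L)^{-1/2}$, and the metric projection onto the reduced constraint set
  \<open>Hr h e\<close>. The polar factor is smooth because squaring is a local diffeomorphism at the identity
  matrix (\<open>smooth_square_root\<close>). The projection is smooth because the full rank of \<open>h\<close> passes to the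
  restriction of \<open>h\<close> to the matrices $[H\ 0]$ (\<open>surj_derivative_reduced\<close>, by a reflection argument),
  and for a regular level set the Lagrange system
  $y + \mathrm{D}F_y^T\lambda = z$, $F(y) = 0$ is locally uniquely solvable; every nearest point
  solves it with a small multiplier (\<open>smooth_local_projection\<close>). Both facts rest on a smooth
  inverse function theorem.

Two representations of one point differ by an orthogonal \<open>r \<times> r\<close> matrix \<open>Q\<close>, and then the
  representations of a tangent vector differ by the same \<open>Q\<close>. All ingredients of the formula are
  equivariant under \<open>Q\<close>, so its value does not depend on the choice (\<open>R_value_unique\<close>). Near a
  base point with frame \<open>V\<close>, the polar factor of $(I - G) V$ is a frame that depends
  smoothly on \<open>G\<close>. Inserting it into the formula gives a smooth expression for the retraction near
  the zero section (\<open>local_smooth_formula\<close>).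

For the order conditions, let $C = K^T H M_{H,\omega}^{-1}$. Along a line $t(\eta,\zeta)$ the frame
  has the expansion $W = V + t V_p - t^2 (V_p C + \frac{1}{2} V V_p^T V_p) + o(t^2)$, so the
  point $Z = (X + t\eta) W$ to be projected has first derivative \<open>K\<close> and second derivative
  $H V_p^T V_p$ at 0. Its projection \<open>Y\<close> has the same first derivative, and the second derivatives
  of \<open>Y\<close> and \<open>Z\<close> agree up to a vector normal to the reduced constraint set (\<open>jet2_projection\<close>),
  which is all that matters since the acceleration is only tested against tangent vectors. Pairing
  the acceleration with the tangent vector represented by $(K', V_p')$, the contributions of \<open>K'\<close>
  cancel and those of $V_p'$ add up to
  $2 \langle V_p (K^T H - C (H^T H + 2 \omega I)), V_p'\rangle = 0$. The last equation is what the
  correction term in \<open>L\<close> is made for (\<open>normal_acceleration\<close>).\<close>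

section \<open>Calculus of continuously differentiable maps\<close>

lemma Ck_on_subset: "Ck_on k S f \<Longrightarrow> T \<subseteq> S \<Longrightarrow> Ck_on k T f"
  by (induction k arbitrary: f) (auto intro: continuous_on_subset)

lemma Ck_on_cong:
  assumes "open S" "Ck_on k S f" "\<And>x. x \<in> S \<Longrightarrow> f x = g x"
  shows "Ck_on k S g"
  using assms
proof (induction k arbitrary: f g)
  case 0
  then show ?case using continuous_on_cong by auto
next
  case (Suc k)
  have d: "(g has_derivative frechet_derivative f (at x)) (at x)" if "x \<in> S" for x
    using Suc.prems that has_derivative_transform_within_open[of f _ x UNIV S g]
    by (auto simp: frechet_derivative_works)
  have "g differentiable (at x)" if "x \<in> S" for x
    using d[OF that] by (auto simp: differentiable_def)
  moreover have "Ck_on k S (\<lambda>x. frechet_derivative g (at x) v)" for v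
  proof (rule Suc.IH[OF \<open>open S\<close>])
    show "Ck_on k S (\<lambda>x. frechet_derivative f (at x) v)" using Suc.prems by simp
    show "frechet_derivative f (at x) v = frechet_derivative g (at x) v" if "x \<in> S" for x
      using frechet_derivative_at[OF d[OF that]] by simp
  qed
  ultimately show ?case by simp
qed

text \<open>The definition speaks of the derivative selected by \<^const>\<open>frechet_derivative\<close>. By uniqueness of
  derivatives, any explicit formula for the derivative serves as well.\<close>

lemma Ck_on_SucI:
  assumes "open S" "\<And>x. x \<in> S \<Longrightarrow> (f has_derivative f' x) (at x)"
    "\<And>v. Ck_on k S (\<lambda>x. f' x v)"
  shows "Ck_on (Suc k) S f"
proof -
  have "Ck_on k S (\<lambda>x. frechet_derivative f (at x) v)" for v
  proof (rule Ck_on_cong[OF assms(1) assms(3)])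
    show "f' x v = frechet_derivative f (at x) v" if "x \<in> S" for x
      using frechet_derivative_at[OF assms(2)[OF that]] by simp
  qed
  then show ?thesis using assms(2) by (auto simp: differentiable_def)
qed

lemma Ck_on_SucD: "Ck_on (Suc k) S f \<Longrightarrow> Ck_on k S f"
proof (induction k arbitrary: f)
  case 0
  then show ?case
    by (simp add: continuous_at_imp_continuous_on differentiable_imp_continuous_within)
next
  case (Suc k)
  then show ?case by (metis Ck_on.simps(2))
qed

lemma Ck_on_const: "Ck_on k S (\<lambda>x. c)"
  by (induction k arbitrary: c) auto

lemma Ck_on_local:
  assumes "\<And>x. x \<in> S \<Longrightarrow> \<exists>N. open N \<and> x \<in> N \<and> Ck_on k N f"
  shows "Ck_on k S f"
  using assms
proof (induction k arbitrary: f)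
  case 0
  then show ?case
    by (simp) (meson continuous_at_imp_continuous_on continuous_on_eq_continuous_at)
next
  case (Suc k)
  have "f differentiable at x" if "x \<in> S" for x using Suc.prems[OF that] by auto
  moreover have "Ck_on k S (\<lambda>x. frechet_derivative f (at x) v)" for v
    using Suc.prems by (intro Suc.IH) (metis Ck_on.simps(2))
  ultimately show ?case by simp
qed

lemma Ck_on_bounded_linear_compose:
  fixes f :: "'a::euclidean_space \<Rightarrow> 'b::real_normed_vector" and L :: "'b \<Rightarrow> 'c::real_normed_vector"
  assumes "bounded_linear L" "open S" "Ck_on k S f"
  shows "Ck_on k S (\<lambda>x. L (f x))"
  using assms(3)
proof (induction k arbitrary: f)
  case 0
  then show ?case using assms(1) by (simp add: bounded_linear.continuous_on)
next
  case (Suc k)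
  show ?case
  proof (rule Ck_on_SucI[OF \<open>open S\<close>])
    show "((\<lambda>x. L (f x)) has_derivative (\<lambda>v. L (frechet_derivative f (at x) v))) (at x)" if "x \<in> S" for x
      using Suc.prems that
      by (intro bounded_linear.has_derivative[OF assms(1)]) (simp add: frechet_derivative_works[symmetric])
  qed (use Suc in auto)
qed

lemma Ck_on_bounded_linear:
  assumes "bounded_linear L" "open S"
  shows "Ck_on k S L"
proof (cases k)
  case 0
  then show ?thesis using assms by (simp add: linear_continuous_on)
next
  case (Suc k')
  then show ?thesis
    using assms bounded_linear_imp_has_derivative[OF assms(1)]
    by (simp only: Suc) (rule Ck_on_SucI[where f'="\<lambda>x. L"]; simp add: Ck_on_const)
qed

lemma Ck_on_add:
  assumes "open S" "Ck_on k S f" "Ck_on k S g"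
  shows "Ck_on k S (\<lambda>x. f x + g x)"
  using assms(2,3)
proof (induction k arbitrary: f g)
  case 0
  then show ?case by (simp add: continuous_on_add)
next
  case (Suc k)
  show ?case
  proof (rule Ck_on_SucI[OF \<open>open S\<close>])
    show "((\<lambda>x. f x + g x) has_derivative
      (\<lambda>v. frechet_derivative f (at x) v + frechet_derivative g (at x) v)) (at x)" if "x \<in> S" for x
      using Suc.prems that
      by (intro has_derivative_add) (simp_all add: frechet_derivative_works[symmetric])
  qed (use Suc in auto)
qed

lemma Ck_on_sum:
  assumes "open S" "\<And>i. i \<in> I \<Longrightarrow> Ck_on k S (f i)"
  shows "Ck_on k S (\<lambda>x. \<Sum>i\<in>I. f i x)"
  using assms(2)
proof (induction I rule: infinite_finite_induct)
  case (insert i I)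
  then show ?case using Ck_on_add[OF \<open>open S\<close>, of k "f i" "\<lambda>x. \<Sum>i\<in>I. f i x"] by simp
qed (auto intro: Ck_on_const)

text \<open>The product rule yields two expressions of the same form with one factor differentiated, so the
  induction has to range over both factors.\<close>

lemma Ck_on_bilinear:
  assumes B: "bounded_bilinear B" and "open S" "Ck_on k S f" "Ck_on k S g"
  shows "Ck_on k S (\<lambda>x. B (f x) (g x))"
  using assms(3,4)
proof (induction k arbitrary: f g)
  case 0
  then show ?case using B by (simp add: bounded_bilinear.continuous_on)
next
  case (Suc k)
  show ?case
  proof (rule Ck_on_SucI[OF \<open>open S\<close>])
    show "((\<lambda>x. B (f x) (g x)) has_derivative
      (\<lambda>v. B (f x) (frechet_derivative g (at x) v) + B (frechet_derivative f (at x) v) (g x))) (at x)"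
      if "x \<in> S" for x
      using Suc.prems that
      by (intro bounded_bilinear.FDERIV[OF B]) (simp_all add: frechet_derivative_works[symmetric])
    show "Ck_on k S (\<lambda>x. B (f x) (frechet_derivative g (at x) v) + B (frechet_derivative f (at x) v) (g x))" for v
      using Suc.prems Ck_on_SucD[OF Suc.prems(1)] Ck_on_SucD[OF Suc.prems(2)]
      by (intro Ck_on_add \<open>open S\<close> Suc.IH) auto
  qed
qed

lemma linear_euclidean_expansion:
  fixes L :: "'a::euclidean_space \<Rightarrow> 'b::real_vector"
  assumes "linear L"
  shows "L v = (\<Sum>b\<in>Basis. (v \<bullet> b) *\<^sub>R L b)"
proof -
  have "L (\<Sum>b\<in>Basis. (v \<bullet> b) *\<^sub>R b) = (\<Sum>b\<in>Basis. (v \<bullet> b) *\<^sub>R L b)"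
    by (simp only: linear_sum[OF assms] linear_scale[OF assms])
  then show ?thesis by (simp only: euclidean_representation)
qed

text \<open>Expanding the argument of the outer derivative in a basis turns the chain rule into a finite sum of
  products in which the outer derivatives in basis directions are again composed with \<open>f\<close>. This is
  what makes the induction on \<open>k\<close> go through.\<close>

lemma Ck_on_compose:
  fixes f :: "'a::euclidean_space \<Rightarrow> 'b::euclidean_space" and g :: "'b \<Rightarrow> 'c::real_normed_vector"
  assumes "open S" "open T" "f ` S \<subseteq> T" "Ck_on k S f" "Ck_on k T g"
  shows "Ck_on k S (\<lambda>x. g (f x))"
  using assms(4,5)
proof (induction k arbitrary: g)
  case 0
  then show ?case using assms continuous_on_compose2 by auto
next
  case (Suc k)
  let ?Df = "\<lambda>x. frechet_derivative f (at x)" and ?Dg = "\<lambda>y. frechet_derivative g (at y)"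
  have lin: "linear (?Dg (f x))" if "x \<in> S" for x
    using Suc.prems assms that by (intro linear_frechet_derivative) auto
  show ?case
  proof (rule Ck_on_SucI[OF \<open>open S\<close>])
    show "((\<lambda>x. g (f x)) has_derivative (\<lambda>v. ?Dg (f x) (?Df x v))) (at x)" if "x \<in> S" for x
      using Suc.prems that assms(3)
      by (intro has_derivative_compose[of f _ x UNIV g])
        (auto simp: frechet_derivative_works[symmetric])
    show "Ck_on k S (\<lambda>x. ?Dg (f x) (?Df x v))" for v
    proof (rule Ck_on_cong[OF \<open>open S\<close>])
      show "Ck_on k S (\<lambda>x. \<Sum>b\<in>Basis. (?Df x v \<bullet> b) *\<^sub>R ?Dg (f x) b)"
      proof (intro Ck_on_sum \<open>open S\<close> Ck_on_bilinear[OF bounded_bilinear_scaleR])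
        fix b :: 'b
        show "Ck_on k S (\<lambda>x. ?Df x v \<bullet> b)"
          using Suc.prems
          by (intro Ck_on_bounded_linear_compose[OF bounded_linear_inner_left \<open>open S\<close>]) simp
        show "Ck_on k S (\<lambda>x. ?Dg (f x) b)"
          using Suc.prems Ck_on_SucD[OF Suc.prems(1)]
          by (intro Suc.IH[of "\<lambda>y. ?Dg y b"]) auto
      qed
      show "(\<Sum>b\<in>Basis. (?Df x v \<bullet> b) *\<^sub>R ?Dg (f x) b) = ?Dg (f x) (?Df x v)" if "x \<in> S" for x
        using linear_euclidean_expansion[OF lin[OF that]] by metis
    qed
  qed
qed

section \<open>Smooth germs\<close>

text \<open>Smoothness as a property of germs: its closure rules carry no domains of definition, and the
  neighborhoods reappear only in the form of filters.\<close>

definition smooth_at :: "'a::euclidean_space \<Rightarrow> ('a \<Rightarrow> 'b::real_normed_vector) \<Rightarrow> bool" where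
  "smooth_at x f \<longleftrightarrow> (\<exists>N. x \<in> N \<and> smooth_on N f)"

lemma smooth_on_imp_smooth_at: "smooth_on N f \<Longrightarrow> x \<in> N \<Longrightarrow> smooth_at x f"
  by (auto simp: smooth_at_def)

lemma smooth_on_iff_smooth_at: "smooth_on S f \<longleftrightarrow> open S \<and> (\<forall>x\<in>S. smooth_at x f)"
proof
  assume "open S \<and> (\<forall>x\<in>S. smooth_at x f)"
  then show "smooth_on S f"
    unfolding smooth_on_def smooth_at_def by (meson Ck_on_local)
qed (auto simp: smooth_on_def smooth_at_def)

lemma open_smooth_at: "open {x. smooth_at x f}"
proof (subst open_subopen, intro ballI)
  fix x assume "x \<in> {x. smooth_at x f}"
  then obtain N where "x \<in> N" "smooth_on N f" by (auto simp: smooth_at_def)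
  then show "\<exists>T. open T \<and> x \<in> T \<and> T \<subseteq> {x. smooth_at x f}"
    by (intro exI[of _ N]) (auto simp: smooth_at_def smooth_on_def)
qed

lemma smooth_on_smooth_at_set: "smooth_on {x. smooth_at x f} f"
  by (simp add: smooth_on_iff_smooth_at open_smooth_at)

lemma eventually_smooth_at: "smooth_at x f \<Longrightarrow> \<forall>\<^sub>F y in nhds x. smooth_at y f"
  using open_smooth_at[of f] by (auto simp: eventually_nhds)

lemma smooth_at_cong:
  assumes "smooth_at x f" "\<forall>\<^sub>F y in nhds x. f y = g y"
  shows "smooth_at x g"
proof -
  obtain N where N: "x \<in> N" "smooth_on N f" using assms(1) by (auto simp: smooth_at_def)
  obtain M where M: "open M" "x \<in> M" "\<And>y. y \<in> M \<Longrightarrow> f y = g y"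
    using assms(2) by (auto simp: eventually_nhds)
  have "smooth_on (N \<inter> M) g"
    using N M unfolding smooth_on_def
    by (auto intro: Ck_on_cong[of "N \<inter> M" _ f] Ck_on_subset[of _ N])
  then show ?thesis using N M by (auto simp: smooth_at_def)
qed

lemma smooth_at_imp_differentiable: "smooth_at x f \<Longrightarrow> f differentiable (at x)"
  unfolding smooth_at_def smooth_on_def using Ck_on.simps(2)[of 0] by blast

lemma smooth_at_imp_has_derivative:
  "smooth_at x f \<Longrightarrow> (f has_derivative frechet_derivative f (at x)) (at x)"
  by (simp add: smooth_at_imp_differentiable frechet_derivative_works[symmetric])

lemma smooth_at_imp_isCont: "smooth_at x f \<Longrightarrow> isCont f x"
  by (simp add: smooth_at_imp_differentiable differentiable_imp_continuous_within)

lemma smooth_at_imp_eventually: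
  "smooth_at x f \<Longrightarrow> \<forall>\<^sub>F y in nhds (f x). P y \<Longrightarrow> \<forall>\<^sub>F y in nhds x. P (f y)"
  using smooth_at_imp_isCont[of x f] isCont_def tendsto_nhds_iff
  by (metis eventually_compose_filterlim tendsto_at_iff_tendsto_nhds)

lemma smooth_at_frechet_derivative:
  assumes "smooth_at x f"
  shows "smooth_at x (\<lambda>y. frechet_derivative f (at y) v)"
proof -
  obtain N where N: "x \<in> N" "open N" "\<And>k. Ck_on k N f"
    using assms by (auto simp: smooth_at_def smooth_on_def)
  have "Ck_on k N (\<lambda>y. frechet_derivative f (at y) v)" for k
    using N(3)[of "Suc k"] by simp
  then show ?thesis using N by (auto simp: smooth_at_def smooth_on_def)
qed

lemma smooth_at_const: "smooth_at x (\<lambda>y. c)"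
  using Ck_on_const open_UNIV unfolding smooth_at_def smooth_on_def by blast

lemma smooth_at_bounded_linear: "bounded_linear L \<Longrightarrow> smooth_at x L"
  using Ck_on_bounded_linear open_UNIV unfolding smooth_at_def smooth_on_def by blast

lemma smooth_at_linear:
  fixes L :: "'a::euclidean_space \<Rightarrow> 'b::real_normed_vector"
  shows "linear L \<Longrightarrow> smooth_at x L"
  by (simp add: smooth_at_bounded_linear linear_conv_bounded_linear)

lemma smooth_at_ident: "smooth_at x (\<lambda>y. y)"
  by (rule smooth_at_bounded_linear[OF bounded_linear_ident])

lemma smooth_at_common_nhd:
  assumes "smooth_at x f" "smooth_at x g"
  obtains N where "x \<in> N" "smooth_on N f" "smooth_on N g"
proof -
  obtain N M where NM: "x \<in> N" "smooth_on N f" "x \<in> M" "smooth_on M g"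
    using assms by (auto simp: smooth_at_def)
  then have "smooth_on (N \<inter> M) f" "smooth_on (N \<inter> M) g"
    by (auto simp: smooth_on_def intro: Ck_on_subset)
  then show ?thesis using that NM by blast
qed

lemma smooth_at_bilinear:
  assumes "bounded_bilinear B" "smooth_at x f" "smooth_at x g"
  shows "smooth_at x (\<lambda>y. B (f y) (g y))"
proof -
  obtain N where "x \<in> N" "smooth_on N f" "smooth_on N g"
    using smooth_at_common_nhd assms by blast
  then show ?thesis
    by (auto simp: smooth_at_def smooth_on_def intro: Ck_on_bilinear[OF assms(1)])
qed

lemma smooth_at_add: "smooth_at x f \<Longrightarrow> smooth_at x g \<Longrightarrow> smooth_at x (\<lambda>y. f y + g y)"
  by (erule (1) smooth_at_common_nhd) (auto simp: smooth_at_def smooth_on_def intro: Ck_on_add)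

lemma smooth_at_compose:
  fixes f :: "'a::euclidean_space \<Rightarrow> 'b::euclidean_space"
  assumes "smooth_at x f" "smooth_at (f x) g"
  shows "smooth_at x (\<lambda>y. g (f y))"
proof -
  obtain N where N: "x \<in> N" "open N" "\<And>k. Ck_on k N f"
    using assms(1) by (auto simp: smooth_at_def smooth_on_def)
  obtain M where M: "f x \<in> M" "open M" "\<And>k. Ck_on k M g"
    using assms(2) by (auto simp: smooth_at_def smooth_on_def)
  have c: "continuous_on N f" using N(3)[of 0] by simp
  let ?N = "N \<inter> f -` M"
  have o: "open ?N" using continuous_open_preimage[OF c N(2) M(2)] .
  have "Ck_on k ?N (\<lambda>y. g (f y))" for k
    by (rule Ck_on_compose[OF o M(2) _ Ck_on_subset[OF N(3)] M(3)]) auto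
  then have "smooth_on ?N (\<lambda>y. g (f y))" using o by (simp add: smooth_on_def)
  then show ?thesis using smooth_on_imp_smooth_at N(1) M(1) by blast
qed

lemma smooth_at_bounded_linear_compose:
  assumes "bounded_linear L" "smooth_at x f"
  shows "smooth_at x (\<lambda>y. L (f y))"
  using assms(2) by (auto simp: smooth_at_def smooth_on_def intro: Ck_on_bounded_linear_compose[OF assms(1)])

lemma smooth_at_linear_compose:
  fixes L :: "'b::euclidean_space \<Rightarrow> 'c::real_normed_vector"
  assumes "linear L" "smooth_at x f"
  shows "smooth_at x (\<lambda>y. L (f y))"
  using assms smooth_at_bounded_linear_compose by (simp add: linear_conv_bounded_linear)

lemma smooth_at_minus: "smooth_at x f \<Longrightarrow> smooth_at x (\<lambda>y. - f y)"
  by (rule smooth_at_bounded_linear_compose[OF bounded_linear_minus[OF bounded_linear_ident]])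

lemma smooth_at_diff: "smooth_at x f \<Longrightarrow> smooth_at x g \<Longrightarrow> smooth_at x (\<lambda>y. f y - g y)"
  using smooth_at_add[of x f "\<lambda>y. - g y"] smooth_at_minus[of x g] by simp

lemma smooth_at_scaleR: "smooth_at x f \<Longrightarrow> smooth_at x g \<Longrightarrow> smooth_at x (\<lambda>y. f y *\<^sub>R g y)"
  by (rule smooth_at_bilinear[OF bounded_bilinear_scaleR])

lemma smooth_at_inner: "smooth_at x f \<Longrightarrow> smooth_at x g \<Longrightarrow> smooth_at x (\<lambda>y. f y \<bullet> g y)"
  by (rule smooth_at_bilinear[OF bounded_bilinear_inner])

lemma smooth_at_sum:
  "(\<And>i. i \<in> I \<Longrightarrow> smooth_at x (f i)) \<Longrightarrow> smooth_at x (\<lambda>y. \<Sum>i\<in>I. f i y)"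
  by (induction I rule: infinite_finite_induct) (auto intro: smooth_at_const smooth_at_add)

lemma smooth_at_fst: "smooth_at x f \<Longrightarrow> smooth_at x (\<lambda>y. fst (f y))"
  by (rule smooth_at_bounded_linear_compose[OF bounded_linear_fst])

lemma smooth_at_snd: "smooth_at x f \<Longrightarrow> smooth_at x (\<lambda>y. snd (f y))"
  by (rule smooth_at_bounded_linear_compose[OF bounded_linear_snd])

lemma smooth_at_Pair:
  assumes "smooth_at x f" "smooth_at x g"
  shows "smooth_at x (\<lambda>y. (f y, g y))"
proof -
  have "smooth_at x (\<lambda>y. (f y, 0))"
    by (rule smooth_at_bounded_linear_compose[OF _ assms(1), where L="\<lambda>u. (u, 0)"])
      (intro bounded_linear_Pair bounded_linear_ident bounded_linear_zero)
  moreover have "smooth_at x (\<lambda>y. (0, g y))"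
    by (rule smooth_at_bounded_linear_compose[OF _ assms(2), where L="\<lambda>u. (0, u)"])
      (intro bounded_linear_Pair bounded_linear_ident bounded_linear_zero)
  ultimately show ?thesis using smooth_at_add by fastforce
qed

lemmas smooth_at_intros = smooth_at_const smooth_at_ident smooth_at_add smooth_at_minus
  smooth_at_diff smooth_at_scaleR smooth_at_inner smooth_at_sum smooth_at_fst smooth_at_snd
  smooth_at_Pair


section \<open>The smooth inverse function theorem\<close>

text \<open>A product rule in which one factor is merely continuous, at the price that the other one vanishes at
  the point. It differentiates the inverse of a family of operators at a stage where only the
  continuity of the inverse is known.\<close>

lemma has_derivative_scaleR_vanishing:
  fixes \<beta> :: "'a::real_normed_vector \<Rightarrow> 'b::real_normed_vector"
  assumes s: "(s has_derivative s') (at x)" and "s x = 0" and c: "isCont \<beta> x"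
  shows "((\<lambda>y. s y *\<^sub>R \<beta> y) has_derivative (\<lambda>u. s' u *\<^sub>R \<beta> x)) (at x)"
proof -
  obtain K where K: "\<And>u. norm (s' u) \<le> norm u * K"
    using has_derivative_bounded_linear[OF s] bounded_linear.bounded by blast
  have t1: "((\<lambda>y. (s y - s x - s' (y - x)) /\<^sub>R norm (y - x)) \<longlongrightarrow> 0) (at x)"
    using s by (simp add: has_derivative_at_within)
  have t2: "((\<lambda>y. ((s y - s x - s' (y - x)) /\<^sub>R norm (y - x)) *\<^sub>R \<beta> y) \<longlongrightarrow> 0 *\<^sub>R \<beta> x) (at x)"
    using t1 c by (intro tendsto_scaleR) (auto simp: isCont_def)
  have t3: "((\<lambda>y. (s' (y - x) / norm (y - x)) *\<^sub>R (\<beta> y - \<beta> x)) \<longlongrightarrow> 0) (at x)"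
  proof (rule Lim_null_comparison)
    show "\<forall>\<^sub>F y in at x. norm ((s' (y - x) / norm (y - x)) *\<^sub>R (\<beta> y - \<beta> x)) \<le> \<bar>K\<bar> * norm (\<beta> y - \<beta> x)"
    proof (intro always_eventually allI)
      fix y
      have "\<bar>s' (y - x) / norm (y - x)\<bar> \<le> \<bar>K\<bar>"
      proof (cases "y = x")
        case False
        have "\<bar>s' (y - x)\<bar> \<le> norm (y - x) * \<bar>K\<bar>"
          using K[of "y - x"] by (smt (verit) mult_left_mono norm_ge_zero real_norm_def)
        then show ?thesis using False by (simp add: divide_simps mult.commute)
      qed simp
      then show "norm ((s' (y - x) / norm (y - x)) *\<^sub>R (\<beta> y - \<beta> x)) \<le> \<bar>K\<bar> * norm (\<beta> y - \<beta> x)"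
        by (simp only: norm_scaleR) (intro mult_right_mono; simp)
    qed
    have "((\<lambda>y. \<bar>K\<bar> * norm (\<beta> y - \<beta> x)) \<longlongrightarrow> \<bar>K\<bar> * norm (\<beta> x - \<beta> x)) (at x)"
      using c by (intro tendsto_intros) (auto simp: isCont_def)
    then show "((\<lambda>y. \<bar>K\<bar> * norm (\<beta> y - \<beta> x)) \<longlongrightarrow> 0) (at x)" by simp
  qed
  have "((\<lambda>y. (s y *\<^sub>R \<beta> y - s x *\<^sub>R \<beta> x - s' (y - x) *\<^sub>R \<beta> x) /\<^sub>R norm (y - x)) \<longlongrightarrow> 0) (at x)"
    using tendsto_add[OF t2 t3] \<open>s x = 0\<close>
    by (simp add: scaleR_diff_left scaleR_diff_right divide_inverse mult.commute algebra_simps)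
  moreover have "bounded_linear (\<lambda>u. s' u *\<^sub>R \<beta> x)"
    using has_derivative_bounded_linear[OF s] bounded_linear_scaleR_left bounded_linear_compose
    by (simp add: bounded_linear_scaleR_const)
  ultimately show ?thesis by (simp add: has_derivative_at_within)
qed

text \<open>A lower bound for the norm of \<open>A x\<close> persists near \<open>x\<close>, so the inverses are locally bounded, and
  \<open>B y v - B x v = B y ((A x - A y) (B x v))\<close> tends to 0.\<close>

lemma isCont_inverse_family:
  fixes A B :: "'a::t2_space \<Rightarrow> 'b::euclidean_space \<Rightarrow> 'b"
  assumes linA: "\<And>y. y \<in> S \<Longrightarrow> linear (A y)" and linB: "\<And>y. y \<in> S \<Longrightarrow> linear (B y)"
    and BA: "\<And>y w. y \<in> S \<Longrightarrow> B y (A y w) = w" and AB: "\<And>y w. y \<in> S \<Longrightarrow> A y (B y w) = w"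
    and "open S" "x \<in> S" and c: "\<And>w. isCont (\<lambda>y. A y w) x"
  shows "isCont (\<lambda>y. B y v) x"
proof -
  obtain K where K: "K > 0" "\<And>u. norm (B x u) \<le> K * norm u"
    using linear_bounded_pos[OF linB[OF \<open>x \<in> S\<close>]] by blast
  let ?e = "\<lambda>y. \<Sum>b\<in>Basis. norm (A y b - A x b)"
  have "(?e \<longlongrightarrow> (\<Sum>b\<in>(Basis::'b set). norm (A x b - A x b))) (at x)"
    using c by (intro tendsto_intros) (auto simp: isCont_def)
  then have "(?e \<longlongrightarrow> 0) (at x)" by simp
  then have e: "\<forall>\<^sub>F y in at x. ?e y < 1 / (2 * K)"
    using K(1) by (intro order_tendstoD(2)[of _ 0]) auto
  have S: "\<forall>\<^sub>F y in at x. y \<in> S" using \<open>open S\<close> \<open>x \<in> S\<close> by (auto simp: eventually_at_topological)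
  have bnd: "norm (B y u) \<le> 2 * K * norm u" if "?e y < 1 / (2 * K)" "y \<in> S" for y u
  proof -
    let ?w = "B y u"
    have "A x ?w - A y ?w = (\<Sum>b\<in>Basis. (?w \<bullet> b) *\<^sub>R (A x b - A y b))"
      using linear_euclidean_expansion[OF linA[OF \<open>x \<in> S\<close>], of ?w]
        linear_euclidean_expansion[OF linA[OF \<open>y \<in> S\<close>], of ?w]
      by (simp add: scaleR_diff_right sum_subtractf)
    also have "norm \<dots> \<le> (\<Sum>b\<in>Basis. norm ?w * norm (A x b - A y b))"
      by (intro sum_norm_le) (auto intro!: mult_right_mono simp: Basis_le_norm)
    also have "\<dots> = norm ?w * ?e y" by (simp add: sum_distrib_left norm_minus_commute)
    also have "\<dots> \<le> norm ?w * (1 / (2 * K))" using that by (intro mult_left_mono) auto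
    finally have 1: "norm (A x ?w) \<le> norm u + norm ?w / (2 * K)"
      using AB[OF \<open>y \<in> S\<close>, of u] norm_triangle_sub[of "A x ?w" "A y ?w"] by simp
    have "norm ?w \<le> K * norm (A x ?w)" using K(2)[of "A x ?w"] BA[OF \<open>x \<in> S\<close>] by simp
    also have "\<dots> \<le> K * (norm u + norm ?w / (2 * K))" using 1 K(1) by (intro mult_left_mono) auto
    also have "\<dots> = K * norm u + norm ?w / 2" using K(1) by (simp add: field_simps)
    finally show ?thesis by simp
  qed
  let ?w = "B x v"
  have "((\<lambda>y. B y v - B x v) \<longlongrightarrow> 0) (at x)"
  proof (rule Lim_null_comparison)
    show "\<forall>\<^sub>F y in at x. norm (B y v - B x v) \<le> 2 * K * norm (A x ?w - A y ?w)"
      using e S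
    proof eventually_elim
      case (elim y)
      have "B y v - B x v = B y (A x ?w - A y ?w)"
        using AB[OF \<open>x \<in> S\<close>] BA[OF \<open>y \<in> S\<close>] linear_diff[OF linB[OF \<open>y \<in> S\<close>]] by simp
      then show ?case using bnd[OF elim] by simp
    qed
    have "((\<lambda>y. 2 * K * norm (A x ?w - A y ?w)) \<longlongrightarrow> 2 * K * norm (A x ?w - A x ?w)) (at x)"
      using c by (intro tendsto_intros) (auto simp: isCont_def)
    then show "((\<lambda>y. 2 * K * norm (A x ?w - A y ?w)) \<longlongrightarrow> 0) (at x)" by simp
  qed
  then show ?thesis unfolding isCont_def by (simp add: LIM_zero_iff)
qed

text \<open>With \<open>w = B x v\<close> one has \<open>B y v = w - B y (A y w - A x w)\<close>, hence the derivative of \<open>B \<cdot> v\<close> at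
  \<open>x\<close> in direction \<open>u\<close> is \<open>- B x (D u w)\<close>, where \<open>D u w\<close> is the derivative of \<open>A \<cdot> w\<close>. Written in a
  basis, it only involves \<open>B\<close> itself and first derivatives of \<open>A\<close>, so one order of smoothness is
  gained from the previous one.\<close>

lemma Ck_on_inverse_family:
  fixes A B :: "'a::euclidean_space \<Rightarrow> 'b::euclidean_space \<Rightarrow> 'b"
  assumes linA: "\<And>y. y \<in> S \<Longrightarrow> linear (A y)" and linB: "\<And>y. y \<in> S \<Longrightarrow> linear (B y)"
    and BA: "\<And>y w. y \<in> S \<Longrightarrow> B y (A y w) = w" and AB: "\<And>y w. y \<in> S \<Longrightarrow> A y (B y w) = w"
    and "open S" and c: "\<And>w. Ck_on k S (\<lambda>y. A y w)"
  shows "Ck_on k S (\<lambda>y. B y v)"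
  using c
proof (induction k arbitrary: v)
  case 0
  have "isCont (\<lambda>y. B y v) x" if x: "x \<in> S" for x
  proof (rule isCont_inverse_family[where S=S and A=A and B=B and x=x and v=v])
    show "isCont (\<lambda>y. A y w) x" for w
      using 0 x \<open>open S\<close> by (simp add: continuous_on_eq_continuous_at)
  qed (simp_all add: linA linB BA AB \<open>open S\<close> x)
  then show ?case by (simp add: continuous_at_imp_continuous_on)
next
  case (Suc k)
  have Ak: "Ck_on k S (\<lambda>y. A y w)" for w using Suc.prems Ck_on_SucD by blast
  note Bk = Suc.IH[OF Ak]
  define D where "D w x = frechet_derivative (\<lambda>y. A y w) (at x)" for w x
  have D: "((\<lambda>y. A y w) has_derivative D w x) (at x)" if "x \<in> S" for x w
    using Suc.prems that by (simp add: D_def frechet_derivative_works[symmetric])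
  have contB: "isCont (\<lambda>y. B y w) x" if "x \<in> S" for x w
  proof (rule isCont_inverse_family[where S=S and A=A and B=B and x=x and v=w])
    show "isCont (\<lambda>y. A y u) x" for u
      using D[OF that] has_derivative_continuous by blast
  qed (simp_all add: linA linB BA AB \<open>open S\<close> that)
  show ?case
  proof (rule Ck_on_SucI[OF \<open>open S\<close>])
    fix x assume x: "x \<in> S"
    let ?w = "B x v"
    let ?s = "\<lambda>b y. (A y ?w - A x ?w) \<bullet> b"
    have "((\<lambda>y. ?s b y *\<^sub>R B y b) has_derivative (\<lambda>u. (D ?w x u \<bullet> b) *\<^sub>R B x b)) (at x)" for b
    proof (rule has_derivative_scaleR_vanishing)
      have "((\<lambda>y. (A y ?w - A x ?w) \<bullet> b) has_derivative (\<lambda>u. (D ?w x u - 0) \<bullet> b)) (at x)"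
        by (intro bounded_linear.has_derivative[OF bounded_linear_inner_left]
            has_derivative_diff D x has_derivative_const)
      then show "(?s b has_derivative (\<lambda>u. D ?w x u \<bullet> b)) (at x)" by simp
    qed (use contB x in auto)
    then have "((\<lambda>y. B x v - (\<Sum>b\<in>Basis. ?s b y *\<^sub>R B y b)) has_derivative
       (\<lambda>u. 0 - (\<Sum>b\<in>Basis. (D ?w x u \<bullet> b) *\<^sub>R B x b))) (at x)"
      by (intro has_derivative_diff has_derivative_const has_derivative_sum)
    moreover have "B x v - (\<Sum>b\<in>Basis. ?s b y *\<^sub>R B y b) = B y v" if "y \<in> S" for y
    proof -
      have "(\<Sum>b\<in>Basis. ?s b y *\<^sub>R B y b) = B y (A y ?w - A x ?w)"
        using linear_euclidean_expansion[OF linB[OF that]] by metis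
      also have "\<dots> = B x v - B y v"
        using AB[OF x] BA[OF that] linear_diff[OF linB[OF that]] by simp
      finally show ?thesis by simp
    qed
    moreover have "(\<Sum>b\<in>Basis. (D ?w x u \<bullet> b) *\<^sub>R B x b) =
       (\<Sum>b\<in>Basis. \<Sum>c\<in>Basis. ((?w \<bullet> c) * (D c x u \<bullet> b)) *\<^sub>R B x b)" for u
    proof -
      have "((\<lambda>y. \<Sum>c\<in>Basis. (?w \<bullet> c) *\<^sub>R A y c) has_derivative
        (\<lambda>u. \<Sum>c\<in>Basis. (?w \<bullet> c) *\<^sub>R D c x u)) (at x)"
        by (intro has_derivative_sum bounded_linear.has_derivative[OF bounded_linear_scaleR_right] D x)
      then have "((\<lambda>y. A y ?w) has_derivative (\<lambda>u. \<Sum>c\<in>Basis. (?w \<bullet> c) *\<^sub>R D c x u)) (at x)"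
      proof (rule has_derivative_transform_within_open[OF _ \<open>open S\<close> x])
        show "(\<Sum>c\<in>Basis. (?w \<bullet> c) *\<^sub>R A y c) = A y ?w" if "y \<in> S" for y
          using linear_euclidean_expansion[OF linA[OF that], of ?w] by simp
      qed
      then have "D ?w x = (\<lambda>u. \<Sum>c\<in>Basis. (?w \<bullet> c) *\<^sub>R D c x u)"
        using D[OF x] has_derivative_unique by blast
      then show ?thesis by (simp add: inner_sum_left scaleR_sum_left)
    qed
    ultimately show "((\<lambda>y. B y v) has_derivative (\<lambda>u. 0 -
       (\<Sum>b\<in>Basis. \<Sum>c\<in>Basis. ((B x v \<bullet> c) * (D c x u \<bullet> b)) *\<^sub>R B x b))) (at x)"
      using has_derivative_transform_within_open[OF _ \<open>open S\<close> x] by fastforce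
  next
    fix u
    have "Ck_on k S (\<lambda>x. D c x u)" for c using Suc.prems by (simp add: D_def)
    then have "Ck_on k S (\<lambda>x. \<Sum>b\<in>Basis. \<Sum>c\<in>Basis. ((B x v \<bullet> c) * (D c x u \<bullet> b)) *\<^sub>R B x b)"
      by (intro Ck_on_sum Ck_on_bilinear[OF bounded_bilinear_scaleR] Ck_on_bilinear[OF bounded_bilinear_mult]
          Ck_on_bounded_linear_compose[OF bounded_linear_inner_left] Bk \<open>open S\<close>)
    from Ck_on_bounded_linear_compose[OF bounded_linear_minus[OF bounded_linear_ident] \<open>open S\<close> this]
    show "Ck_on k S (\<lambda>x. 0 - (\<Sum>b\<in>Basis. \<Sum>c\<in>Basis. ((B x v \<bullet> c) * (D c x u \<bullet> b)) *\<^sub>R B x b))"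
      by simp
  qed
qed

text \<open>The derivative of the local inverse \<open>g\<close> at \<open>y\<close> is the inverse of the derivative of \<open>f\<close> at
  \<open>g y\<close>. If \<open>g\<close> is \<open>k\<close> times continuously differentiable, so is this family of operators, and then
  \<open>g\<close> is one order better.\<close>

theorem smooth_inverse_function:
  fixes f :: "'a::euclidean_space \<Rightarrow> 'a"
  assumes "smooth_at x0 f" and inj: "\<And>v. frechet_derivative f (at x0) v = 0 \<Longrightarrow> v = 0"
  obtains U V g where "open U" "x0 \<in> U" "open V" "f x0 \<in> V" "homeomorphism U V f g" "smooth_on V g"
    "\<And>x. x \<in> U \<Longrightarrow> smooth_at x f"
proof -
  define S where "S = {x. smooth_at x f}"
  have S: "open S" "x0 \<in> S" "\<And>k. Ck_on k S f"
    using open_smooth_at[of f] smooth_on_smooth_at_set[of f] assms by (auto simp: S_def smooth_on_def)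
  define f' where "f' x = Blinfun (frechet_derivative f (at x))" for x
  have D: "(f has_derivative frechet_derivative f (at x)) (at x)" if "x \<in> S" for x
    using that by (simp add: S_def smooth_at_imp_has_derivative)
  have f': "blinfun_apply (f' x) = frechet_derivative f (at x)" if "x \<in> S" for x
    using has_derivative_bounded_linear[OF D[OF that]] by (simp add: f'_def bounded_linear_Blinfun_apply)
  have cont: "continuous_on S f'"
  proof (rule continuous_on_blinfun_componentwise)
    fix i :: 'a
    have "continuous_on S (\<lambda>x. frechet_derivative f (at x) i)" using S(3)[of "Suc 0"] by simp
    then show "continuous_on S (\<lambda>x. blinfun_apply (f' x) i)" by (simp add: f' cong: continuous_on_cong)
  qed
  have lin0: "linear (frechet_derivative f (at x0))"
    using has_derivative_bounded_linear[OF D[OF S(2)]] bounded_linear.linear by blast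
  then have "inj (frechet_derivative f (at x0))" using inj by (simp add: linear_injective_0)
  then obtain h where h: "linear h" "h \<circ> frechet_derivative f (at x0) = id"
    using linear_injective_left_inverse[OF lin0] by blast
  have inv0: "Blinfun h o\<^sub>L f' x0 = id_blinfun"
  proof (rule blinfun_eqI)
    fix i
    have "blinfun_apply (Blinfun h) = h"
      using h(1) by (simp add: bounded_linear_Blinfun_apply linear_conv_bounded_linear)
    then show "blinfun_apply (Blinfun h o\<^sub>L f' x0) i = blinfun_apply id_blinfun i"
      using h(2) by (simp add: f'[OF S(2)] pointfree_idE)
  qed
  have Df: "(f has_derivative blinfun_apply (f' x)) (at x)" if "x \<in> S" for x
    using D[OF that] f'[OF that] by simp
  obtain U V g g' where UV: "open U" "U \<subseteq> S" "x0 \<in> U" "open V" "f x0 \<in> V" "homeomorphism U V f g"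
    and g: "\<And>y. y \<in> V \<Longrightarrow> (g has_derivative (g' y)) (at y)"
    "\<And>y. y \<in> V \<Longrightarrow> g' y = inv (blinfun_apply (f' (g y)))"
    "\<And>y. y \<in> V \<Longrightarrow> bij (blinfun_apply (f' (g y)))"
    by (rule inverse_function_theorem[OF S(1) Df cont S(2) inv0]) blast+
  have gV: "g ` V = U" using UV(6) by (simp add: homeomorphism_def)
  then have gS: "g y \<in> S" if "y \<in> V" for y using UV(2) that by blast
  have "Ck_on k V g" for k
  proof (induction k)
    case 0
    then show ?case using UV(6) by (simp add: homeomorphism_def)
  next
    case (Suc k)
    show ?case
    proof (rule Ck_on_SucI[OF \<open>open V\<close> g(1)])
      show "Ck_on k V (\<lambda>y. g' y v)" for v
      proof (rule Ck_on_inverse_family[where A="\<lambda>y. frechet_derivative f (at (g y))"])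
        fix y assume y: "y \<in> V"
        show "linear (frechet_derivative f (at (g y)))"
          using D[OF gS[OF y]] has_derivative_linear by blast
        show "linear (g' y)" using g(1)[OF y] has_derivative_linear by blast
        fix w
        show "g' y (frechet_derivative f (at (g y)) w) = w"
          using g(2,3)[OF y] f'[OF gS[OF y]] by (simp add: bij_is_inj)
        show "frechet_derivative f (at (g y)) (g' y w) = w"
          using g(2,3)[OF y] f'[OF gS[OF y]] by (simp add: bij_is_surj surj_f_inv_f)
      next
        fix w
        have "Ck_on k S (\<lambda>x. frechet_derivative f (at x) w)" using S(3)[of "Suc k"] by simp
        moreover have "g ` V \<subseteq> S" using gV UV(2) by simp
        ultimately show "Ck_on k V (\<lambda>y. frechet_derivative f (at (g y)) w)"
          using Ck_on_compose[OF \<open>open V\<close> \<open>open S\<close> _ Suc] by blast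
      qed (fact \<open>open V\<close>)
    qed
  qed
  then have "smooth_on V g" using UV(4) by (simp add: smooth_on_def)
  moreover have "smooth_at x f" if "x \<in> U" for x using UV(2) that by (auto simp: S_def)
  ultimately show ?thesis by (rule that[OF UV(1,3-6)])
qed

section \<open>Tangent vectors, level sets and nearest points\<close>

lemma tangent_spaceI:
  assumes "smooth_at 0 \<gamma>" "\<forall>\<^sub>F t in nhds 0. \<gamma> t \<in> M" "\<gamma> 0 = x" "(\<gamma> has_vector_derivative v) (at 0)"
  shows "v \<in> tangent_space M x"
proof -
  have "\<forall>\<^sub>F t in nhds 0. smooth_at t \<gamma> \<and> \<gamma> t \<in> M"
    using eventually_smooth_at[OF assms(1)] assms(2) by eventually_elim simp
  then obtain \<epsilon> where \<epsilon>: "\<epsilon> > 0" "\<And>t. dist t 0 < \<epsilon> \<Longrightarrow> smooth_at t \<gamma> \<and> \<gamma> t \<in> M"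
    by (auto simp: eventually_nhds_metric)
  then have "smooth_on {-\<epsilon><..<\<epsilon>} \<gamma>" "\<gamma> ` {-\<epsilon><..<\<epsilon>} \<subseteq> M"
    by (auto simp: smooth_on_iff_smooth_at dist_real_def)
  then show ?thesis using assms(3,4) \<epsilon>(1) unfolding tangent_space_def by blast
qed

lemma tangent_spaceE:
  assumes "v \<in> tangent_space M x"
  obtains \<gamma> where "smooth_at 0 \<gamma>" "\<forall>\<^sub>F t in nhds 0. \<gamma> t \<in> M" "\<gamma> 0 = x"
    "(\<gamma> has_vector_derivative v) (at 0)"
proof -
  obtain \<gamma> \<epsilon> where g: "\<epsilon> > 0" "smooth_on {-\<epsilon><..<\<epsilon>} \<gamma>" "\<gamma> ` {-\<epsilon><..<\<epsilon>} \<subseteq> M" "\<gamma> 0 = x"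
    "(\<gamma> has_vector_derivative v) (at (0::real))"
    using assms unfolding tangent_space_def by blast
  have "\<forall>\<^sub>F t in nhds 0. t \<in> {-\<epsilon><..<\<epsilon>}"
    using g(1) by (intro eventually_nhds_in_open) auto
  then have "\<forall>\<^sub>F t in nhds 0. \<gamma> t \<in> M" by eventually_elim (use g(3) in blast)
  moreover have "smooth_at 0 \<gamma>" using g(1,2) by (intro smooth_on_imp_smooth_at) auto
  ultimately show ?thesis using that g(4,5) by blast
qed

lemma tangent_space_base: "v \<in> tangent_space M x \<Longrightarrow> x \<in> M"
  by (erule tangent_spaceE) (auto dest: eventually_nhds_x_imp_x)

lemma zero_in_tangent_space: "x \<in> M \<Longrightarrow> 0 \<in> tangent_space M x"
  by (rule tangent_spaceI[of "\<lambda>_. x"]) (auto intro: smooth_at_const)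

lemma tangent_space_scaleR:
  assumes "v \<in> tangent_space M x"
  shows "a *\<^sub>R v \<in> tangent_space M x"
proof -
  obtain \<gamma> where \<gamma>: "smooth_at 0 \<gamma>" "\<forall>\<^sub>F t in nhds 0. \<gamma> t \<in> M" "\<gamma> 0 = x"
    "(\<gamma> has_vector_derivative v) (at 0)"
    using assms by (rule tangent_spaceE)
  have l: "smooth_at 0 (\<lambda>t::real. a * t)"
    using smooth_at_bounded_linear[OF bounded_linear_mult_right] .
  show ?thesis
  proof (rule tangent_spaceI[of "\<lambda>t. \<gamma> (a * t)"])
    show "smooth_at 0 (\<lambda>t. \<gamma> (a * t))"
      using smooth_at_compose[OF l, of \<gamma>] \<gamma>(1) by simp
    show "\<forall>\<^sub>F t in nhds 0. \<gamma> (a * t) \<in> M"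
      using smooth_at_imp_eventually[OF l] \<gamma>(2) by simp
    have "((\<lambda>t. a * t) has_vector_derivative a) (at 0)"
      by (auto intro!: derivative_eq_intros simp: has_real_derivative_iff_has_vector_derivative[symmetric])
    from vector_diff_chain_at[OF this, of \<gamma> v] \<gamma>(4)
    show "((\<lambda>t. \<gamma> (a * t)) has_vector_derivative a *\<^sub>R v) (at 0)" by (simp add: o_def)
  qed (use \<gamma> in simp)
qed

lemma smooth_at_imp_has_vector_derivative:
  "smooth_at t \<gamma> \<Longrightarrow> (\<gamma> has_vector_derivative frechet_derivative \<gamma> (at t) 1) (at t)"
proof -
  assume "smooth_at t \<gamma>"
  then have d: "(\<gamma> has_derivative frechet_derivative \<gamma> (at t)) (at t)"
    by (rule smooth_at_imp_has_derivative)
  have "(\<gamma> has_derivative (\<lambda>x. x *\<^sub>R frechet_derivative \<gamma> (at t) 1)) (at t)"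
  proof (rule has_derivative_eq_rhs[OF d], rule ext)
    show "frechet_derivative \<gamma> (at t) x = x *\<^sub>R frechet_derivative \<gamma> (at t) 1" for x
      using linear_scale[OF has_derivative_linear[OF d], of x 1] by simp
  qed
  then show ?thesis by (simp only: has_vector_derivative_def)
qed

lemma has_vector_derivative_smooth_compose:
  assumes "smooth_at (\<gamma> t) f" "(\<gamma> has_vector_derivative v) (at t)"
  shows "((\<lambda>s. f (\<gamma> s)) has_vector_derivative frechet_derivative f (at (\<gamma> t)) v) (at t)"
  using vector_derivative_diff_chain_within[OF assms(2), of f] smooth_at_imp_has_derivative[OF assms(1)]
  by (simp add: o_def has_derivative_at_withinI)

lemma nearest_point_orthogonal_tangent_space:
  assumes "\<And>w. w \<in> S \<Longrightarrow> dist z y \<le> dist z w" "v \<in> tangent_space S y"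
  shows "(z - y) \<bullet> v = 0"
proof -
  obtain \<gamma> where \<gamma>: "smooth_at 0 \<gamma>" "\<forall>\<^sub>F t in nhds 0. \<gamma> t \<in> S" "\<gamma> 0 = y"
    "(\<gamma> has_vector_derivative v) (at 0)"
    using assms(2) by (rule tangent_spaceE)
  let ?\<phi> = "\<lambda>t. (z - \<gamma> t) \<bullet> (z - \<gamma> t)"
  have "(?\<phi> has_vector_derivative (z - \<gamma> 0) \<bullet> (0 - v) + (0 - v) \<bullet> (z - \<gamma> 0)) (at 0)"
    by (intro bounded_bilinear.has_vector_derivative[OF bounded_bilinear_inner]
        has_vector_derivative_diff has_vector_derivative_const \<gamma>(4))
  then have d: "(?\<phi> has_real_derivative - 2 * ((z - y) \<bullet> v)) (at 0)"
    using \<gamma>(3) by (simp add: has_real_derivative_iff_has_vector_derivative inner_commute)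
  obtain \<epsilon> where \<epsilon>: "\<epsilon> > 0" "\<And>t. dist t 0 < \<epsilon> \<Longrightarrow> \<gamma> t \<in> S"
    using \<gamma>(2) by (auto simp: eventually_nhds_metric)
  have "?\<phi> 0 \<le> ?\<phi> t" if "\<bar>0 - t\<bar> < \<epsilon>" for t
  proof -
    have "norm (z - y) \<le> norm (z - \<gamma> t)"
      using assms(1)[OF \<epsilon>(2)[of t]] that by (simp add: dist_real_def dist_norm)
    then show ?thesis using \<gamma>(3) by (simp add: norm_le)
  qed
  then show ?thesis using DERIV_local_min[OF d \<epsilon>(1)] by simp
qed

text \<open>Let \<open>D\<close> be the derivative of \<open>F\<close> at \<open>y\<close> and \<open>B\<close> a linear right inverse of it. The map
  \<open>x \<mapsto> x + B (F x - D x)\<close> has derivative the identity at \<open>y\<close> and straightens the level set,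
  because \<open>D\<close> applied to it gives \<open>F x\<close>. A kernel vector \<open>k\<close> is the velocity of the preimage of the
  line in direction \<open>k\<close>.\<close>

lemma kernel_subset_tangent_space_level_set:
  fixes F :: "'a::euclidean_space \<Rightarrow> 'b::euclidean_space"
  assumes "smooth_at y F" "F y = 0" and surj: "surj (frechet_derivative F (at y))"
    and k: "frechet_derivative F (at y) k = 0"
  shows "k \<in> tangent_space {x. F x = 0} y"
proof -
  let ?D = "frechet_derivative F (at y)"
  have lin: "linear ?D" using smooth_at_imp_has_derivative[OF assms(1)] has_derivative_linear by blast
  obtain B where B: "linear B" "?D \<circ> B = id" using linear_surjective_right_inverse[OF lin surj] by blast
  then have DB: "?D (B w) = w" for w by (metis comp_apply id_apply)
  define \<phi> where "\<phi> x = x + B (F x - ?D x)" for x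
  have D\<phi>: "?D (\<phi> x) = F x" for x by (simp add: \<phi>_def linear_add[OF lin] DB)
  have s: "smooth_at y \<phi>" unfolding \<phi>_def
    by (intro smooth_at_intros smooth_at_linear_compose[OF B(1)] assms(1) smooth_at_linear[OF lin])
  have "(\<phi> has_derivative (\<lambda>v. v + B (?D v - ?D v))) (at y)"
    unfolding \<phi>_def using B(1) lin
    by (intro has_derivative_add has_derivative_ident bounded_linear.has_derivative[of B] has_derivative_diff
        smooth_at_imp_has_derivative assms(1) bounded_linear_imp_has_derivative)
      (simp_all add: linear_conv_bounded_linear)
  then have "(\<phi> has_derivative (\<lambda>v. v)) (at y)" using linear_0[OF B(1)] by simp
  then have \<phi>': "frechet_derivative \<phi> (at y) = (\<lambda>v. v)" by (metis frechet_derivative_at)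
  obtain U V g where UV: "open U" "y \<in> U" "open V" "\<phi> y \<in> V" "homeomorphism U V \<phi> g" "smooth_on V g"
    by (rule smooth_inverse_function[OF s]) (simp_all add: \<phi>')
  let ?l = "\<lambda>t::real. \<phi> y + t *\<^sub>R k"
  have l: "smooth_at 0 ?l" by (intro smooth_at_intros)
  have g: "smooth_at (\<phi> y) g" using UV smooth_on_imp_smooth_at by blast
  have V: "\<forall>\<^sub>F t in nhds 0. ?l t \<in> V"
    using smooth_at_imp_eventually[OF l, of "\<lambda>y. y \<in> V"] eventually_nhds_in_open[OF UV(3,4)] by simp
  have gl: "smooth_at 0 (\<lambda>t. g (?l t))" using smooth_at_compose[OF l, of g] g by simp
  have gy: "g (\<phi> y) = y" using UV by (simp add: homeomorphism_def)
  have inv: "\<forall>\<^sub>F t in nhds 0. \<phi> (g (?l t)) = ?l t"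
    using V by eventually_elim (use UV(5) in \<open>simp add: homeomorphism_def\<close>)
  let ?v = "frechet_derivative (\<lambda>t. g (?l t)) (at 0) 1"
  have d: "((\<lambda>t. g (?l t)) has_vector_derivative ?v) (at 0)"
    by (rule smooth_at_imp_has_vector_derivative[OF gl])
  have "((\<lambda>t. \<phi> (g (?l t))) has_vector_derivative ?v) (at 0)"
    using has_vector_derivative_smooth_compose[OF _ d, of \<phi>] s gy \<phi>' by simp
  moreover have "(?l has_vector_derivative k) (at 0)"
    by (auto intro!: derivative_eq_intros)
  moreover have "((\<lambda>t. \<phi> (g (?l t))) has_vector_derivative ?v) (at 0) = (?l has_vector_derivative ?v) (at 0)"
    by (rule has_vector_derivative_cong_ev) (use inv in \<open>auto elim: eventually_mono dest: eventually_nhds_x_imp_x\<close>)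
  ultimately have "?v = k" using vector_derivative_unique_at by blast
  then show ?thesis
  proof (intro tangent_spaceI[of "\<lambda>t. g (?l t)"] gl)
    show "\<forall>\<^sub>F t in nhds 0. g (?l t) \<in> {x. F x = 0}"
      using inv
    proof eventually_elim
      case (elim t)
      have "F (g (?l t)) = ?D (?l t)" using D\<phi>[of "g (?l t)"] elim by simp
      also have "\<dots> = 0" using D\<phi>[of y] k assms(2) by (simp add: linear_add[OF lin] linear_scale[OF lin])
      finally show ?case by simp
    qed
  qed (use gy d in auto)
qed

text \<open>Since \<open>D\<close> is onto, \<open>D\<close> composed with its adjoint is invertible, so there is an \<open>l\<close> for which
  \<open>u - adjoint D l\<close> lies in the kernel; this difference is orthogonal to itself.\<close>

lemma orthogonal_to_kernel_imp_range_adjoint: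
  fixes D :: "'a::euclidean_space \<Rightarrow> 'b::euclidean_space"
  assumes lin: "linear D" and surj: "surj D" and u: "\<And>k. D k = 0 \<Longrightarrow> u \<bullet> k = 0"
  shows "\<exists>l. u = adjoint D l"
proof -
  have linA: "linear (adjoint D)" using adjoint_linear[OF lin] .
  have inj0: "l = 0" if "D (adjoint D l) = 0" for l
  proof -
    have "adjoint D l \<bullet> adjoint D l = D (adjoint D l) \<bullet> l" by (simp add: adjoint_works[OF lin])
    then have a: "adjoint D l = 0" using that by simp
    obtain x where "D x = l" using surj by (metis surjD)
    then have "l \<bullet> l = x \<bullet> adjoint D l" by (simp add: adjoint_works[OF lin])
    then show ?thesis using a by simp
  qed
  have linT: "linear (D \<circ> adjoint D)" using linA lin by (rule linear_compose)
  then have "inj (D \<circ> adjoint D)" using inj0 by (simp add: linear_injective_0)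
  then have "surj (D \<circ> adjoint D)" using linT linear_injective_imp_surjective by blast
  then obtain l where l: "D (adjoint D l) = D u" by (metis comp_apply surjD)
  let ?k = "u - adjoint D l"
  have "D ?k = 0" by (simp add: linear_diff[OF lin] l)
  then have "u \<bullet> ?k = 0" "?k \<bullet> adjoint D l = 0" using u by (auto simp: adjoint_works[OF lin])
  then have "?k \<bullet> ?k = 0" by (simp add: inner_diff_left inner_commute)
  then show ?thesis by auto
qed

text \<open>Near \<open>(y0, 0)\<close> the Lagrange map \<open>\<Psi>\<close>, sending a point \<open>y\<close> and a multiplier \<open>l\<close> to
  \<open>(y + adjoint (D y) l, F y)\<close>, is a local diffeomorphism. A point \<open>y\<close> of the level set nearest to
  \<open>z\<close> satisfies \<open>\<Psi> (y, l) = (z, 0)\<close> for some \<open>l\<close>, and \<open>l\<close> is bounded by a multiple of the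
  distance from \<open>z\<close> to \<open>y\<close>. So if \<open>z\<close> is close to \<open>y0\<close>, then \<open>(y, l)\<close> is in the range of the
  local inverse and \<open>y\<close> is its first component at \<open>(z, 0)\<close>.\<close>

theorem smooth_local_projection:
  fixes F :: "'a::euclidean_space \<Rightarrow> 'b::euclidean_space"
  assumes F: "smooth_on UNIV F" and surj: "\<And>y. F y = 0 \<Longrightarrow> surj (frechet_derivative F (at y))"
    and y0: "F y0 = 0"
  obtains P where "smooth_at y0 P"
    "\<forall>\<^sub>F z in nhds y0. F (P z) = 0 \<and> (\<forall>w. F w = 0 \<longrightarrow> dist z (P z) \<le> dist z w) \<and>
       (\<forall>y. F y = 0 \<and> (\<forall>w. F w = 0 \<longrightarrow> dist z y \<le> dist z w) \<longrightarrow> y = P z)"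
proof -
  let ?D = "\<lambda>y. frechet_derivative F (at y)"
  have Fs: "smooth_at y F" for y using F smooth_on_imp_smooth_at by blast
  have DF: "(F has_derivative ?D y) (at y)" for y using Fs smooth_at_imp_has_derivative by blast
  have lin: "linear (?D y)" for y using DF has_derivative_linear by blast
  define \<Psi> where "\<Psi> = (\<lambda>p. (fst p + (\<Sum>b\<in>Basis. (?D (fst p) b \<bullet> snd p) *\<^sub>R b), F (fst p)))"
  have \<Psi>_adj: "\<Psi> (y, l) = (y + adjoint (?D y) l, F y)" for y l
  proof -
    have "adjoint (?D y) l = (\<Sum>b\<in>Basis. (adjoint (?D y) l \<bullet> b) *\<^sub>R b)"
      by (simp add: euclidean_representation)
    also have "\<dots> = (\<Sum>b\<in>Basis. (?D y b \<bullet> l) *\<^sub>R b)"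
      by (intro sum.cong refl) (metis adjoint_works[OF lin] inner_commute)
    finally show ?thesis by (simp add: \<Psi>_def)
  qed
  have Ds: "smooth_at y (\<lambda>x. ?D x v)" for y v using smooth_at_frechet_derivative[OF Fs] .
  have \<Psi>s: "smooth_at (y0, 0) \<Psi>" unfolding \<Psi>_def
    by (intro smooth_at_intros smooth_at_compose[of _ fst "\<lambda>y. ?D y _"] smooth_at_compose[of _ fst F]
        Ds Fs smooth_at_bounded_linear[OF bounded_linear_fst] smooth_at_bounded_linear[OF bounded_linear_snd])
  have "(\<Psi> has_derivative (\<lambda>h. (fst h + (\<Sum>b\<in>Basis. (?D (fst (y0, 0::'b)) b \<bullet> snd h +
      frechet_derivative (\<lambda>x. ?D x b) (at (fst (y0, 0::'b))) (fst h) \<bullet> snd (y0, 0::'b)) *\<^sub>R b),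
      ?D (fst (y0, 0::'b)) (fst h)))) (at (y0, 0))"
    unfolding \<Psi>_def
    by (intro has_derivative_Pair has_derivative_add has_derivative_sum
        bounded_linear.has_derivative[OF bounded_linear_scaleR_left]
        has_derivative_inner
        has_derivative_compose[of fst fst _ UNIV "\<lambda>x. ?D x _"]
        has_derivative_compose[of fst fst _ UNIV F] DF
        smooth_at_imp_has_derivative[OF Ds] 
        bounded_linear_imp_has_derivative[OF bounded_linear_fst] bounded_linear_imp_has_derivative[OF bounded_linear_snd])
  then have "frechet_derivative \<Psi> (at (y0, 0)) = (\<lambda>h. (fst h + (\<Sum>b\<in>Basis. (?D y0 b \<bullet> snd h) *\<^sub>R b), ?D y0 (fst h)))"
    using frechet_derivative_at by fastforce
  moreover have "(\<Sum>b\<in>Basis. (?D y0 b \<bullet> l) *\<^sub>R b) = adjoint (?D y0) l" for l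
    using \<Psi>_adj[of y0 l] by (simp add: \<Psi>_def)
  ultimately have \<Psi>': "frechet_derivative \<Psi> (at (y0, 0)) (a, l) = (a + adjoint (?D y0) l, ?D y0 a)" for a l
    by simp
  have inj: "v = 0" if "frechet_derivative \<Psi> (at (y0, 0)) v = 0" for v
  proof -
    obtain a l where v: "v = (a, l)" by force
    have e: "a + adjoint (?D y0) l = 0" "?D y0 a = 0" using that v \<Psi>' by (auto simp: zero_prod_def)
    have "a \<bullet> (a + adjoint (?D y0) l) = a \<bullet> a" using e(2) by (simp add: inner_add_right adjoint_works[OF lin])
    then have a: "a = 0" using e(1) by simp
    obtain x where "?D y0 x = l" using surj[OF y0] by (metis surjD)
    then have "l \<bullet> l = x \<bullet> adjoint (?D y0) l" by (simp add: adjoint_works[OF lin])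
    then have "l = 0" using e(1) a by simp
    then show ?thesis using v a by (simp add: zero_prod_def)
  qed
  obtain U V g where UV: "open U" "(y0, 0) \<in> U" "open V" "\<Psi> (y0, 0) \<in> V" "homeomorphism U V \<Psi> g" "smooth_on V g"
    by (rule smooth_inverse_function[OF \<Psi>s inj]) blast
  have \<Psi>0: "\<Psi> (y0, 0) = (y0, 0)" using y0 by (simp add: \<Psi>_adj linear_0[OF adjoint_linear[OF lin]])
  define P where "P z = fst (g (z, 0))" for z
  have gs: "smooth_at (y0, 0) g" using UV(4) \<Psi>0 by (intro smooth_on_imp_smooth_at[OF UV(6)]) simp
  have Ps: "smooth_at y0 P" unfolding P_def
    by (intro smooth_at_fst smooth_at_compose[of _ "\<lambda>z. (z, 0)" g] smooth_at_intros gs)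
  obtain B where B: "linear B" "?D y0 \<circ> B = id" using linear_surjective_right_inverse[OF lin surj[OF y0]] by blast
  then have DB: "?D y0 (B w) = w" for w by (metis comp_apply id_apply)
  obtain C where C: "C > 0" "\<And>w. norm (B w) \<le> C * norm w"
    using linear_bounded_pos[OF B(1)] by blast
  let ?e = "\<lambda>y. \<Sum>b\<in>Basis. norm (?D y (B b) - ?D y0 (B b))"
  have "isCont ?e y0" using smooth_at_imp_isCont[OF Ds] by (intro continuous_intros) auto
  then have "(?e \<longlongrightarrow> ?e y0) (nhds y0)" by (simp only: isCont_def tendsto_at_iff_tendsto_nhds[of ?e y0])
  then have "(?e \<longlongrightarrow> 0) (nhds y0)" by simp
  then have "\<forall>\<^sub>F y in nhds y0. ?e y < 1/2" by (rule order_tendstoD) simp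
  then obtain r1 where r1: "r1 > 0" "\<And>y. dist y y0 < r1 \<Longrightarrow> ?e y < 1/2"
    by (auto simp: eventually_nhds_metric)
  \<comment> \<open>Testing the multiplier equation with \<open>B l\<close> bounds the multiplier, because \<open>?D y (B l)\<close> is close to
    \<open>l\<close> when \<open>y\<close> is close to \<open>y0\<close>.\<close>
  have mult: "norm l \<le> 2 * C * norm (z - y)" if "dist y y0 < r1" "z - y = adjoint (?D y) l" for y z l
  proof -
    have "?D y (B l) - l = ?D y (B l) - ?D y0 (B l)" by (simp add: DB)
    also have "\<dots> = (\<Sum>b\<in>Basis. (l \<bullet> b) *\<^sub>R (?D y (B b) - ?D y0 (B b)))"
      using linear_euclidean_expansion[OF linear_compose[OF B(1) lin[of y]], of l]
        linear_euclidean_expansion[OF linear_compose[OF B(1) lin[of y0]], of l]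
      by (simp add: scaleR_diff_right sum_subtractf)
    also have "norm \<dots> \<le> (\<Sum>b\<in>Basis. norm l * norm (?D y (B b) - ?D y0 (B b)))"
      by (intro sum_norm_le) (auto intro!: mult_right_mono simp: Basis_le_norm)
    also have "\<dots> = norm l * ?e y" by (simp add: sum_distrib_left)
    also have "\<dots> \<le> norm l * (1/2)" using r1(2)[OF that(1)] by (intro mult_left_mono) auto
    finally have 1: "norm (?D y (B l) - l) \<le> norm l / 2" by simp
    have "l \<bullet> (l - ?D y (B l)) \<le> norm l * (norm l / 2)"
      using norm_cauchy_schwarz[of l "l - ?D y (B l)"] mult_left_mono[OF 1, of "norm l"]
      by (simp add: norm_minus_commute)
    then have "norm l * (norm l / 2) \<le> l \<bullet> ?D y (B l)"
      by (simp add: inner_diff_right power2_norm_eq_inner[symmetric] power2_eq_square)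
    also have "\<dots> = (z - y) \<bullet> B l" using that(2) by (simp add: adjoint_works[OF lin] inner_commute)
    also have "\<dots> \<le> norm (z - y) * (C * norm l)"
      using norm_cauchy_schwarz[of "z - y" "B l"] mult_left_mono[OF C(2)[of l], of "norm (z - y)"] by simp
    finally have "norm l * norm l \<le> norm l * (2 * C * norm (z - y))" by (simp add: algebra_simps)
    then show ?thesis using C(1) by (cases "l = 0") (simp_all add: mult_le_cancel_left)
  qed
  obtain r2 where r2: "r2 > 0" "ball (y0, 0) r2 \<subseteq> U" using UV(1,2) open_contains_ball by blast
  \<comment> \<open>If \<open>z\<close> is within \<open>r\<close> of \<open>y0\<close>, the nearest point is within \<open>2 r\<close> of \<open>y0\<close> and the multiplier is
    at most \<open>2 C r\<close>; the constant 3 makes the sum strictly smaller than \<open>r2\<close>.\<close>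
  define r where "r = min r1 r2 / (3 + 2 * C)"
  have r: "r > 0" "2 * r < r1" "(2 + 2 * C) * r < r2"
  proof -
    have m: "min r1 r2 = (3 + 2 * C) * r" using C(1) by (simp add: r_def)
    show "r > 0" using C(1) r1(1) r2(1) by (simp add: r_def)
    then have "C * r > 0" using C(1) by simp
    then show "2 * r < r1" "(2 + 2 * C) * r < r2"
      using m \<open>r > 0\<close> by (auto simp: algebra_simps min_def split: if_splits)
  qed
  let ?near = "\<lambda>z y. F y = 0 \<and> (\<forall>w. F w = 0 \<longrightarrow> dist z y \<le> dist z w)"
  have uniq: "y = P z" if z: "dist z y0 < r" and y: "?near z y" for y z
  proof -
    have zy: "norm (z - y) < r" using y y0 z by (metis dist_norm le_less_trans)
    have yy0: "dist y y0 < 2 * r" using zy z dist_triangle[of y y0 z] by (simp add: dist_norm norm_minus_commute)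
    have "(z - y) \<bullet> k = 0" if "?D y k = 0" for k
      using nearest_point_orthogonal_tangent_space[of "{x. F x = 0}" z y k]
        kernel_subset_tangent_space_level_set[OF Fs _ surj that] y by simp
    then obtain l where l: "z - y = adjoint (?D y) l"
      using orthogonal_to_kernel_imp_range_adjoint[OF lin surj] y by metis
    have "norm l \<le> 2 * C * norm (z - y)" using mult[OF _ l] yy0 r(2) by simp
    also have "\<dots> \<le> 2 * C * r" using zy C(1) by simp
    finally have "dist (y, l) (y0, 0) < 2 * r + 2 * C * r"
      using yy0 sqrt_sum_squares_le_sum[of "dist y y0" "norm l"] by (simp add: dist_Pair_Pair)
    then have "(y, l) \<in> U" using r(3) r2(2) by (auto simp: dist_commute algebra_simps)
    moreover have "\<Psi> (y, l) = (z, 0)" using y l by (simp add: \<Psi>_adj flip: l)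
    ultimately have "g (z, 0) = (y, l)" using UV(5) by (metis homeomorphism_apply1)
    then show ?thesis by (simp add: P_def)
  qed
  have "continuous_on UNIV F" by (intro continuous_at_imp_continuous_on ballI smooth_at_imp_isCont Fs)
  then have cl: "closed {x. F x = 0}" by (simp add: closed_Collect_eq continuous_on_const)
  have "\<forall>\<^sub>F z in nhds y0. dist z y0 < r" using r(1) by (auto simp: eventually_nhds_metric)
  then have "\<forall>\<^sub>F z in nhds y0. ?near z (P z) \<and> (\<forall>y. ?near z y \<longrightarrow> y = P z)"
  proof eventually_elim
    case (elim z)
    obtain y where "y \<in> {x. F x = 0}" "\<And>w. w \<in> {x. F x = 0} \<Longrightarrow> dist z y \<le> dist z w"
      using distance_attains_inf[OF cl, of z] y0 by blast
    then have "?near z y" by simp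
    with uniq[OF elim] show ?case by blast
  qed
  then show ?thesis using that[OF Ps] by (simp add: conj_assoc)
qed

definition is_nearest :: "'a::metric_space set \<Rightarrow> 'a \<Rightarrow> 'a \<Rightarrow> bool" where
  "is_nearest S z y \<longleftrightarrow> y \<in> S \<and> (\<forall>w\<in>S. dist z y \<le> dist z w)"

lemma closest_point_eq_unique_nearest:
  assumes "is_nearest S z y" "\<forall>y'. is_nearest S z y' \<longrightarrow> y' = y"
  shows "closest_point S z = y"
  unfolding closest_point_def
proof (rule some_equality)
  show "y \<in> S \<and> (\<forall>w\<in>S. dist z y \<le> dist z w)" using assms(1) by (simp add: is_nearest_def)
  show "x = y" if "x \<in> S \<and> (\<forall>w\<in>S. dist z x \<le> dist z w)" for x
    using assms(2) that by (simp add: is_nearest_def)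
qed

text \<open>The projection fixes the points of \<open>S\<close> near \<open>H\<close>, hence every curve in \<open>S\<close> through \<open>H\<close>.\<close>

lemma derivative_of_projection_on_tangent:
  assumes P: "smooth_at H P" "\<forall>\<^sub>F z in nhds H. is_nearest S z (P z) \<and> (\<forall>y. is_nearest S z y \<longrightarrow> y = P z)"
    and K: "K \<in> tangent_space S H"
  shows "frechet_derivative P (at H) K = K"
proof -
  obtain c where c: "smooth_at 0 c" "\<forall>\<^sub>F t in nhds 0. c t \<in> S" "c 0 = H"
    "(c has_vector_derivative K) (at 0)"
    using K by (rule tangent_spaceE)
  have "\<forall>\<^sub>F t in nhds 0. is_nearest S (c t) (P (c t)) \<and> (\<forall>y. is_nearest S (c t) y \<longrightarrow> y = P (c t))"
    using smooth_at_imp_eventually[OF c(1), unfolded c(3), OF P(2)] .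
  with c(2) have ev: "\<forall>\<^sub>F t in nhds 0. P (c t) = c t"
  proof eventually_elim
    case (elim t)
    have "is_nearest S (c t) (c t)" using elim(1) by (simp add: is_nearest_def)
    then show ?case using elim(2) by metis
  qed
  have "((\<lambda>t. P (c t)) has_vector_derivative frechet_derivative P (at H) K) (at 0)"
    using has_vector_derivative_smooth_compose[OF _ c(4), of P] P(1) c(3) by simp
  moreover have "((\<lambda>t. P (c t)) has_vector_derivative K) (at 0) = (c has_vector_derivative K) (at 0)"
    by (rule has_vector_derivative_cong_ev)
      (use ev in \<open>auto elim: eventually_mono dest: eventually_nhds_x_imp_x\<close>)
  ultimately show ?thesis using c(4) vector_derivative_unique_at by blast
qed

section \<open>Second-order jets of curves\<close>

text \<open>The value, the first and the second derivative at 0 of a curve that is differentiable near 0. Working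
  with the triple reduces second-order expansions to the product rule below and to the comparison of
  two jets of the same curve.\<close>

definition jet2 :: "(real \<Rightarrow> 'a::real_normed_vector) \<Rightarrow> 'a \<Rightarrow> 'a \<Rightarrow> 'a \<Rightarrow> bool" where
  "jet2 f a b c \<longleftrightarrow> (\<exists>f'. (\<forall>\<^sub>F t in nhds 0. (f has_vector_derivative f' t) (at t)) \<and>
     f 0 = a \<and> f' 0 = b \<and> (f' has_vector_derivative c) (at 0))"

lemma jet2_imp_has_vector_derivative: "jet2 f a b c \<Longrightarrow> (f has_vector_derivative b) (at 0)"
  unfolding jet2_def by (auto dest: eventually_nhds_x_imp_x)

lemma jet2_value: "jet2 f a b c \<Longrightarrow> f 0 = a"
  by (auto simp: jet2_def)

lemma jet2_second_derivative:
  assumes "jet2 f a b c"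
  shows "((\<lambda>t. vector_derivative f (at t)) has_vector_derivative c) (at 0)"
proof -
  obtain f' where f': "\<forall>\<^sub>F t in nhds 0. (f has_vector_derivative f' t) (at t)"
    "(f' has_vector_derivative c) (at 0)"
    using assms by (auto simp: jet2_def)
  have "\<forall>\<^sub>F t in nhds 0. f' t = vector_derivative f (at t)"
    using f'(1) by eventually_elim (simp add: vector_derivative_at)
  then have "((\<lambda>t. vector_derivative f (at t)) has_vector_derivative c) (at 0) =
    (f' has_vector_derivative c) (at 0)"
    by (intro has_vector_derivative_cong_ev) (auto elim: eventually_mono dest: eventually_nhds_x_imp_x)
  then show ?thesis using f'(2) by simp
qed

lemma jet2_unique:
  assumes "jet2 f a b c" "jet2 f a' b' c'"
  shows "a' = a" "b' = b" "c' = c"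
  using jet2_value[OF assms(1)] jet2_value[OF assms(2)]
    vector_derivative_unique_at[OF jet2_imp_has_vector_derivative[OF assms(2)] jet2_imp_has_vector_derivative[OF assms(1)]]
    vector_derivative_unique_at[OF jet2_second_derivative[OF assms(2)] jet2_second_derivative[OF assms(1)]]
  by simp_all

lemma jet2_cong:
  assumes "jet2 f a b c" "\<forall>\<^sub>F t in nhds 0. f t = g t"
  shows "jet2 g a b c"
proof -
  obtain f' where f': "\<forall>\<^sub>F t in nhds 0. (f has_vector_derivative f' t) (at t)"
    "f 0 = a" "f' 0 = b" "(f' has_vector_derivative c) (at 0)"
    using assms(1) by (auto simp: jet2_def)
  obtain T where T: "open T" "0 \<in> T" "\<And>t. t \<in> T \<Longrightarrow> f t = g t"
    using assms(2) by (auto simp: eventually_nhds)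
  have "\<forall>\<^sub>F t in nhds 0. t \<in> T" using T by (intro eventually_nhds_in_open)
  with f'(1) have "\<forall>\<^sub>F t in nhds 0. (g has_vector_derivative f' t) (at t)"
  proof eventually_elim
    case (elim t)
    then show ?case using has_vector_derivative_transform_within_open[of f "f' t" t T g] T by blast
  qed
  then show ?thesis using f' T by (auto simp: jet2_def)
qed

lemma jet2_bilinear:
  assumes B: "bounded_bilinear B" and "jet2 f a b c" "jet2 g a' b' c'"
  shows "jet2 (\<lambda>t. B (f t) (g t)) (B a a') (B a b' + B b a') (B a c' + 2 *\<^sub>R B b b' + B c a')"
proof -
  obtain f' where f': "\<forall>\<^sub>F t in nhds 0. (f has_vector_derivative f' t) (at t)"
    "f 0 = a" "f' 0 = b" "(f' has_vector_derivative c) (at 0)"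
    using assms(2) by (auto simp: jet2_def)
  obtain g' where g': "\<forall>\<^sub>F t in nhds 0. (g has_vector_derivative g' t) (at t)"
    "g 0 = a'" "g' 0 = b'" "(g' has_vector_derivative c') (at 0)"
    using assms(3) by (auto simp: jet2_def)
  let ?h = "\<lambda>t. B (f t) (g' t) + B (f' t) (g t)"
  have "\<forall>\<^sub>F t in nhds 0. ((\<lambda>t. B (f t) (g t)) has_vector_derivative ?h t) (at t)"
    using f'(1) g'(1) by eventually_elim (rule bounded_bilinear.has_vector_derivative[OF B])
  moreover have "(?h has_vector_derivative ((B (f 0) c' + B b (g' 0)) + (B (f' 0) b' + B c (g 0)))) (at 0)"
    by (intro has_vector_derivative_add bounded_bilinear.has_vector_derivative[OF B]
        jet2_imp_has_vector_derivative[OF assms(2)] jet2_imp_has_vector_derivative[OF assms(3)] f'(4) g'(4))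
  ultimately show ?thesis unfolding jet2_def
    by (intro exI[of _ ?h]) (simp add: f'(2,3) g'(2,3) scaleR_2 algebra_simps)
qed

lemma jet2_linear:
  assumes L: "bounded_linear L" and "jet2 f a b c"
  shows "jet2 (\<lambda>t. L (f t)) (L a) (L b) (L c)"
proof -
  obtain f' where f': "\<forall>\<^sub>F t in nhds 0. (f has_vector_derivative f' t) (at t)"
    "f 0 = a" "f' 0 = b" "(f' has_vector_derivative c) (at 0)"
    using assms(2) by (auto simp: jet2_def)
  have "\<forall>\<^sub>F t in nhds 0. ((\<lambda>t. L (f t)) has_vector_derivative L (f' t)) (at t)"
    using f'(1) by eventually_elim (rule bounded_linear.has_vector_derivative[OF L])
  moreover have "((\<lambda>t. L (f' t)) has_vector_derivative L c) (at 0)"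
    by (rule bounded_linear.has_vector_derivative[OF L f'(4)])
  ultimately show ?thesis unfolding jet2_def
    by (intro exI[of _ "\<lambda>t. L (f' t)"]) (simp add: f'(2,3))
qed

lemma jet2_add:
  assumes "jet2 f a b c" "jet2 g a' b' c'"
  shows "jet2 (\<lambda>t. f t + g t) (a + a') (b + b') (c + c')"
proof -
  obtain f' where f': "\<forall>\<^sub>F t in nhds 0. (f has_vector_derivative f' t) (at t)"
    "f 0 = a" "f' 0 = b" "(f' has_vector_derivative c) (at 0)"
    using assms(1) by (auto simp: jet2_def)
  obtain g' where g': "\<forall>\<^sub>F t in nhds 0. (g has_vector_derivative g' t) (at t)"
    "g 0 = a'" "g' 0 = b'" "(g' has_vector_derivative c') (at 0)"
    using assms(2) by (auto simp: jet2_def)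
  have "\<forall>\<^sub>F t in nhds 0. ((\<lambda>t. f t + g t) has_vector_derivative f' t + g' t) (at t)"
    using f'(1) g'(1) by eventually_elim (rule has_vector_derivative_add)
  moreover have "((\<lambda>t. f' t + g' t) has_vector_derivative c + c') (at 0)"
    by (intro has_vector_derivative_add f' g')
  ultimately show ?thesis unfolding jet2_def
    by (intro exI[of _ "\<lambda>t. f' t + g' t"]) (simp add: f'(2,3) g'(2,3))
qed

lemma jet2_minus: "jet2 f a b c \<Longrightarrow> jet2 (\<lambda>t. - f t) (- a) (- b) (- c)"
  by (rule jet2_linear[OF bounded_linear_minus[OF bounded_linear_ident]])

lemma jet2_diff: "jet2 f a b c \<Longrightarrow> jet2 g a' b' c' \<Longrightarrow> jet2 (\<lambda>t. f t - g t) (a - a') (b - b') (c - c')"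
  using jet2_add[of f a b c "\<lambda>t. - g t" "- a'" "- b'" "- c'"] jet2_minus[of g a' b' c'] by simp

lemma jet2_Pair:
  assumes "jet2 f a b c" "jet2 g a' b' c'"
  shows "jet2 (\<lambda>t. (f t, g t)) (a, a') (b, b') (c, c')"
proof -
  have "bounded_linear (\<lambda>u. (u, 0))" "bounded_linear (\<lambda>u. (0, u))"
    by (intro bounded_linear_Pair bounded_linear_ident bounded_linear_zero)+
  from jet2_add[OF jet2_linear[OF this(1) assms(1)] jet2_linear[OF this(2) assms(2)]]
  show ?thesis by simp
qed

lemma jet2_const: "jet2 (\<lambda>t. a) a 0 0"
  unfolding jet2_def by (intro exI[of _ "\<lambda>t. 0"]) auto

lemma jet2_ident: "jet2 (\<lambda>t. t) 0 1 0"
  unfolding jet2_def by (intro exI[of _ "\<lambda>t. 1"]) auto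

lemma jet2_line: "jet2 (\<lambda>t. t *\<^sub>R v) 0 v 0"
  using jet2_bilinear[OF bounded_bilinear_scaleR jet2_ident jet2_const[of v]] by simp

lemma smooth_at_jet2:
  assumes "smooth_at 0 f"
  obtains b c where "jet2 f (f 0) b c"
proof -
  let ?f' = "\<lambda>t. frechet_derivative f (at t) 1"
  have "\<forall>\<^sub>F t in nhds 0. (f has_vector_derivative ?f' t) (at t)"
    using eventually_smooth_at[OF assms] by eventually_elim (rule smooth_at_imp_has_vector_derivative)
  moreover have "(?f' has_vector_derivative frechet_derivative ?f' (at 0) 1) (at 0)"
    by (intro smooth_at_imp_has_vector_derivative smooth_at_frechet_derivative assms)
  ultimately have "jet2 f (f 0) (?f' 0) (frechet_derivative ?f' (at 0) 1)"
    unfolding jet2_def by (intro exI[of _ ?f']) simp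
  then show ?thesis by (rule that)
qed

lemma jet2_imp_vector_derivative2:
  "jet2 f a b c \<Longrightarrow> vector_derivative (\<lambda>s. vector_derivative f (at s)) (at 0) = c"
  by (rule vector_derivative_at[OF jet2_second_derivative])

text \<open>The difference \<open>Z - P Z\<close> is orthogonal to every tangent field along \<open>P Z\<close>. It vanishes to first
  order at 0, so differentiating the orthogonality relation twice leaves only its second derivative,
  which is therefore orthogonal to the tangent space at \<open>H\<close>.\<close>

lemma jet2_projection:
  fixes P :: "'a::euclidean_space \<Rightarrow> 'a"
  assumes P: "smooth_at H P" "\<forall>\<^sub>F z in nhds H. is_nearest S z (P z) \<and> (\<forall>y. is_nearest S z y \<longrightarrow> y = P z)"
    and K: "K \<in> tangent_space S H" and Z: "smooth_at 0 Z" "jet2 Z H K Z2"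
  obtains Y2 where "jet2 (\<lambda>t. P (Z t)) H K Y2"
    "\<And>K'. K' \<in> tangent_space S H \<Longrightarrow> Y2 \<bullet> K' = Z2 \<bullet> K'"
proof -
  let ?near = "\<lambda>z. is_nearest S z (P z) \<and> (\<forall>y. is_nearest S z y \<longrightarrow> y = P z)"
  note D = derivative_of_projection_on_tangent[OF P]
  have Z0: "Z 0 = H" by (rule jet2_value[OF Z(2)])
  have sP: "smooth_at (Z 0) P" by (simp add: Z0 P(1))
  have sY: "smooth_at 0 (\<lambda>t. P (Z t))" by (rule smooth_at_compose[OF Z(1) sP])
  have "is_nearest S H H" using tangent_space_base[OF K] by (simp add: is_nearest_def)
  then have PH: "P H = H" using eventually_nhds_x_imp_x[OF P(2)] by metis
  obtain y1 Y2 where "jet2 (\<lambda>t. P (Z t)) (P (Z 0)) y1 Y2" using smooth_at_jet2[OF sY] .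
  then have j: "jet2 (\<lambda>t. P (Z t)) H y1 Y2" by (simp only: Z0 PH)
  have "((\<lambda>t. P (Z t)) has_vector_derivative K) (at 0)"
    using has_vector_derivative_smooth_compose[OF sP jet2_imp_has_vector_derivative[OF Z(2)]]
    by (simp only: Z0 D[OF K])
  then have "y1 = K" using jet2_imp_has_vector_derivative[OF j] vector_derivative_unique_at by blast
  then have jY: "jet2 (\<lambda>t. P (Z t)) H K Y2" using j by simp
  obtain N where N: "open N" "H \<in> N" "\<And>z. z \<in> N \<Longrightarrow> smooth_at z P \<and> ?near z"
    using eventually_conj[OF eventually_smooth_at[OF P(1)] P(2)] unfolding eventually_nhds by blast
  show ?thesis
  proof (rule that[OF jY])
    fix K' assume K': "K' \<in> tangent_space S H"
    \<comment> \<open>The derivative of \<open>P\<close> maps into tangent spaces and fixes \<open>K'\<close> at \<open>H\<close>, so it extends \<open>K'\<close> to a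
      tangent field along \<open>P Z\<close>.\<close>
    let ?T = "\<lambda>t. frechet_derivative P (at (Z t)) K'"
    have "smooth_at 0 ?T"
      using smooth_at_compose[OF Z(1) smooth_at_frechet_derivative[OF sP, of K']] .
    then obtain T1 T2 where "jet2 ?T (?T 0) T1 T2" using smooth_at_jet2[of ?T] by blast
    then have jT: "jet2 ?T K' T1 T2" by (simp only: Z0 D[OF K'])
    have "\<forall>\<^sub>F t in nhds 0. Z t \<in> N"
      using smooth_at_imp_eventually[OF Z(1), unfolded Z0, OF eventually_nhds_in_open[OF N(1,2)]] .
    then have "\<forall>\<^sub>F t in nhds 0. 0 = (Z t - P (Z t)) \<bullet> ?T t"
    proof eventually_elim
      case (elim t)
      have "?T t \<in> tangent_space S (P (Z t))"
      proof (rule tangent_spaceI)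
        have l: "smooth_at 0 (\<lambda>s::real. Z t + s *\<^sub>R K')" by (intro smooth_at_intros)
        show "smooth_at 0 (\<lambda>s. P (Z t + s *\<^sub>R K'))"
          using N(3)[OF elim] by (intro smooth_at_compose[OF l]) simp
        have "\<forall>\<^sub>F s in nhds 0. Z t + s *\<^sub>R K' \<in> N"
          using smooth_at_imp_eventually[OF l, of "\<lambda>z. z \<in> N"] eventually_nhds_in_open[OF N(1) elim] by simp
        then show "\<forall>\<^sub>F s in nhds 0. P (Z t + s *\<^sub>R K') \<in> S"
          by eventually_elim (use N(3) in \<open>simp add: is_nearest_def\<close>)
        have "((\<lambda>s. Z t + s *\<^sub>R K') has_vector_derivative K') (at 0)"
          by (auto intro!: derivative_eq_intros)
        from has_vector_derivative_smooth_compose[OF _ this, of P] N(3)[OF elim]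
        show "((\<lambda>s. P (Z t + s *\<^sub>R K')) has_vector_derivative ?T t) (at 0)" by simp
      qed simp
      then show ?case
        using nearest_point_orthogonal_tangent_space[of S "Z t" "P (Z t)"] N(3)[OF elim]
        by (simp add: is_nearest_def)
    qed
    from jet2_unique(3)[OF jet2_cong[OF jet2_const this] jet2_bilinear[OF bounded_bilinear_inner jet2_diff[OF Z(2) jY] jT]]
    show "Y2 \<bullet> K' = Z2 \<bullet> K'" by (simp add: inner_diff_left)
  qed
qed


section \<open>Positive definite square roots and polar factors\<close>

lemma bounded_bilinear_matrix_mult:
  "bounded_bilinear ((**) :: real^'n^'m \<Rightarrow> real^'k^'n \<Rightarrow> real^'k^'m)"
proof -
  have "bilinear ((**) :: real^'n^'m \<Rightarrow> real^'k^'n \<Rightarrow> real^'k^'m)"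
    unfolding bilinear_def
    by (intro conjI allI linearI)
      (vector matrix_matrix_mult_def sum.distrib sum_distrib_left algebra_simps)+
  then show ?thesis by (simp add: bilinear_conv_bounded_bilinear)
qed

lemmas matrix_mult_algebra =
  bounded_bilinear.add_left[OF bounded_bilinear_matrix_mult]
  bounded_bilinear.add_right[OF bounded_bilinear_matrix_mult]
  bounded_bilinear.diff_left[OF bounded_bilinear_matrix_mult]
  bounded_bilinear.diff_right[OF bounded_bilinear_matrix_mult]
  bounded_bilinear.minus_left[OF bounded_bilinear_matrix_mult]
  bounded_bilinear.minus_right[OF bounded_bilinear_matrix_mult]
  bounded_bilinear.scaleR_left[OF bounded_bilinear_matrix_mult]
  bounded_bilinear.scaleR_right[OF bounded_bilinear_matrix_mult]
  bounded_bilinear.zero_left[OF bounded_bilinear_matrix_mult]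
  bounded_bilinear.zero_right[OF bounded_bilinear_matrix_mult]

lemma bounded_linear_transpose: "bounded_linear (transpose :: real^'n^'m \<Rightarrow> real^'m^'n)"
proof -
  have "linear (transpose :: real^'n^'m \<Rightarrow> real^'m^'n)"
    by (intro linearI) (vector transpose_def)+
  then show ?thesis by (simp add: linear_conv_bounded_linear)
qed

lemma transpose_zero: "transpose (0 :: real^'n^'m) = 0"
  by (rule linear_0[OF bounded_linear.linear[OF bounded_linear_transpose]])

lemmas transpose_algebra =
  bounded_linear.linear[OF bounded_linear_transpose, THEN linear_add]
  bounded_linear.linear[OF bounded_linear_transpose, THEN linear_diff]
  bounded_linear.linear[OF bounded_linear_transpose, THEN linear_neg]
  bounded_linear.linear[OF bounded_linear_transpose, THEN linear_scale]
  transpose_zero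
  matrix_transpose_mul transpose_transpose transpose_mat

lemmas smooth_at_matrix_mult = smooth_at_bilinear[OF bounded_bilinear_matrix_mult]
lemmas smooth_at_transpose = smooth_at_bounded_linear_compose[OF bounded_linear_transpose]
lemmas jet2_matrix_mult = jet2_bilinear[OF bounded_bilinear_matrix_mult]
lemmas jet2_transpose = jet2_linear[OF bounded_linear_transpose]

lemma frob_inner_eq_inner: "frob_inner A B = A \<bullet> B"
proof -
  have "frob_inner A B = (\<Sum>j\<in>UNIV. \<Sum>i\<in>UNIV. A $ i $ j * B $ i $ j)"
    by (simp add: frob_inner_def trace_def matrix_matrix_mult_def transpose_def)
  also have "\<dots> = (\<Sum>i\<in>UNIV. \<Sum>j\<in>UNIV. A $ i $ j * B $ i $ j)" by (rule sum.swap)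
  finally show ?thesis by (simp add: inner_vec_def)
qed

lemma inner_eq_trace: "A \<bullet> B = trace (transpose A ** B)"
  by (simp add: frob_inner_eq_inner[symmetric] frob_inner_def)

lemma inner_transpose: "transpose A \<bullet> transpose B = A \<bullet> (B :: real^'n^'m)"
proof -
  have "A \<bullet> B = (\<Sum>i\<in>UNIV. \<Sum>j\<in>UNIV. A $ i $ j * B $ i $ j)" by (simp add: inner_vec_def)
  also have "\<dots> = (\<Sum>j\<in>UNIV. \<Sum>i\<in>UNIV. A $ i $ j * B $ i $ j)" by (rule sum.swap)
  finally show ?thesis by (simp add: inner_vec_def transpose_def)
qed

lemma inner_mult_left: "(A ** B) \<bullet> C = B \<bullet> (transpose A ** C)" for A :: "real^'n^'m"
  by (simp add: inner_eq_trace matrix_transpose_mul matrix_mul_assoc)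

lemma inner_mult_right: "(A ** B) \<bullet> C = A \<bullet> (C ** transpose B)" for A :: "real^'n^'m"
proof -
  have "(A ** B) \<bullet> C = transpose (A ** B) \<bullet> transpose C" by (simp add: inner_transpose)
  also have "\<dots> = transpose A \<bullet> transpose (C ** transpose B)"
    by (simp add: matrix_transpose_mul inner_mult_left)
  finally show ?thesis by (simp add: inner_transpose)
qed

lemma matrix_inv_mult:
  fixes A :: "real^'n^'n"
  assumes "invertible A"
  shows "A ** matrix_inv A = mat 1" "matrix_inv A ** A = mat 1"
proof -
  have "\<exists>B. A ** B = mat 1 \<and> B ** A = mat 1" using assms by (simp add: invertible_def)
  from someI_ex[OF this] show "A ** matrix_inv A = mat 1" "matrix_inv A ** A = mat 1"
    by (simp_all add: matrix_inv_def)
qed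

lemma matrix_inv_eqI:
  fixes A :: "real^'n^'n"
  assumes "A ** B = mat 1"
  shows "matrix_inv A = B"
proof -
  have "B ** A = mat 1" using assms matrix_left_right_inverse by blast
  then have "invertible A" using assms by (auto simp: invertible_def)
  then have "matrix_inv A = matrix_inv A ** (A ** B)" using assms by simp
  also have "\<dots> = B" using matrix_inv_mult[OF \<open>invertible A\<close>] by (simp add: matrix_mul_assoc)
  finally show ?thesis .
qed

lemma matrix_inv_mat1: "matrix_inv (mat 1 :: real^'n^'n) = mat 1"
  by (rule matrix_inv_eqI) simp

text \<open>Left multiplication by \<open>A\<close> is an invertible operator that depends linearly on \<open>A\<close>, and the inverse
  operator applied to the identity matrix is the inverse matrix.\<close>

lemma smooth_at_matrix_inv:
  fixes A :: "real^'n^'n"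
  assumes "invertible A"
  shows "smooth_at A matrix_inv"
proof -
  let ?S = "{A :: real^'n^'n. invertible A}"
  have "continuous_on UNIV (\<lambda>A :: real^'n^'n. det A)"
    unfolding det_def by (intro continuous_intros)
  then have "open {A :: real^'n^'n. det A \<noteq> 0}"
    by (intro open_Collect_neq continuous_on_const)
  then have o: "open ?S" by (simp add: invertible_det_nz)
  have "Ck_on k ?S (\<lambda>A. matrix_inv A ** mat 1)" for k
  proof (rule Ck_on_inverse_family[where A="\<lambda>A X. A ** X" and B="\<lambda>A X. matrix_inv A ** X", OF _ _ _ _ o])
    fix X :: "real^'n^'n"
    show "Ck_on k ?S (\<lambda>A. A ** X)"
      by (rule Ck_on_bounded_linear[OF bounded_bilinear.bounded_linear_left[OF bounded_bilinear_matrix_mult] o])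
  qed (simp_all add: matrix_mul_assoc matrix_inv_mult bounded_linear.linear[OF
        bounded_bilinear.bounded_linear_right[OF bounded_bilinear_matrix_mult]])
  then have "smooth_on ?S matrix_inv" using o by (simp add: smooth_on_def)
  then show ?thesis using assms smooth_on_imp_smooth_at by blast
qed

definition pos_def :: "real^'n^'n \<Rightarrow> bool" where
  "pos_def B \<longleftrightarrow> transpose B = B \<and> (\<forall>x. x \<noteq> 0 \<longrightarrow> 0 < x \<bullet> (B *v x))"

lemma pos_def_imp_invertible:
  assumes "pos_def B"
  shows "invertible B"
proof -
  have "x = 0" if "B *v x = 0" for x using assms that unfolding pos_def_def by force
  then have "\<exists>C. C ** B = mat 1" using matrix_left_invertible_ker[of B] by blast
  then show ?thesis using matrix_left_right_inverse by (auto simp: invertible_def)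
qed

text \<open>With a symmetric \<open>C\<close> the inner product splits into the quadratic form of \<open>C\<close> on the rows of \<open>D\<close>,
  which is how definiteness of \<open>C\<close> enters the uniqueness of roots.\<close>

lemma inner_mult_sym:
  fixes C :: "real^'n^'n" and D :: "real^'n^'m"
  assumes "transpose C = C"
  shows "D \<bullet> (D ** C) = (\<Sum>i\<in>UNIV. D $ i \<bullet> (C *v D $ i))"
proof -
  have "(D ** C) $ i = C *v D $ i" for i
  proof -
    have "(D ** C) $ i = (\<chi> j. \<Sum>k\<in>UNIV. D $ i $ k * transpose C $ j $ k)"
      by (vector matrix_matrix_mult_def transpose_def)
    then show ?thesis by (simp only: assms) (vector matrix_vector_mult_def mult.commute)
  qed
  then show ?thesis by (simp add: inner_vec_def[of D])
qed

text \<open>For \<open>D = B - C\<close> the hypothesis gives \<open>B D + D C = 0\<close>. Pairing with \<open>D\<close> gives a sum of two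
  nonnegative terms, and the second one is positive unless \<open>D = 0\<close>.\<close>

lemma psd_root_unique:
  assumes B: "transpose B = B" "\<And>x. 0 \<le> x \<bullet> (B *v x)" and C: "pos_def C" and eq: "B ** B = C ** C"
  shows "B = C"
proof -
  let ?D = "B - C"
  have C': "transpose C = C" "\<And>x. x \<noteq> 0 \<Longrightarrow> 0 < x \<bullet> (C *v x)" using C by (auto simp: pos_def_def)
  then have C0: "0 \<le> x \<bullet> (C *v x)" for x by (cases "x = 0") (auto intro: less_imp_le)
  have "B ** ?D + ?D ** C = 0" by (simp add: matrix_mult_algebra eq)
  then have "?D \<bullet> (B ** ?D) + ?D \<bullet> (?D ** C) = 0" by (metis inner_add_right inner_zero_right)
  moreover have "?D \<bullet> (B ** ?D) = transpose ?D \<bullet> (transpose ?D ** B)"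
    using inner_transpose[of ?D "B ** ?D"] by (simp add: matrix_transpose_mul B(1))
  then have "0 \<le> ?D \<bullet> (B ** ?D)" by (simp only: inner_mult_sym[OF B(1)]) (intro sum_nonneg B(2))
  moreover have "?D \<bullet> (?D ** C) = (\<Sum>i\<in>UNIV. ?D $ i \<bullet> (C *v ?D $ i))"
    by (rule inner_mult_sym[OF C'(1)])
  moreover have "0 \<le> (\<Sum>i\<in>UNIV. ?D $ i \<bullet> (C *v ?D $ i))" by (intro sum_nonneg C0)
  ultimately have "(\<Sum>i\<in>UNIV. ?D $ i \<bullet> (C *v ?D $ i)) = 0" by linarith
  then have "?D $ i \<bullet> (C *v ?D $ i) = 0" for i
    using C0 by (subst (asm) sum_nonneg_eq_0_iff) auto
  then have "?D $ i = 0" for i using C'(2)[of "?D $ i"] by fastforce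
  then show ?thesis by (simp add: vec_eq_iff)
qed

lemma psd_sqrt_eqI:
  assumes "pos_def B" "B ** B = A"
  shows "psd_sqrt A = B"
  unfolding psd_sqrt_def
proof (rule the_equality)
  have "0 \<le> x \<bullet> (B *v x)" for x
    using assms(1) by (cases "x = 0") (auto simp: pos_def_def intro: less_imp_le)
  then show "transpose B = B \<and> (\<forall>x. 0 \<le> x \<bullet> (B *v x)) \<and> B ** B = A"
    using assms by (auto simp: pos_def_def)
  show "B' = B" if "transpose B' = B' \<and> (\<forall>x. 0 \<le> x \<bullet> (B' *v x)) \<and> B' ** B' = A" for B'
    using psd_root_unique[of B' B] that assms by simp
qed

lemma pos_def_mat1: "pos_def (mat 1)"
  by (simp add: pos_def_def)

text \<open>Squaring has derivative \<open>E \<mapsto> E + E\<close> at the identity matrix. The local inverse takes symmetric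
  values on symmetric matrices, because the transpose of a root of a symmetric matrix is a root too;
  on a small ball around the identity the roots are positive definite.\<close>

lemma smooth_square_root:
  obtains N and s :: "real^'n^'n \<Rightarrow> real^'n^'n" where "open N" "mat 1 \<in> N" "smooth_on N s"
    "\<And>A. A \<in> N \<Longrightarrow> transpose A = A \<Longrightarrow> pos_def (s A) \<and> s A ** s A = A"
proof -
  let ?f = "\<lambda>B :: real^'n^'n. B ** B"
  have "(?f has_derivative (\<lambda>E. mat 1 ** E + E ** mat 1)) (at (mat 1))"
    by (intro bounded_bilinear.FDERIV[OF bounded_bilinear_matrix_mult] has_derivative_ident)
  then have "frechet_derivative ?f (at (mat 1)) = (\<lambda>E. E + E)"
    using frechet_derivative_at by fastforce
  then have inj: "E = 0" if "frechet_derivative ?f (at (mat 1)) E = 0" for E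
    using that by (simp add: scaleR_2[symmetric])
  have sm: "smooth_at (mat 1) ?f" by (intro smooth_at_matrix_mult smooth_at_intros)
  obtain U V g where UV: "open U" "mat 1 \<in> U" "open V" "?f (mat 1) \<in> V" "homeomorphism U V ?f g" "smooth_on V g"
    by (rule smooth_inverse_function[OF sm inj]) blast
  obtain K where K: "K > 0" "\<And>(A::real^'n^'n) (x::real^'n). norm (A *v x) \<le> norm A * norm x * K"
  proof -
    have "bilinear ((*v) :: real^'n^'n \<Rightarrow> real^'n \<Rightarrow> real^'n)" unfolding bilinear_def
      by (intro conjI allI linearI) (simp_all add: algebra_simps scaleR_matrix_vector_assoc[symmetric])
    then have "bounded_bilinear ((*v) :: real^'n^'n \<Rightarrow> real^'n \<Rightarrow> real^'n)"
      by (simp add: bilinear_conv_bounded_bilinear)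
    from bounded_bilinear.pos_bounded[OF this] show ?thesis using that by blast
  qed
  have pd: "0 < x \<bullet> (B *v x)" if "dist B (mat 1) < 1 / K" "x \<noteq> 0" for B :: "real^'n^'n" and x
  proof -
    have "norm ((B - mat 1) *v x) \<le> norm (B - mat 1) * norm x * K" by (rule K(2))
    also have "\<dots> = (norm (B - mat 1) * K) * norm x" by simp
    also have "\<dots> < 1 * norm x"
      using that K(1) by (intro mult_strict_right_mono) (auto simp: dist_norm field_simps)
    finally have "norm ((B - mat 1) *v x) < norm x" by simp
    moreover have "- (x \<bullet> ((B - mat 1) *v x)) \<le> norm x * norm ((B - mat 1) *v x)"
      using Cauchy_Schwarz_ineq2[of x "(B - mat 1) *v x"] by linarith
    ultimately have "- (x \<bullet> ((B - mat 1) *v x)) < norm x * norm x"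
      using that(2) by (smt (verit, best) mult_strict_left_mono zero_less_norm_iff)
    moreover have "x \<bullet> (B *v x) = x \<bullet> ((B - mat 1) *v x) + norm x * norm x"
      by (simp add: matrix_vector_mult_diff_rdistrib inner_diff_right power2_norm_eq_inner[symmetric] power2_eq_square)
    ultimately show ?thesis by simp
  qed
  let ?W = "U \<inter> transpose -` U \<inter> ball (mat 1) (1 / K)"
  let ?N = "V \<inter> g -` ?W"
  have "open ?W"
    using UV(1) bounded_linear.continuous_on[OF bounded_linear_transpose continuous_on_id]
    by (intro open_Int open_ball open_vimage) (auto simp: o_def)
  moreover have "continuous_on V g" using UV(5) by (simp add: homeomorphism_def)
  ultimately have "open ?N" using UV(3) continuous_open_preimage by blast
  moreover have "g (mat 1) = mat 1" using UV(2,5) by (metis homeomorphism_apply1 matrix_mul_lid)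
  then have "mat 1 \<in> ?N" using UV(2,4) K(1) by simp
  moreover have "smooth_on ?N g" using UV(6) \<open>open ?N\<close> by (auto simp: smooth_on_iff_smooth_at)
  moreover have "pos_def (g A) \<and> g A ** g A = A" if A: "A \<in> ?N" "transpose A = A" for A
  proof -
    have sq: "g A ** g A = A" using A(1) UV(5) by (metis IntD1 homeomorphism_apply2)
    have gA: "g A \<in> U" "transpose (g A) \<in> U" "dist (g A) (mat 1) < 1 / K"
      using A(1) by (auto simp: dist_commute)
    have "?f (transpose (g A)) = A" using sq A(2) by (metis matrix_transpose_mul)
    then have "transpose (g A) = g A" using gA UV(5) by (metis homeomorphism_apply1)
    then show ?thesis using sq pd[OF gA(3)] by (simp add: pos_def_def)
  qed
  ultimately show ?thesis using that by blast
qed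

definition gram_root :: "real^'r^'n \<Rightarrow> real^'r^'r" where
  "gram_root L = psd_sqrt (transpose L ** L)"

text \<open>For \<open>L\<close> of full column rank this is the orthonormal factor in the polar decomposition of \<open>L\<close>.\<close>

definition polar :: "real^'r^'n \<Rightarrow> real^'r^'n" where
  "polar L = L ** matrix_inv (gram_root L)"

text \<open>The condition under which the definite description in \<^const>\<open>psd_sqrt\<close> denotes a positive definite
  root of the Gram matrix. Near orthonormal frames it follows from the inverse function theorem.\<close>

definition has_gram_root :: "real^'r^'n \<Rightarrow> bool" where
  "has_gram_root L \<longleftrightarrow> (\<exists>B. pos_def B \<and> B ** B = transpose L ** L)"

lemma gram_root:
  assumes "has_gram_root L"
  shows "pos_def (gram_root L)" "gram_root L ** gram_root L = transpose L ** L"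
    "invertible (gram_root L)" "transpose (gram_root L) = gram_root L"
proof -
  obtain B where B: "pos_def B" "B ** B = transpose L ** L" using assms by (auto simp: has_gram_root_def)
  then have "gram_root L = B" by (simp add: gram_root_def psd_sqrt_eqI)
  then show "pos_def (gram_root L)" "gram_root L ** gram_root L = transpose L ** L"
    "invertible (gram_root L)" "transpose (gram_root L) = gram_root L"
    using B pos_def_imp_invertible by (auto simp: pos_def_def)
qed

lemma transpose_matrix_inv:
  fixes A :: "real^'n^'n"
  assumes "invertible A"
  shows "transpose (matrix_inv A) = matrix_inv (transpose A)"
  by (rule matrix_inv_eqI[symmetric])
    (metis assms matrix_inv_mult(2) matrix_transpose_mul transpose_mat)

lemma polar_in_St:
  assumes "has_gram_root L"
  shows "polar L \<in> St"
proof -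
  note g = gram_root[OF assms]
  let ?B = "gram_root L" and ?S = "matrix_inv (gram_root L)"
  have tS: "transpose ?S = ?S" using transpose_matrix_inv[OF g(3)] g(4) by simp
  have "transpose (polar L) ** polar L = ?S ** (transpose L ** L) ** ?S"
    by (simp add: polar_def matrix_transpose_mul tS matrix_mul_assoc)
  also have "\<dots> = (?S ** ?B) ** (?B ** ?S)" by (simp only: g(2)[symmetric] matrix_mul_assoc)
  also have "\<dots> = mat 1" using matrix_inv_mult[OF g(3)] by simp
  finally show ?thesis by (simp add: St_def)
qed

lemma has_gram_root_St: "V \<in> St \<Longrightarrow> has_gram_root V"
  unfolding has_gram_root_def by (intro exI[of _ "mat 1"]) (simp add: St_def pos_def_mat1)

lemma gram_root_St: "V \<in> St \<Longrightarrow> gram_root V = mat 1"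
  unfolding gram_root_def by (rule psd_sqrt_eqI) (simp_all add: St_def pos_def_mat1)

lemma polar_St: "V \<in> St \<Longrightarrow> polar V = V"
  by (simp add: polar_def gram_root_St matrix_inv_mat1)

text \<open>Conjugating the root of $L^T L$ with \<open>Q\<close> gives a positive definite root of the Gram matrix of \<open>L Q\<close>,
  and roots are unique.\<close>

lemma gram_root_mult_orthogonal:
  assumes "has_gram_root L" and Q: "orthogonal_matrix Q"
  shows "has_gram_root (L ** Q)" "polar (L ** Q) = polar L ** Q"
proof -
  note g = gram_root[OF assms(1)]
  have Q': "transpose Q ** Q = mat 1" "Q ** transpose Q = mat 1" using Q by (auto simp: orthogonal_matrix_def)
  let ?B = "transpose Q ** gram_root L ** Q"
  have "x \<bullet> (?B *v x) = (Q *v x) \<bullet> (gram_root L *v (Q *v x))" for x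
    by (metis dot_lmul_matrix matrix_vector_mul_assoc transpose_matrix_vector inner_commute)
  moreover have "Q *v x \<noteq> 0" if "x \<noteq> 0" for x
    by (metis Q'(1) matrix_vector_mul_assoc matrix_vector_mul_lid matrix_vector_mult_0_right that)
  ultimately have pd: "pos_def ?B"
    using g(1,4) by (simp add: pos_def_def matrix_transpose_mul matrix_mul_assoc)
  have "?B ** ?B = transpose Q ** gram_root L ** (Q ** transpose Q) ** gram_root L ** Q"
    by (simp add: matrix_mul_assoc)
  also have "\<dots> = transpose Q ** (gram_root L ** gram_root L) ** Q" by (simp add: Q'(2) matrix_mul_assoc)
  also have "\<dots> = transpose (L ** Q) ** (L ** Q)" by (simp add: g(2) matrix_transpose_mul matrix_mul_assoc)
  finally have sq: "?B ** ?B = transpose (L ** Q) ** (L ** Q)" .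
  show "has_gram_root (L ** Q)" using pd sq by (auto simp: has_gram_root_def)
  have r: "gram_root (L ** Q) = ?B" using psd_sqrt_eqI[OF pd sq] by (simp add: gram_root_def)
  have "?B ** (transpose Q ** matrix_inv (gram_root L) ** Q) =
     transpose Q ** gram_root L ** (Q ** transpose Q) ** matrix_inv (gram_root L) ** Q"
    by (simp add: matrix_mul_assoc)
  also have "\<dots> = transpose Q ** (gram_root L ** matrix_inv (gram_root L)) ** Q" by (simp add: Q'(2) matrix_mul_assoc)
  also have "\<dots> = mat 1" by (simp add: matrix_inv_mult[OF g(3)] Q'(1))
  finally have i: "matrix_inv ?B = transpose Q ** matrix_inv (gram_root L) ** Q" by (rule matrix_inv_eqI)
  have "polar (L ** Q) = L ** (Q ** transpose Q) ** matrix_inv (gram_root L) ** Q"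
    by (simp add: polar_def[of "L ** Q"] r i matrix_mul_assoc)
  then show "polar (L ** Q) = polar L ** Q" by (simp add: Q'(2) polar_def)
qed

lemma smooth_at_gram_root:
  fixes V :: "real^'r^'n"
  assumes V: "V \<in> St"
  shows "smooth_at V gram_root" "\<forall>\<^sub>F L in nhds V. has_gram_root L"
proof -
  obtain N and s :: "real^'r^'r \<Rightarrow> real^'r^'r" where N: "open N" "mat 1 \<in> N" "smooth_on N s"
    and s: "\<And>A. A \<in> N \<Longrightarrow> transpose A = A \<Longrightarrow> pos_def (s A) \<and> s A ** s A = A"
    using smooth_square_root by blast
  let ?g = "\<lambda>L :: real^'r^'n. transpose L ** L"
  have sg: "smooth_at V ?g" by (intro smooth_at_matrix_mult smooth_at_transpose smooth_at_ident)
  have "?g V = mat 1" using V by (simp add: St_def)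
  then have ev: "\<forall>\<^sub>F L in nhds V. ?g L \<in> N"
    using smooth_at_imp_eventually[OF sg, of "\<lambda>A. A \<in> N"] eventually_nhds_in_open[OF N(1,2)] by simp
  have root: "pos_def (s (?g L)) \<and> s (?g L) ** s (?g L) = ?g L" if "?g L \<in> N" for L
    using s[OF that] by (simp add: matrix_transpose_mul)
  show "\<forall>\<^sub>F L in nhds V. has_gram_root L"
    using ev by eventually_elim (use root has_gram_root_def in blast)
  have "smooth_at V (\<lambda>L. s (?g L))"
    using N(2,3) \<open>?g V = mat 1\<close> by (intro smooth_at_compose[OF sg]) (auto intro: smooth_on_imp_smooth_at)
  moreover have "\<forall>\<^sub>F L in nhds V. s (?g L) = gram_root L"
    using ev
  proof eventually_elim
    case (elim L)
    then show ?case using psd_sqrt_eqI[of "s (?g L)" "?g L"] root[OF elim] by (simp add: gram_root_def)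
  qed
  ultimately show "smooth_at V gram_root" by (rule smooth_at_cong)
qed

lemma smooth_at_polar:
  assumes V: "V \<in> St"
  shows "smooth_at V polar"
proof -
  have "smooth_at V (\<lambda>L. L ** matrix_inv (gram_root L))"
  proof (intro smooth_at_matrix_mult smooth_at_ident smooth_at_compose[OF smooth_at_gram_root(1)[OF V], of matrix_inv])
    show "smooth_at (gram_root V) matrix_inv"
      by (intro smooth_at_matrix_inv gram_root has_gram_root_St V)
  qed
  moreover have "(\<lambda>L :: real^'r^'n. L ** matrix_inv (gram_root L)) = polar"
    by (rule ext) (rule polar_def[symmetric])
  ultimately show ?thesis by (rule back_subst[of "smooth_at V"])
qed

text \<open>The Gram matrix is the identity to first order, so its root \<open>q\<close> has vanishing first derivative
  and half the second derivative; the inverse of \<open>q\<close> has the negative of it. The product rule for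
  \<open>L q\<^sup>-\<^sup>1\<close> gives the claim. Only existence of the jets of \<open>q\<close> and its inverse is taken from smoothness;
  their values are found by comparing jets in the equations that define them.\<close>

lemma jet2_polar:
  fixes L :: "real \<Rightarrow> real^'r^'n"
  assumes sm: "smooth_at 0 L" and L: "jet2 L V L1 L2" and V: "V \<in> St" and L1: "transpose V ** L1 = 0"
  shows "jet2 (\<lambda>t. polar (L t)) V L1
    (L2 - V ** ((1/2) *\<^sub>R (transpose V ** L2 + transpose L2 ** V + 2 *\<^sub>R (transpose L1 ** L1))))"
proof -
  have L0: "L 0 = V" by (rule jet2_value[OF L])
  have sg: "smooth_at 0 (\<lambda>t. gram_root (L t))"
    using smooth_at_gram_root(1)[OF V] L0 by (intro smooth_at_compose[OF sm]) simp
  obtain q1 q2 where "jet2 (\<lambda>t. gram_root (L t)) (gram_root (L 0)) q1 q2"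
    by (rule smooth_at_jet2[OF sg])
  then have q: "jet2 (\<lambda>t. gram_root (L t)) (mat 1) q1 q2" by (simp add: L0 gram_root_St V)
  have ev: "\<forall>\<^sub>F t in nhds 0. has_gram_root (L t)"
    using smooth_at_imp_eventually[OF sm, of has_gram_root] smooth_at_gram_root(2)[OF V] L0 by simp
  have VV: "transpose V ** V = mat 1" using V by (simp add: St_def)
  have L1': "transpose L1 ** V = 0"
    by (metis L1 matrix_transpose_mul transpose_transpose transpose_zero)
  have LL: "jet2 (\<lambda>t. transpose (L t) ** L t) (mat 1) 0
     (transpose V ** L2 + transpose L2 ** V + 2 *\<^sub>R (transpose L1 ** L1))"
    using jet2_matrix_mult[OF jet2_transpose[OF L] L] by (simp add: VV L1 L1' add_ac)
  have "jet2 (\<lambda>t. gram_root (L t) ** gram_root (L t)) (mat 1) 0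
     (transpose V ** L2 + transpose L2 ** V + 2 *\<^sub>R (transpose L1 ** L1))"
    by (rule jet2_cong[OF LL]) (use ev in eventually_elim, simp add: gram_root)
  from jet2_unique[OF this jet2_matrix_mult[OF q q]]
  have q1: "q1 = 0" and
    "q2 + 2 *\<^sub>R (q1 ** q1) + q2 = transpose V ** L2 + transpose L2 ** V + 2 *\<^sub>R (transpose L1 ** L1)"
    by (simp_all add: scaleR_2[symmetric])
  then have q2: "2 *\<^sub>R q2 = transpose V ** L2 + transpose L2 ** V + 2 *\<^sub>R (transpose L1 ** L1)"
    by (simp add: scaleR_2 matrix_mult_algebra)
  have "smooth_at (mat 1) (matrix_inv :: real^'r^'r \<Rightarrow> _)"
    by (intro smooth_at_matrix_inv pos_def_imp_invertible pos_def_mat1)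
  then have si: "smooth_at 0 (\<lambda>t. matrix_inv (gram_root (L t)))"
    by (intro smooth_at_compose[OF sg]) (simp add: L0 gram_root_St V)
  have "matrix_inv (gram_root (L 0)) = mat 1" by (simp add: L0 gram_root_St V matrix_inv_mat1)
  then obtain s1 s2 where s: "jet2 (\<lambda>t. matrix_inv (gram_root (L t))) (mat 1) s1 s2"
    using smooth_at_jet2[OF si] by metis
  have "jet2 (\<lambda>t. gram_root (L t) ** matrix_inv (gram_root (L t))) (mat 1) 0 0"
    by (rule jet2_cong[OF jet2_const]) (use ev in eventually_elim, simp add: gram_root matrix_inv_mult)
  from jet2_unique[OF this jet2_matrix_mult[OF q s]] q1
  have s1: "s1 = 0" and "s2 + q2 = 0" by (simp_all add: matrix_mult_algebra)
  then have "2 *\<^sub>R s2 = - (2 *\<^sub>R q2)" by (simp add: add_eq_0_iff2)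
  then have s2: "s2 = - ((1/2) *\<^sub>R (transpose V ** L2 + transpose L2 ** V + 2 *\<^sub>R (transpose L1 ** L1)))"
    unfolding q2 by (metis (no_types) scaleR_half_double scaleR_2 scaleR_right.minus)
  show ?thesis
    using jet2_matrix_mult[OF L s] unfolding polar_def s1 s2 by (simp add: matrix_mult_algebra)
qed

section \<open>Orthonormal frames and projectors\<close>

(* products with a transposed frame are kept in column form, in which frames cancel *)
declare transpose_matrix_vector [simp del]

lemma inner_matrix_vector:
  fixes A :: "real^'n^'m"
  shows "(A *v x) \<bullet> y = x \<bullet> (transpose A *v y)"
  using dot_lmul_matrix[of y A x] transpose_matrix_vector[of A y] inner_commute[of "A *v x" y]
    inner_commute[of "y v* A" x] by simp

text \<open>The null space is the orthogonal complement of the row space.\<close>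

lemma dim_null_space_plus_rank:
  fixes A :: "real^'n^'m"
  shows "dim {x. A *v x = 0} + rank A = CARD('n)"
proof -
  have "{x. A *v x = 0} = {y \<in> UNIV. \<forall>x\<in>range ((*v) (transpose A)). orthogonal x y}"
  proof -
    have "(transpose A *v z) \<bullet> y = z \<bullet> (A *v y)" for z y
      by (simp add: inner_matrix_vector)
    then have "(\<forall>z. (transpose A *v z) \<bullet> y = 0) \<longleftrightarrow> A *v y = 0" for y
      by (metis inner_eq_zero_iff inner_zero_right)
    then show ?thesis by (auto simp: orthogonal_def)
  qed
  moreover have "dim {y \<in> (UNIV :: (real^'n) set). \<forall>x\<in>range ((*v) (transpose A)). orthogonal x y}
      + dim (range ((*v) (transpose A))) = dim (UNIV :: (real^'n) set)"
    by (rule dim_subspace_orthogonal_to_vectors) (auto intro!: linear_subspace_image)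
  ultimately show ?thesis using rank_dim_range[of "transpose A"] by (simp add: rank_transpose)
qed

lemma St_inverse: "V \<in> St \<Longrightarrow> transpose V ** V = mat 1"
  by (simp add: St_def)

lemma St_cancel:
  assumes "V \<in> St"
  shows "transpose V ** V = mat 1" "A ** transpose V ** V = A"
  using assms by (simp_all add: St_def flip: matrix_mul_assoc)

lemma St_vector_cancel: "V \<in> St \<Longrightarrow> transpose V *v (V *v x) = x"
  by (simp add: St_def matrix_vector_mul_assoc)

lemma dim_range_St:
  fixes V :: "real^'r^'n"
  assumes "V \<in> St"
  shows "dim (range ((*v) V)) = CARD('r)"
proof -
  have "inj ((*v) V)" using St_vector_cancel[OF assms] by (metis injI)
  then have "dim (((*v) V) ` (UNIV :: (real^'r) set)) = dim (UNIV :: (real^'r) set)"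
    by (intro dim_image_eq) auto
  then show ?thesis by simp
qed

lemma rank_St: "V \<in> St \<Longrightarrow> rank (V :: real^'r^'n) = CARD('r)"
  by (simp add: rank_dim_range dim_range_St)

lemma complementary_projector_in_Gr:
  fixes W :: "real^'r^'n"
  assumes W: "W \<in> St"
  shows "mat 1 - W ** transpose W \<in> Gr (CARD('n) - CARD('r))"
proof -
  let ?G = "mat 1 - W ** transpose W"
  have "?G ** ?G = ?G" by (simp add: matrix_mult_algebra matrix_mul_assoc St_cancel[OF W])
  moreover have "transpose ?G = ?G" by (simp add: transpose_algebra)
  moreover have "{x. ?G *v x = 0} = range ((*v) W)"
  proof -
    have "?G *v x = 0 \<longleftrightarrow> x = W *v (transpose W *v x)" for x
      by (simp add: matrix_vector_mult_diff_rdistrib matrix_vector_mul_assoc)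
    moreover have "W *v y = W *v (transpose W *v (W *v y))" for y by (simp add: St_vector_cancel[OF W])
    ultimately show ?thesis by blast
  qed
  then have "rank ?G = CARD('n) - CARD('r)"
    using dim_null_space_plus_rank[of ?G] dim_range_St[OF W] by simp
  ultimately show ?thesis by (simp add: Gr_def)
qed

text \<open>The columns of \<open>V\<close> form an orthonormal basis of the null space of \<open>G\<close>, which has dimension \<open>r\<close>.\<close>

lemma Gr_imp_complementary_projector:
  fixes G :: "real^'n^'n"
  assumes G: "G \<in> Gr (CARD('n) - CARD('r::finite))" and le: "CARD('r) \<le> CARD('n)"
  obtains V :: "real^'r^'n" where "V \<in> St" "G = mat 1 - V ** transpose V"
proof -
  have G': "transpose G = G" "G ** G = G" "rank G = CARD('n) - CARD('r)" using G by (auto simp: Gr_def)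
  let ?N = "{x. G *v x = 0}"
  have sub: "subspace ?N" by (intro linear_subspace_kernel) simp
  have dN: "dim ?N = CARD('r)" using dim_null_space_plus_rank[of G] G'(3) le by simp
  obtain B where B: "B \<subseteq> ?N" "pairwise orthogonal B" "\<And>x. x \<in> B \<Longrightarrow> norm x = 1"
    "independent B" "card B = dim ?N" "span B = ?N"
    using orthonormal_basis_subspace[OF sub] by metis
  have "finite B" using B(4) independent_imp_finite by blast
  then obtain \<phi> where \<phi>: "bij_betw \<phi> (UNIV :: 'r set) B"
    using B(5) dN bij_betw_iff_card[of "UNIV :: 'r set" B] by auto
  define V :: "real^'r^'n" where "V = (\<chi> i k. \<phi> k $ i)"
  have col: "column k V = \<phi> k" for k by (vector V_def column_def)
  have \<phi>B: "\<phi> k \<in> B" for k using \<phi> by (auto simp: bij_betw_def)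
  have "\<phi> k \<bullet> \<phi> l = (if k = l then 1 else 0)" for k l
  proof (cases "k = l")
    case True
    then show ?thesis using B(3)[OF \<phi>B[of l]] by (simp add: norm_eq_1)
  next
    case False
    then have "\<phi> k \<noteq> \<phi> l" using \<phi> by (auto simp: bij_betw_def inj_on_def)
    then show ?thesis using B(2) \<phi>B False by (auto simp: pairwise_def orthogonal_def)
  qed
  then have VS: "V \<in> St"
    by (simp add: St_def matrix_mult_transpose_dot_column col mat_def)
  have GV: "G ** V = 0"
  proof -
    have "G *v (V *v x) = 0" for x
    proof -
      have "V *v x = (\<Sum>k\<in>UNIV. x $ k *s \<phi> k)"
        using matrix_mult_sum[of V x] by (simp add: col)
      moreover have "(\<Sum>k\<in>UNIV. x $ k *s \<phi> k) \<in> ?N"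
        unfolding scalar_mult_eq_scaleR using B(1) \<phi>B
        by (intro subspace_sum[OF sub] subspace_scale[OF sub]) blast
      ultimately show ?thesis by simp
    qed
    then show ?thesis by (simp add: matrix_eq matrix_vector_mul_assoc)
  qed
  have VVN: "V *v (transpose V *v x) = x" if "x \<in> ?N" for x
  proof -
    have "?N \<subseteq> {x. (V ** transpose V - mat 1) *v x = 0}"
      unfolding B(6)[symmetric]
    proof (rule span_minimal)
      show "B \<subseteq> {x. (V ** transpose V - mat 1) *v x = 0}"
      proof
        fix b assume "b \<in> B"
        then obtain k where "b = \<phi> k" using \<phi> by (auto simp: bij_betw_def)
        then have "b = V *v axis k 1" using col[of k] by (simp add: matrix_vector_mult_basis)
        then have "V *v (transpose V *v b) = b" using St_vector_cancel[OF VS] by simp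
        then show "b \<in> {x. (V ** transpose V - mat 1) *v x = 0}"
          by (simp add: matrix_vector_mult_diff_rdistrib matrix_vector_mul_assoc)
      qed
      show "subspace {x. (V ** transpose V - mat 1) *v x = 0}" by (intro linear_subspace_kernel) simp
    qed
    then show ?thesis using that
      by (auto simp: matrix_vector_mult_diff_rdistrib matrix_vector_mul_assoc)
  qed
  have "V ** transpose V ** (mat 1 - G) = mat 1 - G"
  proof -
    have "G *v ((mat 1 - G) *v x) = 0" for x
      by (simp add: matrix_vector_mul_assoc matrix_mult_algebra G'(2))
    then have "V *v (transpose V *v ((mat 1 - G) *v x)) = (mat 1 - G) *v x" for x by (intro VVN) simp
    then show ?thesis by (simp add: matrix_eq matrix_vector_mul_assoc matrix_mul_assoc)
  qed
  moreover have "transpose V ** G = 0"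
    using arg_cong[OF GV, of transpose] by (simp add: matrix_transpose_mul G'(1) transpose_zero)
  ultimately have "V ** transpose V = mat 1 - G"
    by (simp add: matrix_mult_algebra flip: matrix_mul_assoc)
  then have "G = mat 1 - V ** transpose V" by simp
  with VS show ?thesis by (rule that)
qed

text \<open>The complements of the ranges of \<open>U\<close> and \<open>W\<close> have equal dimension, so there is a linear map \<open>f\<close> that
  is an isometry between them. The sum of $W U^T$ and of \<open>f\<close> after the projection onto the
  complement is orthogonal by Pythagoras.\<close>

lemma St_orthogonal_transitive:
  fixes U W :: "real^'r^'n"
  assumes U: "U \<in> St" and W: "W \<in> St"
  obtains Q :: "real^'n^'n" where "orthogonal_matrix Q" "Q ** U = W"
proof -
  let ?N = "\<lambda>V :: real^'r^'n. {x. transpose V *v x = 0}"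
  have sub: "subspace (?N V)" for V by (intro linear_subspace_kernel) simp
  have dm: "dim (?N U) = dim (?N W)"
    using dim_null_space_plus_rank[of "transpose U"] dim_null_space_plus_rank[of "transpose W"]
    by (simp add: rank_transpose rank_St U W)
  obtain f where f: "linear f" "f ` ?N U = ?N W" "\<And>x. x \<in> ?N U \<Longrightarrow> norm (f x) = norm x"
    by (rule isometries_subspaces[OF sub[of U] sub[of W] dm]) blast
  define q where "q x = W *v (transpose U *v x) + f (x - U *v (transpose U *v x))" for x
  have "linear q" unfolding q_def
    by (intro linearI)
      (simp_all add: matrix_vector_right_distrib matrix_vector_mult_scaleR linear_add[OF f(1)]
        linear_diff[OF f(1)] linear_scale[OF f(1)] algebra_simps)
  have nrm: "norm (q x) = norm x" for x
  proof -
    let ?u = "transpose U *v x" and ?v = "x - U *v (transpose U *v x)"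
    have v: "?v \<in> ?N U" by (simp add: matrix_vector_mult_diff_distrib St_vector_cancel[OF U])
    then have fv: "transpose W *v f ?v = 0" using f(2) by blast
    have pyth: "(norm (V *v a + b))\<^sup>2 = (norm a)\<^sup>2 + (norm b)\<^sup>2" if "V \<in> St" "transpose V *v b = 0"
      for V :: "real^'r^'n" and a b
    proof -
      have 1: "(V *v a) \<bullet> b = 0"
        by (simp add: inner_matrix_vector that(2))
      have 2: "(V *v a) \<bullet> (V *v a) = a \<bullet> a"
        by (simp add: inner_matrix_vector St_vector_cancel[OF that(1)])
      have 3: "b \<bullet> (V *v a) = 0" by (simp only: 1 inner_commute[of b "V *v a"])
      show ?thesis by (simp add: power2_norm_eq_inner inner_add_left inner_add_right 1 2 3)
    qed
    have "(norm (q x))\<^sup>2 = (norm ?u)\<^sup>2 + (norm (f ?v))\<^sup>2" unfolding q_def by (rule pyth[OF W fv])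
    also have "\<dots> = (norm ?u)\<^sup>2 + (norm ?v)\<^sup>2" using f(3)[OF v] by simp
    also have "\<dots> = (norm (U *v ?u + ?v))\<^sup>2" using pyth[OF U, of ?v ?u] v by simp
    also have "U *v ?u + ?v = x" by simp
    finally show ?thesis by simp
  qed
  have "orthogonal_transformation q" using \<open>linear q\<close> nrm by (simp add: orthogonal_transformation)
  then have "orthogonal_matrix (matrix q)" by (simp add: orthogonal_transformation_matrix)
  moreover have "matrix q ** U = W"
  proof -
    have "matrix q *v (U *v y) = W *v y" for y
      using \<open>linear q\<close> by (simp add: matrix_works q_def St_vector_cancel[OF U] linear_0[OF f(1)])
    then show ?thesis by (simp add: matrix_eq matrix_vector_mul_assoc)
  qed
  ultimately show ?thesis by (rule that)
qed

text \<open>The columns are the coordinate vectors selected by \<open>e\<close>. Multiplication by the transpose of this frame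
  is \<^const>\<open>pad\<close>.\<close>

definition pad_frame :: "('r::finite \<Rightarrow> 'n::finite) \<Rightarrow> real^'r^'n" where
  "pad_frame e = (\<chi> j k. if j = e k then 1 else 0)"

lemma pad_eq_mult:
  assumes "inj e"
  shows "pad e H = H ** transpose (pad_frame e)"
proof -
  have "pad e H $ i $ j = (\<Sum>k\<in>UNIV. H $ i $ k * (if j = e k then 1 else 0))" for i j
  proof (cases "j \<in> range e")
    case True
    then obtain k where k: "j = e k" by blast
    have "(\<Sum>l\<in>UNIV. H $ i $ l * (if j = e l then 1 else 0)) = (\<Sum>l\<in>UNIV. if l = k then H $ i $ l else 0)"
      using assms k by (intro sum.cong) (auto simp: inj_eq)
    then show ?thesis using assms k by (simp add: pad_def)
  next
    case False
    then have "(\<Sum>k\<in>UNIV. H $ i $ k * (if j = e k then 1 else 0)) = 0" by (intro sum.neutral) auto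
    then show ?thesis using False by (simp add: pad_def)
  qed
  then show ?thesis by (simp add: vec_eq_iff matrix_matrix_mult_def transpose_def pad_frame_def)
qed

lemma pad_frame_in_St:
  assumes "inj e"
  shows "pad_frame e \<in> St"
proof -
  have "column k (pad_frame e) = axis (e k) 1" for k
    by (simp add: vec_eq_iff column_def pad_frame_def axis_def)
  then have "(transpose (pad_frame e) ** pad_frame e) $ k $ l = (mat 1 :: real^'a^'a) $ k $ l" for k l
    using assms by (simp add: matrix_mult_transpose_dot_column inner_axis_axis mat_def inj_eq)
  then show ?thesis by (simp add: St_def vec_eq_iff)
qed

lemma orthogonal_transpose_inverse:
  "orthogonal_matrix Q \<Longrightarrow> transpose Q ** Q = mat 1" "orthogonal_matrix Q \<Longrightarrow> Q ** transpose Q = mat 1"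
  by (auto simp: orthogonal_matrix_def)

lemma St_mult_orthogonal:
  assumes "V \<in> St" "orthogonal_matrix Q"
  shows "V ** Q \<in> St"
proof -
  have "transpose (V ** Q) ** (V ** Q) = transpose Q ** (transpose V ** V) ** Q"
    by (simp add: matrix_transpose_mul matrix_mul_assoc)
  then show ?thesis using assms by (simp add: St_def orthogonal_transpose_inverse)
qed

lemma norm_mult_orthogonal:
  fixes A :: "real^'n^'m"
  assumes "orthogonal_matrix Q"
  shows "norm (A ** Q) = norm A"
  by (simp add: norm_eq_sqrt_inner inner_mult_right orthogonal_transpose_inverse[OF assms] flip: matrix_mul_assoc)

text \<open>The projector \<open>I - G\<close> is \<open>U U\<^sup>T\<close> for some frame \<open>U\<close>. The columns of \<open>W\<close> lie in the range of \<open>U\<close>,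
  hence \<open>W = U Q\<close> for a square matrix \<open>Q\<close>, and \<open>Q\<close> is orthogonal because \<open>U\<close> and \<open>W\<close> are frames.\<close>

lemma polar_of_projected_frame:
  fixes V :: "real^'r^'n"
  assumes G: "G \<in> Gr (CARD('n) - CARD('r))" and le: "CARD('r) \<le> CARD('n)"
    and root: "has_gram_root ((mat 1 - G) ** V)"
  defines "W \<equiv> polar ((mat 1 - G) ** V)"
  shows "W \<in> St" "G = mat 1 - W ** transpose W"
proof -
  show W: "W \<in> St" unfolding W_def by (rule polar_in_St[OF root])
  obtain U :: "real^'r^'n" where U: "U \<in> St" "G = mat 1 - U ** transpose U"
    by (rule Gr_imp_complementary_projector[OF G le])
  let ?Q = "transpose U ** W"
  have "U ** transpose U ** (U ** transpose U) = U ** transpose U"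
    by (simp add: matrix_mul_assoc St_cancel(2)[OF U(1)])
  then have "U ** ?Q = W"
    by (simp add: W_def polar_def U(2) matrix_mul_assoc)
  moreover have "transpose ?Q ** ?Q = transpose W ** (U ** ?Q)"
    by (simp add: matrix_transpose_mul matrix_mul_assoc)
  ultimately have "orthogonal_matrix ?Q" by (simp only: orthogonal_matrix St_inverse[OF W])
  have "W ** transpose W = U ** (?Q ** transpose ?Q) ** transpose U"
    by (subst (1 2) \<open>U ** ?Q = W\<close>[symmetric]) (simp add: matrix_transpose_mul matrix_mul_assoc)
  also have "\<dots> = U ** transpose U"
    by (simp only: orthogonal_transpose_inverse(2)[OF \<open>orthogonal_matrix ?Q\<close>] matrix_mul_rid)
  finally show "G = mat 1 - W ** transpose W" by (simp add: U(2))
qed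

text \<open>A frame of the range of \<open>I - G\<close> that depends smoothly on \<open>p = (X, G)\<close> near a point at which \<open>V\<close> is
  such a frame, and equals \<open>V\<close> there.\<close>

definition frame :: "real^'r^'n \<Rightarrow> (real^'n^'m) \<times> (real^'n^'n) \<Rightarrow> real^'r^'n" where
  "frame V p = polar ((mat 1 - snd p) ** V)"

lemma frame_base:
  assumes "V \<in> St" "snd p = mat 1 - V ** transpose V"
  shows "(mat 1 - snd p) ** V = V" "frame V p = V"
  using assms by (simp_all add: frame_def polar_St St_cancel)

lemma smooth_at_frame:
  assumes "V \<in> St" "snd p = mat 1 - V ** transpose V"
  shows "smooth_at p (frame V)"
  unfolding frame_def
  by (rule smooth_at_compose[of _ "\<lambda>p. (mat 1 - snd p) ** V" polar])
    (auto simp only: frame_base[OF assms] intro!: smooth_at_matrix_mult smooth_at_intros smooth_at_polar assms(1))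

section \<open>Representations of points and tangent vectors\<close>

locale orthogonally_invariant =
  fixes h :: "real^'n^'m \<Rightarrow> real^'q" and e :: "'r::finite \<Rightarrow> 'n"
  assumes inj_e: "inj e" and inv: "\<And>X Q. orthogonal_matrix Q \<Longrightarrow> h (X ** Q) = h X"
begin

text \<open>The padded matrix and the matrix on the right are carried into each other by an orthogonal matrix that
  maps the coordinate frame to \<open>V\<close>. So the constraint on \<open>H\<close> can be tested with any frame.\<close>

lemma h_pad:
  assumes "V \<in> St"
  shows "h (pad e H) = h (H ** transpose V)"
proof -
  obtain Q where Q: "orthogonal_matrix Q" "Q ** pad_frame e = V"
    using St_orthogonal_transitive[OF pad_frame_in_St[OF inj_e] assms] .
  have "H ** transpose V = pad e H ** transpose Q"
    by (simp add: Q(2)[symmetric] pad_eq_mult[OF inj_e] matrix_transpose_mul matrix_mul_assoc)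
  then show ?thesis using inv[of "transpose Q"] Q(1) by simp
qed

lemma mem_Hr_iff: "V \<in> St \<Longrightarrow> H \<in> Hr h e \<longleftrightarrow> h (H ** transpose V) = 0"
  by (simp add: Hr_def h_pad)

lemma Hr_mult_orthogonal:
  assumes "orthogonal_matrix Q"
  shows "H ** Q \<in> Hr h e \<longleftrightarrow> H \<in> Hr h e"
proof -
  let ?E = "pad_frame e"
  have E: "?E \<in> St" by (rule pad_frame_in_St[OF inj_e])
  have E': "?E ** transpose Q \<in> St" using E assms by (intro St_mult_orthogonal) simp_all
  have "H ** transpose (?E ** transpose Q) = (H ** Q) ** transpose ?E"
    by (simp add: matrix_transpose_mul matrix_mul_assoc)
  then show ?thesis using mem_Hr_iff[OF E, of "H ** Q"] mem_Hr_iff[OF E', of H] by simp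
qed

lemma represents_point_imp_Mh:
  assumes "represents_point h e H V p"
  shows "p \<in> Mh h e"
proof -
  have "H \<in> Hr h e" and V: "V \<in> St" and p: "p = (H ** transpose V, mat 1 - V ** transpose V)"
    using assms by (auto simp: represents_point_def)
  then have "h (H ** transpose V) = 0" by (simp add: mem_Hr_iff)
  moreover have "H ** transpose V ** (mat 1 - V ** transpose V) = 0"
    by (simp add: matrix_mult_algebra matrix_mul_assoc St_cancel[OF V])
  ultimately show ?thesis using complementary_projector_in_Gr[OF V] by (simp add: Mh_def p)
qed

lemma card_le: "CARD('r) \<le> CARD('n)"
  using card_inj_on_le[OF inj_e] by simp

lemma represents_pointI:
  assumes "p \<in> Mh h e" "V \<in> St" "snd p = mat 1 - V ** transpose V"
  shows "represents_point h e (fst p ** V) V p"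
proof -
  have "fst p ** (mat 1 - V ** transpose V) = 0" "h (fst p) = 0" using assms by (auto simp: Mh_def)
  then have X: "fst p ** V ** transpose V = fst p" by (simp add: matrix_mult_algebra matrix_mul_assoc)
  then show ?thesis using assms \<open>h (fst p) = 0\<close>
    by (simp add: represents_point_def mem_Hr_iff prod_eq_iff)
qed

lemma represents_point_exists:
  assumes "p \<in> Mh h e"
  obtains H V where "represents_point h e H V p"
proof -
  have G: "snd p \<in> Gr (CARD('n) - CARD('r))" using assms by (auto simp: Mh_def)
  obtain V :: "real^'r^'n" where "V \<in> St" "snd p = mat 1 - V ** transpose V"
    by (rule Gr_imp_complementary_projector[OF G card_le])
  then show ?thesis using represents_pointI[OF assms] by (intro that)
qed

lemma represents_point_eq:
  assumes "represents_point h e H V p"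
  shows "H = fst p ** V"
  using assms by (auto simp: represents_point_def St_cancel(2))

text \<open>The orthogonal matrix is $Q = V^T V'$: since \<open>V\<close> and \<open>V'\<close> define the same projector, \<open>V Q = V'\<close>.\<close>

lemma represents_point_unique:
  assumes "represents_point h e H V p" "represents_point h e H' V' p"
  obtains Q where "orthogonal_matrix Q" "H' = H ** Q" "V' = V ** Q"
proof -
  have V: "V \<in> St" "V' \<in> St" and VV: "V ** transpose V = V' ** transpose V'"
    using assms by (auto simp: represents_point_def)
  let ?Q = "transpose V ** V'"
  have "V ** ?Q = V' ** transpose V' ** V'" by (simp only: VV matrix_mul_assoc)
  then have VQ: "V ** ?Q = V'" by (simp only: St_cancel(2)[OF V(2)])
  have "transpose ?Q ** ?Q = transpose V' ** (V ** ?Q)"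
    by (simp add: matrix_transpose_mul matrix_mul_assoc)
  also have "\<dots> = mat 1" by (simp only: VQ St_inverse[OF V(2)])
  finally have "orthogonal_matrix ?Q" by (simp only: orthogonal_matrix)
  moreover have "H' = H ** ?Q"
  proof -
    have "H' = fst p ** (V ** ?Q)" by (simp only: VQ represents_point_eq[OF assms(2)])
    then show ?thesis by (simp only: matrix_mul_assoc represents_point_eq[OF assms(1)])
  qed
  ultimately show ?thesis using VQ[symmetric] by (rule that)
qed

text \<open>Multiplying both components of \<open>\<xi>\<close> by \<open>V\<close> removes the terms with $V_p^T V = 0$; in particular the
  representation of a tangent vector is determined by the one of its base point.\<close>

lemma represents_tangent_eq:
  assumes "represents_point h e H V p" "represents_tangent h e H V K Vp \<xi>"
  shows "K = fst \<xi> ** V" "Vp = - (snd \<xi> ** V)"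
proof -
  have V: "V \<in> St" using assms by (auto simp: represents_point_def)
  have "transpose V ** Vp = 0" using assms by (simp add: represents_tangent_def)
  then have "transpose (transpose V ** Vp) = 0" by (simp only: transpose_zero)
  then have 0: "transpose Vp ** V = 0" by (simp add: matrix_transpose_mul)
  have x: "\<xi> = (K ** transpose V + H ** transpose Vp, - (Vp ** transpose V) - V ** transpose Vp)"
    using assms by (auto simp: represents_tangent_def)
  have c: "A ** transpose Vp ** V = 0" for A :: "real^'r^'k" by (simp add: 0 matrix_mult_algebra flip: matrix_mul_assoc)
  show "K = fst \<xi> ** V" "Vp = - (snd \<xi> ** V)"
    by (simp_all add: x matrix_mult_algebra St_cancel(2)[OF V] c)
qed

lemma eventually_frame_represents:
  assumes V: "V \<in> St" "snd p = mat 1 - V ** transpose V"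
  shows "\<forall>\<^sub>F p' in nhds p. p' \<in> Mh h e \<longrightarrow> represents_point h e (fst p' ** frame V p') (frame V p') p'"
proof -
  have "smooth_at p (\<lambda>p'. (mat 1 - snd p') ** V)"
    by (intro smooth_at_matrix_mult smooth_at_intros)
  from smooth_at_imp_eventually[OF this, of has_gram_root]
  have "\<forall>\<^sub>F p' in nhds p. has_gram_root ((mat 1 - snd p') ** V)"
    using smooth_at_gram_root(2)[OF V(1)] by (simp only: frame_base[OF V])
  then show ?thesis
  proof eventually_elim
    case (elim p')
    show ?case
    proof
      assume M: "p' \<in> Mh h e"
      then have "snd p' \<in> Gr (CARD('n) - CARD('r))" by (auto simp: Mh_def)
      from polar_of_projected_frame[OF this card_le elim]
      show "represents_point h e (fst p' ** frame V p') (frame V p') p'"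
        using M by (intro represents_pointI) (simp_all add: frame_def)
    qed
  qed
qed

text \<open>Differentiating $G^2 = G$, $G^T = G$ and \<open>X G = 0\<close> along a curve gives the algebraic relations. For the
  tangency of \<open>\<eta> V\<close>, the curve \<open>X\<close> is multiplied by the smooth frame of \<open>I - G\<close> obtained as the polar
  factor of \<open>(I - G) V\<close>. The product lies in the reduced constraint set, and its velocity is \<open>\<eta> V\<close>
  because the first derivative $-\zeta V$ of the frame is annihilated by \<open>X\<close>.\<close>

lemma tangent_represents:
  assumes rep: "represents_point h e H V p" and \<xi>: "\<xi> \<in> tangent_space (Mh h e) p"
  shows "represents_tangent h e H V (fst \<xi> ** V) (- (snd \<xi> ** V)) \<xi>"
proof -
  have V: "V \<in> St" "snd p = mat 1 - V ** transpose V" and X0: "fst p = H ** transpose V"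
    using rep by (auto simp: represents_point_def)
  obtain \<gamma> where \<gamma>: "smooth_at 0 \<gamma>" "\<forall>\<^sub>F t in nhds 0. \<gamma> t \<in> Mh h e" "\<gamma> 0 = p"
    "(\<gamma> has_vector_derivative \<xi>) (at 0)"
    using \<xi> by (rule tangent_spaceE)
  obtain c1 c2 where "jet2 \<gamma> (\<gamma> 0) c1 c2" using smooth_at_jet2[OF \<gamma>(1)] .
  then have j: "jet2 \<gamma> p \<xi> c2"
    using \<gamma>(3,4) jet2_imp_has_vector_derivative vector_derivative_unique_at by metis
  let ?\<eta> = "fst \<xi>" and ?\<zeta> = "snd \<xi>" and ?P = "V ** transpose V"
  have jX: "jet2 (\<lambda>t. fst (\<gamma> t)) (fst p) ?\<eta> (fst c2)" by (rule jet2_linear[OF bounded_linear_fst j])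
  have jG: "jet2 (\<lambda>t. snd (\<gamma> t)) (snd p) ?\<zeta> (snd c2)" by (rule jet2_linear[OF bounded_linear_snd j])
  have "jet2 (\<lambda>t. snd (\<gamma> t) ** snd (\<gamma> t)) (snd p) ?\<zeta> (snd c2)"
    by (rule jet2_cong[OF jG]) (use \<gamma>(2) in eventually_elim, auto simp: Mh_def Gr_def)
  from jet2_unique(2)[OF this jet2_matrix_mult[OF jG jG]]
  have z: "?\<zeta> = ?P ** ?\<zeta> + ?\<zeta> ** ?P"
    by (simp add: V(2) matrix_mult_algebra algebra_simps)
  have "jet2 (\<lambda>t. transpose (snd (\<gamma> t))) (snd p) ?\<zeta> (snd c2)"
    by (rule jet2_cong[OF jG]) (use \<gamma>(2) in eventually_elim, auto simp: Mh_def Gr_def)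
  from jet2_unique(2)[OF this jet2_transpose[OF jG]]
  have zs: "transpose ?\<zeta> = ?\<zeta>" .
  have "jet2 (\<lambda>t. fst (\<gamma> t) ** snd (\<gamma> t)) 0 0 0"
    by (rule jet2_cong[OF jet2_const]) (use \<gamma>(2) in eventually_elim, auto simp: Mh_def)
  from jet2_unique(2)[OF this jet2_matrix_mult[OF jX jG]]
  have x: "fst p ** ?\<zeta> + ?\<eta> ** snd p = 0" .
  have VzV: "transpose V ** ?\<zeta> ** V = 0"
  proof -
    have "transpose V ** ?\<zeta> ** V = transpose V ** (?P ** ?\<zeta> + ?\<zeta> ** ?P) ** V" by (simp only: z[symmetric])
    also have "\<dots> = transpose V ** ?\<zeta> ** V + transpose V ** ?\<zeta> ** V"
      by (simp add: matrix_mult_algebra matrix_mul_assoc St_cancel[OF V(1)])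
    finally show ?thesis by simp
  qed
  have hz: "A ** transpose V ** ?\<zeta> ** V = 0" for A :: "real^'r^'k"
    using VzV by (metis matrix_mul_assoc bounded_bilinear.zero_right[OF bounded_bilinear_matrix_mult])
  have eq1: "?\<eta> = ?\<eta> ** V ** transpose V + H ** transpose (- (?\<zeta> ** V))"
    using x by (simp add: X0 V(2) matrix_mult_algebra matrix_mul_assoc transpose_algebra zs)
      (simp add: algebra_simps eq_diff_eq)
  have eq2: "?\<zeta> = - (- (?\<zeta> ** V) ** transpose V) - V ** transpose (- (?\<zeta> ** V))"
    using z by (simp add: matrix_mult_algebra matrix_mul_assoc transpose_algebra zs add.commute)
  have K: "?\<eta> ** V \<in> tangent_space (Hr h e) H"
  proof (rule tangent_spaceI)
    let ?L = "\<lambda>t. (mat 1 - snd (\<gamma> t)) ** V"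
    let ?c = "\<lambda>t. fst (\<gamma> t) ** frame V (\<gamma> t)"
    have sF: "smooth_at 0 (\<lambda>t. frame V (\<gamma> t))"
      using smooth_at_frame[OF V] \<gamma>(3) by (intro smooth_at_compose[OF \<gamma>(1)]) simp
    show "smooth_at 0 ?c" by (intro smooth_at_matrix_mult smooth_at_fst \<gamma>(1) sF)
    show "\<forall>\<^sub>F t in nhds 0. ?c t \<in> Hr h e"
      using smooth_at_imp_eventually[OF \<gamma>(1), unfolded \<gamma>(3), OF eventually_frame_represents[OF V]] \<gamma>(2)
      by eventually_elim (simp add: represents_point_def)
    show "?c 0 = H" using X0 by (simp add: \<gamma>(3) frame_base[OF V] St_cancel[OF V(1)])
    have sL: "smooth_at 0 ?L" by (intro smooth_at_matrix_mult smooth_at_intros \<gamma>(1))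
    have jL: "jet2 ?L V (- (?\<zeta> ** V)) (- (snd c2 ** V))"
      using jet2_matrix_mult[OF jet2_diff[OF jet2_const[of "mat 1"] jG] jet2_const[of V]]
      by (simp only: frame_base[OF V]) (simp add: matrix_mult_algebra)
    have "transpose V ** - (?\<zeta> ** V) = 0" using VzV by (simp add: matrix_mult_algebra matrix_mul_assoc)
    note jF = jet2_polar[OF sL jL V(1) this]
    from jet2_matrix_mult[OF jX jF, THEN jet2_imp_has_vector_derivative]
    show "(?c has_vector_derivative ?\<eta> ** V) (at 0)"
      by (simp add: frame_def X0 matrix_mult_algebra matrix_mul_assoc hz)
  qed
  show ?thesis
    unfolding represents_tangent_def
    using K eq1 eq2 VzV by (auto simp: prod_eq_iff matrix_mult_algebra matrix_mul_assoc)
qed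

end

section \<open>Independence of the retraction from the representation\<close>

lemma pos_def_Mmat:
  assumes "\<omega> > 0"
  shows "pos_def (Mmat \<omega> H)"
proof -
  have "x \<bullet> (Mmat \<omega> H *v x) = 2 * \<omega> * (x \<bullet> x) + (H *v x) \<bullet> (H *v x)" for x
    by (simp add: Mmat_def matrix_vector_mult_add_rdistrib inner_add_right inner_matrix_vector
        scaleR_matrix_vector_assoc[symmetric] matrix_vector_mul_assoc[symmetric])
  then have "0 < x \<bullet> (Mmat \<omega> H *v x)" if "x \<noteq> 0" for x
    using that assms by (simp add: add_pos_nonneg)
  then show ?thesis by (simp add: pos_def_def Mmat_def transpose_algebra)
qed

lemma Wmat_eq_polar: "Wmat \<omega> H V K Vp = polar (Lmat \<omega> H V K Vp)"
  by (simp add: Wmat_def polar_def gram_root_def Let_def)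

text \<open>The matrix $M_{H,\omega}$ and its inverse are conjugated by \<open>Q\<close>, and all interior factors \<open>Q Q\<^sup>T\<close>
  cancel.\<close>

lemma Lmat_mult_orthogonal:
  assumes "\<omega> > 0" and Q: "orthogonal_matrix Q"
  shows "Lmat \<omega> (H ** Q) (V ** Q) (K ** Q) (Vp ** Q) = Lmat \<omega> H V K Vp ** Q"
proof -
  have inv: "invertible (Mmat \<omega> H)" by (intro pos_def_imp_invertible pos_def_Mmat assms)
  note o = orthogonal_transpose_inverse[OF Q]
  have QQ: "A ** Q ** transpose Q = A" for A :: "real^'a^'k" by (simp add: o flip: matrix_mul_assoc)
  have "Mmat \<omega> (H ** Q) = transpose Q ** Mmat \<omega> H ** Q"
    by (simp add: Mmat_def matrix_mult_algebra matrix_transpose_mul matrix_mul_assoc o)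
  then have "Mmat \<omega> (H ** Q) ** (transpose Q ** matrix_inv (Mmat \<omega> H) ** Q) = 
    transpose Q ** (Mmat \<omega> H ** matrix_inv (Mmat \<omega> H)) ** Q"
    by (simp add: matrix_mul_assoc QQ)
  then have "matrix_inv (Mmat \<omega> (H ** Q)) = transpose Q ** matrix_inv (Mmat \<omega> H) ** Q"
    by (intro matrix_inv_eqI) (simp add: matrix_inv_mult[OF inv] o)
  then show ?thesis
    by (simp add: Lmat_def matrix_mult_algebra matrix_transpose_mul matrix_mul_assoc QQ)
qed

context orthogonally_invariant
begin

lemma is_nearest_mult_orthogonal:
  assumes Q: "orthogonal_matrix Q"
  shows "is_nearest (Hr h e) (z ** Q) (y ** Q) \<longleftrightarrow> is_nearest (Hr h e) z y"
proof -
  have d: "dist (a ** Q) (b ** Q) = dist a b" for a b :: "real^'r^'m"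
    using norm_mult_orthogonal[OF Q, of "a - b"] by (simp add: dist_norm matrix_mult_algebra)
  have "w = (w ** transpose Q) ** Q" for w :: "real^'r^'m"
    by (simp add: orthogonal_transpose_inverse[OF Q] flip: matrix_mul_assoc)
  then have "(\<forall>w\<in>Hr h e. dist (z ** Q) (y ** Q) \<le> dist (z ** Q) w) \<longleftrightarrow>
      (\<forall>w\<in>Hr h e. dist z y \<le> dist z w)"
    using Hr_mult_orthogonal[OF Q] d by metis
  then show ?thesis by (simp add: is_nearest_def Hr_mult_orthogonal[OF Q])
qed

text \<open>By the previous lemmas \<open>W\<close> and the point to be projected are multiplied by \<open>Q\<close>. Right multiplication by
  \<open>Q\<close> is an isometry that preserves the reduced constraint set, so the nearest point is multiplied
  by \<open>Q\<close> as well, and \<open>Q\<close> cancels in the two products with $W^T$.\<close>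

lemma R_value_unique:
  assumes "\<omega> > 0"
    and rep: "represents_point h e H V p" "represents_tangent h e H V K Vp \<xi>"
    and root: "has_gram_root (Lmat \<omega> H V K Vp)"
    and near: "is_nearest (Hr h e) ((fst p + fst \<xi>) ** Wmat \<omega> H V K Vp) y"
      "\<forall>y'. is_nearest (Hr h e) ((fst p + fst \<xi>) ** Wmat \<omega> H V K Vp) y' \<longrightarrow> y' = y"
    and rep': "represents_point h e H' V' p" "represents_tangent h e H' V' K' Vp' \<xi>"
  shows "\<exists>!y. is_nearest (Hr h e) ((fst p + fst \<xi>) ** Wmat \<omega> H' V' K' Vp') y"
    "R_value h e \<omega> H' V' K' Vp' p \<xi> = R_value h e \<omega> H V K Vp p \<xi>"
proof -
  obtain Q where Q: "orthogonal_matrix Q" and HV: "H' = H ** Q" "V' = V ** Q"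
    using represents_point_unique[OF rep(1) rep'(1)] .
  have KV: "K' = K ** Q" "Vp' = Vp ** Q"
    using represents_tangent_eq[OF rep] represents_tangent_eq[OF rep']
    by (simp_all add: HV matrix_mul_assoc matrix_mult_algebra)
  have W: "Wmat \<omega> H' V' K' Vp' = Wmat \<omega> H V K Vp ** Q"
    unfolding Wmat_eq_polar HV KV Lmat_mult_orthogonal[OF assms(1) Q]
    by (rule gram_root_mult_orthogonal(2)[OF root Q])
  let ?z = "(fst p + fst \<xi>) ** Wmat \<omega> H V K Vp" and ?z' = "(fst p + fst \<xi>) ** Wmat \<omega> H' V' K' Vp'"
  have z': "?z' = ?z ** Q" by (simp add: W matrix_mul_assoc)
  have n1: "is_nearest (Hr h e) ?z' (y ** Q)" unfolding z' is_nearest_mult_orthogonal[OF Q] by (rule near(1))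
  have n2: "\<forall>u. is_nearest (Hr h e) ?z' u \<longrightarrow> u = y ** Q"
  proof (intro allI impI)
    fix u assume that: "is_nearest (Hr h e) ?z' u"
    have u: "u = (u ** transpose Q) ** Q" by (simp add: orthogonal_transpose_inverse[OF Q] flip: matrix_mul_assoc)
    have "is_nearest (Hr h e) ?z (u ** transpose Q)"
      using that u is_nearest_mult_orthogonal[OF Q, of ?z "u ** transpose Q"] by (simp add: z')
    then have "u ** transpose Q = y" using near(2) by blast
    then show "u = y ** Q" using u by simp
  qed
  show "\<exists>!y. is_nearest (Hr h e) ?z' y" using n1 n2 by blast
  have c: "closest_point (Hr h e) ?z' = closest_point (Hr h e) ?z ** Q"
    using closest_point_eq_unique_nearest[OF n1 n2] closest_point_eq_unique_nearest[OF near] by simp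
  have QQ: "A ** Q ** transpose Q = A" for A :: "real^'r^'k"
    by (simp add: orthogonal_transpose_inverse[OF Q] flip: matrix_mul_assoc)
  show "R_value h e \<omega> H' V' K' Vp' p \<xi> = R_value h e \<omega> H V K Vp p \<xi>"
    by (simp add: R_value_def Let_def c) (simp add: W matrix_transpose_mul matrix_mul_assoc QQ)
qed

lemma R_map_eq_R_value:
  assumes "\<omega> > 0"
    and rep: "represents_point h e H V p" "represents_tangent h e H V K Vp \<xi>"
    and root: "has_gram_root (Lmat \<omega> H V K Vp)"
    and near: "is_nearest (Hr h e) ((fst p + fst \<xi>) ** Wmat \<omega> H V K Vp) y"
      "\<forall>y'. is_nearest (Hr h e) ((fst p + fst \<xi>) ** Wmat \<omega> H V K Vp) y' \<longrightarrow> y' = y"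
  shows "R_map h e \<omega> (p, \<xi>) = R_value h e \<omega> H V K Vp p \<xi>" "R_well_defined_at h e \<omega> p \<xi>"
proof -
  note u = R_value_unique[OF assms]
  show eq: "R_map h e \<omega> (p, \<xi>) = R_value h e \<omega> H V K Vp p \<xi>"
    unfolding R_map_def prod.case
  proof (rule the_equality)
    show "\<exists>H' V' K' Vp'. represents_point h e H' V' p \<and> represents_tangent h e H' V' K' Vp' \<xi> \<and>
        R_value h e \<omega> H V K Vp p \<xi> = R_value h e \<omega> H' V' K' Vp' p \<xi>"
      using rep by blast
  qed (use u(2) in auto)
  show "R_well_defined_at h e \<omega> p \<xi>"
    unfolding R_well_defined_at_def eq
  proof (intro conjI allI impI)
    show "\<exists>H V K Vp. represents_point h e H V p \<and> represents_tangent h e H V K Vp \<xi>" using rep by blast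
    fix H' V' K' Vp'
    assume "represents_point h e H' V' p \<and> represents_tangent h e H' V' K' Vp' \<xi>"
    then have r: "represents_point h e H' V' p" "represents_tangent h e H' V' K' Vp' \<xi>" by auto
    show "\<exists>!Y. Y \<in> Hr h e \<and> (\<forall>Z\<in>Hr h e. dist ((fst p + fst \<xi>) ** Wmat \<omega> H' V' K' Vp') Y
        \<le> dist ((fst p + fst \<xi>) ** Wmat \<omega> H' V' K' Vp') Z)"
      using u(1)[OF r] unfolding is_nearest_def .
    show "R_value h e \<omega> H V K Vp p \<xi> = R_value h e \<omega> H' V' K' Vp' p \<xi>" using u(2)[OF r] by simp
  qed
qed

end

section \<open>Smoothness of the retraction near the zero section\<close>

lemma smooth_at_Lmat:
  assumes "\<omega> > 0" and "smooth_at x H" "smooth_at x V" "smooth_at x K" "smooth_at x Vp"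
  shows "smooth_at x (\<lambda>y. Lmat \<omega> (H y) (V y) (K y) (Vp y))"
proof -
  have "smooth_at x (\<lambda>y. Mmat \<omega> (H y))" unfolding Mmat_def
    by (intro smooth_at_intros smooth_at_matrix_mult smooth_at_transpose assms)
  then have "smooth_at x (\<lambda>y. matrix_inv (Mmat \<omega> (H y)))"
    by (rule smooth_at_compose) (intro smooth_at_matrix_inv pos_def_imp_invertible pos_def_Mmat assms(1))
  then show ?thesis unfolding Lmat_def
    by (intro smooth_at_intros smooth_at_matrix_mult smooth_at_transpose assms)
qed

locale smooth_constraint = orthogonally_invariant h e
  for h :: "real^'n^'m \<Rightarrow> real^'q" and e :: "'r::finite \<Rightarrow> 'n" +
  assumes smooth_h: "smooth_on UNIV h"
    and full_rank: "\<And>X. X \<in> Hset h \<Longrightarrow> dim (range (frechet_derivative h (at X))) = CARD('q)"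
begin

text \<open>Let \<open>S\<close> be the reflection that fixes the columns selected by \<open>e\<close> and changes the sign of the others. It
  fixes \<open>pad e H\<close>, so by invariance the derivative of \<open>h\<close> at this point takes the same value on \<open>Y\<close> and
  \<open>Y S\<close>. Hence it kills directions supported on the other columns, and its range is already
  attained on padded matrices.\<close>

lemma surj_derivative_reduced:
  assumes "h (pad e H) = 0"
  shows "surj (frechet_derivative (\<lambda>H. h (pad e H)) (at H))"
proof -
  let ?E = "pad_frame e" and ?X = "pad e H"
  let ?D = "frechet_derivative h (at ?X)"
  have E: "?E \<in> St" by (rule pad_frame_in_St[OF inj_e])
  have D: "(h has_derivative ?D) (at ?X)"
    using smooth_h by (intro smooth_at_imp_has_derivative smooth_on_imp_smooth_at[of UNIV]) auto
  have lin: "linear ?D" using D has_derivative_linear by blast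
  have "dim (range ?D) = CARD('q)" using full_rank[of ?X] assms by (simp add: Hset_def)
  then have "span (range ?D) = UNIV" using dim_eq_full[of "range ?D"] by simp
  moreover have "subspace (range ?D)" by (intro linear_subspace_image lin subspace_UNIV)
  ultimately have surj: "surj ?D" by (metis span_eq_iff)
  let ?S = "2 *\<^sub>R (?E ** transpose ?E) - mat 1"
  have St: "transpose ?S = ?S" by (simp add: transpose_algebra)
  have PP: "Y ** (?E ** transpose ?E) ** (?E ** transpose ?E) = Y ** (?E ** transpose ?E)" for Y :: "real^'n^'k"
    by (simp add: matrix_mul_assoc St_cancel(2)[OF E])
  have reflect: "Y ** ?S = 2 *\<^sub>R (Y ** (?E ** transpose ?E)) - Y" for Y :: "real^'n^'k"
    by (simp only: matrix_mult_algebra matrix_mul_rid)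
  have SS: "?S ** ?S = mat 1"
  proof -
    have "?S ** (?E ** transpose ?E) = ?E ** transpose ?E"
      using PP[of "mat 1"] by (simp only: matrix_mult_algebra matrix_mul_lid scaleR_2 add_diff_cancel_left')
    then show ?thesis by (simp only: reflect[of ?S]) simp
  qed
  have oS: "orthogonal_matrix ?S" by (simp only: orthogonal_matrix St SS)
  have XS: "?X ** ?S = ?X"
    unfolding reflect
    by (simp only: pad_eq_mult[OF inj_e] matrix_mul_assoc St_cancel(2)[OF E] scaleR_2 add_diff_cancel_left')
  have DS: "?D (Y ** ?S) = ?D Y" for Y
  proof -
    have "((\<lambda>X. X ** ?S) has_derivative (\<lambda>Y. Y ** ?S)) (at ?X)"
      by (intro bounded_linear_imp_has_derivative
          bounded_bilinear.bounded_linear_left[OF bounded_bilinear_matrix_mult])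
    from has_derivative_compose[OF this, of h ?D] D XS
    have "((\<lambda>X. h (X ** ?S)) has_derivative (\<lambda>Y. ?D (Y ** ?S))) (at ?X)" by simp
    then have "(h has_derivative (\<lambda>Y. ?D (Y ** ?S))) (at ?X)" by (simp only: inv[OF oS])
    from has_derivative_unique[OF this D] show ?thesis by (rule fun_cong)
  qed
  have DE: "?D Y = ?D (Y ** ?E ** transpose ?E)" for Y
  proof -
    have "2 *\<^sub>R ?D Y = ?D (Y ** ?S) + ?D Y" unfolding DS by (rule scaleR_2)
    also have "\<dots> = ?D (Y ** ?S + Y)" by (simp only: linear_add[OF lin])
    also have "Y ** ?S + Y = 2 *\<^sub>R (Y ** ?E ** transpose ?E)"
      unfolding reflect by (simp add: matrix_mul_assoc)
    finally show ?thesis by (simp add: linear_scale[OF lin])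
  qed
  have "((\<lambda>H. H ** transpose ?E) has_derivative (\<lambda>K. K ** transpose ?E)) (at H)"
    by (intro bounded_linear_imp_has_derivative
        bounded_bilinear.bounded_linear_left[OF bounded_bilinear_matrix_mult])
  from has_derivative_compose[OF this, of h ?D] D
  have "((\<lambda>H. h (pad e H)) has_derivative (\<lambda>K. ?D (K ** transpose ?E))) (at H)"
    by (simp add: pad_eq_mult[OF inj_e])
  then have eq: "frechet_derivative (\<lambda>H. h (pad e H)) (at H) = (\<lambda>K. ?D (K ** transpose ?E))"
    by (metis frechet_derivative_at)
  show ?thesis unfolding eq
  proof (rule surjI)
    fix y
    show "?D (inv ?D y ** ?E ** transpose ?E) = y"
      using DE[of "inv ?D y"] surj by (simp add: surj_f_inv_f)
  qed
qed

lemma smooth_on_reduced: "smooth_on UNIV (\<lambda>H :: real^'r^'m. h (pad e H))"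
proof -
  have "smooth_at H (\<lambda>H :: real^'r^'m. h (H ** transpose (pad_frame e)))" for H
    using smooth_h
    by (intro smooth_at_compose[of H "\<lambda>H. H ** transpose (pad_frame e)" h] smooth_at_matrix_mult smooth_at_intros)
      (auto intro: smooth_on_imp_smooth_at)
  then show ?thesis by (simp add: smooth_on_iff_smooth_at pad_eq_mult[OF inj_e])
qed

lemma Hr_projection:
  assumes "H \<in> Hr h e"
  obtains P where "smooth_at H P"
    "\<forall>\<^sub>F z in nhds H. is_nearest (Hr h e) z (P z) \<and> (\<forall>y. is_nearest (Hr h e) z y \<longrightarrow> y = P z)"
proof -
  let ?F = "\<lambda>H :: real^'r^'m. h (pad e H)"
  have n: "is_nearest (Hr h e) z y \<longleftrightarrow> ?F y = 0 \<and> (\<forall>w. ?F w = 0 \<longrightarrow> dist z y \<le> dist z w)" for z y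
    by (simp add: is_nearest_def Hr_def)
  have H: "?F H = 0" using assms by (simp add: Hr_def)
  have surj: "surj (frechet_derivative ?F (at y))" if "?F y = 0" for y
    using surj_derivative_reduced that .
  obtain P where "smooth_at H P"
    "\<forall>\<^sub>F z in nhds H. ?F (P z) = 0 \<and> (\<forall>w. ?F w = 0 \<longrightarrow> dist z (P z) \<le> dist z w) \<and>
       (\<forall>y. ?F y = 0 \<and> (\<forall>w. ?F w = 0 \<longrightarrow> dist z y \<le> dist z w) \<longrightarrow> y = P z)"
    by (rule smooth_local_projection[OF smooth_on_reduced surj H])
  then show ?thesis by (intro that) (simp_all only: n conj_assoc)
qed

text \<open>All ingredients are expressed through the smooth frame near \<open>p0\<close>: \<open>fV\<close>, \<open>fH\<close>, \<open>fK\<close> and \<open>fU\<close> are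
  the components of a representation of the point and of the tangent vector, defined
  by formulas that make sense for arbitrary matrices and are smooth near \<open>(p0, 0)\<close>. At this point the
  frame \<open>fW\<close> is \<open>V\<close> and the matrix \<open>fZ\<close> to be projected is \<open>H\<close>, which is where the local
  projection and the polar factor are known to be smooth.\<close>

lemma local_smooth_formula:
  assumes \<omega>: "\<omega> > 0" and p0: "p0 \<in> Mh h e"
  obtains N g where "open N" "(p0, 0) \<in> N" "smooth_on N g"
    "\<And>p \<xi>. (p, \<xi>) \<in> N \<Longrightarrow> \<xi> \<in> tangent_space (Mh h e) p \<Longrightarrow>
       R_well_defined_at h e \<omega> p \<xi> \<and> g (p, \<xi>) = R_map h e \<omega> (p, \<xi>) \<and> R_map h e \<omega> (p, \<xi>) \<in> Mh h e"
proof -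
  obtain H V where rep: "represents_point h e H V p0" using represents_point_exists[OF p0] .
  have V: "V \<in> St" "snd p0 = mat 1 - V ** transpose V" and H: "H \<in> Hr h e"
    using rep by (auto simp: represents_point_def)
  obtain P where P: "smooth_at H P"
    "\<forall>\<^sub>F z in nhds H. is_nearest (Hr h e) z (P z) \<and> (\<forall>y. is_nearest (Hr h e) z y \<longrightarrow> y = P z)"
    using Hr_projection[OF H] .
  define fV :: "((real^'n^'m) \<times> (real^'n^'n)) \<times> ((real^'n^'m) \<times> (real^'n^'n)) \<Rightarrow> real^'r^'n"
    where "fV x = frame V (fst x)" for x
  define fH where "fH x = fst (fst x) ** fV x" for x
  define fK where "fK x = fst (snd x) ** fV x" for x
  define fU where "fU x = - (snd (snd x) ** fV x)" for x
  define fL where "fL x = Lmat \<omega> (fH x) (fV x) (fK x) (fU x)" for x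
  define fW where "fW x = polar (fL x)" for x
  define fZ where "fZ x = (fst (fst x) + fst (snd x)) ** fW x" for x
  define g where "g x = (P (fZ x) ** transpose (fW x), mat 1 - fW x ** transpose (fW x))" for x
  let ?x = "(p0, 0) :: ((real^'n^'m) \<times> (real^'n^'n)) \<times> ((real^'n^'m) \<times> (real^'n^'n))"
  have v: "fV ?x = V" by (simp add: fV_def frame_base[OF V])
  have hh: "fH ?x = H" by (simp add: fH_def v represents_point_eq[OF rep])
  have l: "fL ?x = V" by (simp add: fL_def v fK_def fU_def Lmat_def matrix_mult_algebra)
  have w: "fW ?x = V" by (simp add: fW_def l polar_St[OF V(1)])
  have z: "fZ ?x = H" by (simp add: fZ_def w represents_point_eq[OF rep])
  have sV: "smooth_at ?x fV" unfolding fV_def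
    by (rule smooth_at_compose[of _ fst "frame V"])
      (simp_all add: smooth_at_frame[OF V] smooth_at_bounded_linear bounded_linear_fst)
  have sH: "smooth_at ?x fH" and sK: "smooth_at ?x fK" and sU: "smooth_at ?x fU"
    unfolding fH_def fK_def fU_def by (intro smooth_at_matrix_mult smooth_at_intros sV)+
  have sL: "smooth_at ?x fL" unfolding fL_def by (rule smooth_at_Lmat[OF \<omega> sH sV sK sU])
  have sW: "smooth_at ?x fW" unfolding fW_def
    by (rule smooth_at_compose[OF sL]) (simp add: l smooth_at_polar[OF V(1)])
  have sZ: "smooth_at ?x fZ" unfolding fZ_def by (intro smooth_at_matrix_mult smooth_at_intros sW)
  have "smooth_at ?x (\<lambda>x. P (fZ x))" by (rule smooth_at_compose[OF sZ]) (simp add: z P(1))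
  then have sg: "smooth_at ?x g" unfolding g_def
    by (intro smooth_at_intros smooth_at_matrix_mult smooth_at_transpose sW)
  have "\<forall>\<^sub>F x in nhds ?x. smooth_at x g \<and> has_gram_root (fL x) \<and>
     (fst x \<in> Mh h e \<longrightarrow> represents_point h e (fH x) (fV x) (fst x)) \<and>
     is_nearest (Hr h e) (fZ x) (P (fZ x)) \<and> (\<forall>y. is_nearest (Hr h e) (fZ x) y \<longrightarrow> y = P (fZ x))"
  proof (intro eventually_conj)
    show "\<forall>\<^sub>F x in nhds ?x. smooth_at x g" by (rule eventually_smooth_at[OF sg])
    show "\<forall>\<^sub>F x in nhds ?x. has_gram_root (fL x)"
      using smooth_at_imp_eventually[OF sL, unfolded l, OF smooth_at_gram_root(2)[OF V(1)]] .
    have "smooth_at ?x fst" by (rule smooth_at_bounded_linear[OF bounded_linear_fst])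
    from smooth_at_imp_eventually[OF this, unfolded fst_conv, OF eventually_frame_represents[OF V]]
    show "\<forall>\<^sub>F x in nhds ?x. fst x \<in> Mh h e \<longrightarrow> represents_point h e (fH x) (fV x) (fst x)"
      by (simp add: fH_def fV_def)
    show "\<forall>\<^sub>F x in nhds ?x. is_nearest (Hr h e) (fZ x) (P (fZ x))"
      "\<forall>\<^sub>F x in nhds ?x. \<forall>y. is_nearest (Hr h e) (fZ x) y \<longrightarrow> y = P (fZ x)"
      using smooth_at_imp_eventually[OF sZ, unfolded z, OF P(2)] by (auto elim: eventually_mono)
  qed
  then obtain N where N: "open N" "?x \<in> N" "\<And>x. x \<in> N \<Longrightarrow> smooth_at x g" "\<And>x. x \<in> N \<Longrightarrow> has_gram_root (fL x)"
    "\<And>x. x \<in> N \<Longrightarrow> fst x \<in> Mh h e \<Longrightarrow> represents_point h e (fH x) (fV x) (fst x)"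
    "\<And>x. x \<in> N \<Longrightarrow> is_nearest (Hr h e) (fZ x) (P (fZ x))"
    "\<And>x. x \<in> N \<Longrightarrow> \<forall>y. is_nearest (Hr h e) (fZ x) y \<longrightarrow> y = P (fZ x)"
    unfolding eventually_nhds by blast
  show ?thesis
  proof (rule that[OF N(1,2)])
    show "smooth_on N g" using N(1,3) by (simp add: smooth_on_iff_smooth_at)
    fix p \<xi> assume x: "(p, \<xi>) \<in> N" and \<xi>: "\<xi> \<in> tangent_space (Mh h e) p"
    let ?y = "(p, \<xi>)"
    have p: "p \<in> Mh h e" using \<xi> by (rule tangent_space_base)
    have r: "represents_point h e (fH ?y) (fV ?y) p" using N(5)[OF x] p by simp
    have t: "represents_tangent h e (fH ?y) (fV ?y) (fK ?y) (fU ?y) \<xi>"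
      using tangent_represents[OF r \<xi>] by (simp add: fK_def fU_def)
    have W: "Wmat \<omega> (fH ?y) (fV ?y) (fK ?y) (fU ?y) = fW ?y" by (simp add: Wmat_eq_polar fW_def fL_def)
    have Z: "(fst p + fst \<xi>) ** fW ?y = fZ ?y" by (simp add: fZ_def)
    have root: "has_gram_root (Lmat \<omega> (fH ?y) (fV ?y) (fK ?y) (fU ?y))" using N(4)[OF x] by (simp add: fL_def)
    have n: "is_nearest (Hr h e) ((fst p + fst \<xi>) ** Wmat \<omega> (fH ?y) (fV ?y) (fK ?y) (fU ?y)) (P (fZ ?y))"
      "\<forall>u. is_nearest (Hr h e) ((fst p + fst \<xi>) ** Wmat \<omega> (fH ?y) (fV ?y) (fK ?y) (fU ?y)) u \<longrightarrow> u = P (fZ ?y)"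
      unfolding W Z by (rule N(6)[OF x], rule N(7)[OF x])
    note R = R_map_eq_R_value[OF \<omega> r t root n]
    have Rg: "R_map h e \<omega> (p, \<xi>) = g ?y"
      unfolding R(1) R_value_def Let_def closest_point_eq_unique_nearest[OF n] unfolding W g_def ..
    have "represents_point h e (P (fZ ?y)) (fW ?y) (g ?y)"
      using N(6)[OF x] polar_in_St[OF N(4)[OF x]]
      by (simp add: represents_point_def is_nearest_def g_def fW_def)
    then have "g ?y \<in> Mh h e" by (rule represents_point_imp_Mh)
    then show "R_well_defined_at h e \<omega> p \<xi> \<and> g (p, \<xi>) = R_map h e \<omega> (p, \<xi>) \<and> R_map h e \<omega> (p, \<xi>) \<in> Mh h e"
      using R(2) Rg by simp
  qed
qed

end

section \<open>Vanishing intrinsic acceleration\<close>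

lemma weighted_inner_eq: "weighted_inner \<omega> A B = fst A \<bullet> fst B + \<omega> * (snd A \<bullet> snd B)"
  by (simp add: weighted_inner_def frob_inner_eq_inner)

text \<open>An element \<open>q\<close> of \<open>T\<close> with \<open>z - q\<close> orthogonal to \<open>T\<close> is orthogonal to itself.\<close>

lemma orth_proj_weighted_inner_eq_0:
  assumes "\<omega> > 0" "0 \<in> T" "\<And>t. t \<in> T \<Longrightarrow> weighted_inner \<omega> z t = 0"
  shows "orth_proj (weighted_inner \<omega>) T z = 0"
  unfolding orth_proj_def
proof (rule the_equality)
  show "0 \<in> T \<and> (\<forall>t\<in>T. weighted_inner \<omega> (z - 0) t = 0)" using assms by simp
  fix q assume q: "q \<in> T \<and> (\<forall>t\<in>T. weighted_inner \<omega> (z - q) t = 0)"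
  then have "weighted_inner \<omega> (z - q) q = 0" "weighted_inner \<omega> z q = 0" using assms(3) by auto
  then have "fst q \<bullet> fst q + \<omega> * (snd q \<bullet> snd q) = 0"
    by (simp add: weighted_inner_eq inner_diff_left algebra_simps)
  moreover have "0 \<le> fst q \<bullet> fst q" "0 \<le> \<omega> * (snd q \<bullet> snd q)" using assms(1) by auto
  ultimately have "fst q \<bullet> fst q = 0" "\<omega> * (snd q \<bullet> snd q) = 0" by linarith+
  then show "q = 0" using assms(1) by (simp add: prod_eq_iff)
qed

text \<open>The first argument is the extrinsic acceleration, with \<open>W2\<close> and \<open>Y2\<close> the second derivatives of the
  frame and of the projected matrix. The terms \<open>T1\<close> and \<open>T5\<close> cancel. The terms \<open>T4\<close>, \<open>T6\<close> and \<open>T7\<close>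
  are pairings with \<open>U'\<close> and cancel by the equation for \<open>C\<close>; the factor \<open>2 \<omega>\<close> in the definition of
  \<open>Mmat\<close> comes from the two symmetric halves of \<open>T7\<close>.\<close>

lemma normal_acceleration:
  fixes H K K' Y2 :: "real^'r^'m" and V U U' W2 :: "real^'r^'n" and C :: "real^'r^'r"
  assumes V: "V \<in> St" and U: "transpose V ** U = 0" "transpose V ** U' = 0"
    and C: "C ** Mmat \<omega> H = transpose K ** H"
    and W2: "W2 = - (2 *\<^sub>R (U ** C)) - V ** (transpose U ** U)"
    and Y2: "Y2 \<bullet> K' = (H ** (transpose U ** U)) \<bullet> K'"
  shows "weighted_inner \<omega>
     (H ** transpose W2 + 2 *\<^sub>R (K ** transpose U) + Y2 ** transpose V,
      - (V ** transpose W2 + 2 *\<^sub>R (U ** transpose U) + W2 ** transpose V))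
     (K' ** transpose V + H ** transpose U', - (U' ** transpose V) - V ** transpose U') = 0"
proof -
  let ?S = "transpose U ** U"
  have Ut: "transpose U ** V = 0" "transpose U' ** V = 0"
  proof -
    have "transpose (transpose V ** U) = 0" "transpose (transpose V ** U') = 0"
      by (simp_all only: U transpose_zero)
    then show "transpose U ** V = 0" "transpose U' ** V = 0" by (simp_all add: matrix_transpose_mul)
  qed
  have z: "A ** transpose V ** U = 0" "A ** transpose V ** U' = 0" "A ** transpose U ** V = 0"
    "A ** transpose U' ** V = 0" for A :: "real^'r^'k"
    by (simp_all add: U Ut matrix_mult_algebra flip: matrix_mul_assoc)
  have VW2: "A ** transpose V ** W2 = - (A ** ?S)" for A :: "real^'r^'k"
    by (simp add: W2 matrix_mult_algebra matrix_mul_assoc z St_cancel[OF V])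
  have W2V: "transpose W2 ** V = - ?S"
    using arg_cong[OF VW2[of "mat 1"], of transpose] by (simp add: transpose_algebra)
  have Vperp: "(V ** B) \<bullet> U' = 0" for B :: "real^'r^'r" by (simp add: inner_mult_left U)
  have T1: "(Y2 ** transpose V) \<bullet> (K' ** transpose V) = (H ** ?S) \<bullet> K'"
    by (simp add: inner_mult_right St_cancel[OF V] Y2)
  have T2: "(Y2 ** transpose V) \<bullet> (H ** transpose U') = 0"
    by (simp add: inner_mult_right z)
  have T3: "(K ** transpose U) \<bullet> (K' ** transpose V) = 0"
    by (simp add: inner_mult_right z)
  have T4: "(K ** transpose U) \<bullet> (H ** transpose U') = (U ** transpose K ** H) \<bullet> U'"
  proof -
    have "(K ** transpose U) \<bullet> (H ** transpose U') = (U ** transpose K) \<bullet> (U' ** transpose H)"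
      using inner_transpose[of "K ** transpose U" "H ** transpose U'"] by (simp add: matrix_transpose_mul)
    also have "\<dots> = U' \<bullet> (U ** transpose K ** H)"
      using inner_mult_right[of U' "transpose H" "U ** transpose K"] by (simp add: inner_commute)
    finally show ?thesis by (simp add: inner_commute)
  qed
  have T5: "(H ** transpose W2) \<bullet> (K' ** transpose V) = - ((H ** ?S) \<bullet> K')"
  proof -
    have "(H ** transpose W2) \<bullet> (K' ** transpose V) = H \<bullet> - (K' ** ?S)"
      by (simp only: inner_mult_right transpose_transpose VW2)
    also have "\<dots> = - ((K' ** ?S) \<bullet> H)" by (simp add: inner_commute)
    also have "\<dots> = - (K' \<bullet> (H ** ?S))" by (simp only: inner_mult_right matrix_transpose_mul transpose_transpose)
    finally show ?thesis by (simp add: inner_commute)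
  qed
  have T6: "(H ** transpose W2) \<bullet> (H ** transpose U') = - 2 * ((U ** C ** transpose H ** H) \<bullet> U')"
  proof -
    have "(H ** transpose W2) \<bullet> (H ** transpose U') = (W2 ** transpose H) \<bullet> (U' ** transpose H)"
      using inner_transpose[of "H ** transpose W2" "H ** transpose U'"] by (simp add: matrix_transpose_mul)
    also have "\<dots> = U' \<bullet> (W2 ** transpose H ** H)"
      using inner_mult_right[of U' "transpose H" "W2 ** transpose H"] by (simp add: inner_commute)
    also have "\<dots> = (W2 ** transpose H ** H) \<bullet> U'" by (rule inner_commute)
    also have "W2 ** transpose H ** H = - (2 *\<^sub>R (U ** C ** transpose H ** H)) - V ** (?S ** transpose H ** H)"
      by (simp only: W2 matrix_mult_algebra matrix_mul_assoc)
    also have "\<dots> \<bullet> U' = - 2 * ((U ** C ** transpose H ** H) \<bullet> U')"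
      by (simp only: inner_diff_left inner_minus_left inner_scaleR_left Vperp)
    finally show ?thesis .
  qed
  let ?A = "V ** transpose W2 + 2 *\<^sub>R (U ** transpose U) + W2 ** transpose V"
  have T7: "- ?A \<bullet> (- (U' ** transpose V) - V ** transpose U') = - 4 * ((U ** C) \<bullet> U')"
  proof -
    have At: "transpose ?A = ?A" by (simp only: transpose_algebra) (simp add: add_ac)
    have "?A \<bullet> (V ** transpose U') = ?A \<bullet> (U' ** transpose V)"
      using inner_transpose[of ?A "V ** transpose U'"] unfolding At by (simp add: matrix_transpose_mul)
    then have "- ?A \<bullet> (- (U' ** transpose V) - V ** transpose U') = 2 * (?A \<bullet> (U' ** transpose V))"
      by (simp only: inner_minus_left inner_diff_right inner_minus_right)
    also have "?A \<bullet> (U' ** transpose V) = U' \<bullet> (?A ** V)"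
      using inner_mult_right[of U' "transpose V" ?A] by (simp add: inner_commute)
    also have "?A ** V = V ** (transpose W2 ** V) + W2"
      by (simp add: matrix_mult_algebra matrix_mul_assoc z St_cancel[OF V])
    also have "\<dots> = - (V ** ?S) + (- (2 *\<^sub>R (U ** C)) - V ** ?S)"
      by (simp only: W2V matrix_mult_algebra) (simp only: W2)
    also have "U' \<bullet> \<dots> = - 2 * ((U ** C) \<bullet> U')"
    proof -
      have "U' \<bullet> (V ** ?S) = 0" using Vperp[of ?S] by (simp only: inner_commute)
      then show ?thesis
        by (simp only: inner_add_right inner_diff_right inner_minus_right inner_scaleR_right
            inner_commute[of U' "U ** C"])
    qed
    finally show ?thesis by simp
  qed
  have "(U ** transpose K ** H) \<bullet> U' = (U ** (C ** Mmat \<omega> H)) \<bullet> U'" by (simp only: C matrix_mul_assoc)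
  also have "U ** (C ** Mmat \<omega> H) = (2 * \<omega>) *\<^sub>R (U ** C) + U ** C ** transpose H ** H"
    by (simp only: Mmat_def matrix_mult_algebra matrix_mul_rid matrix_mul_assoc)
  finally have "(U ** transpose K ** H) \<bullet> U' = 2 * \<omega> * ((U ** C) \<bullet> U') + (U ** C ** transpose H ** H) \<bullet> U'"
    by (simp only: inner_add_left inner_scaleR_left)
  then show ?thesis
    by (simp only: weighted_inner_eq fst_conv snd_conv T7)
      (simp add: inner_add_left inner_add_right T1 T2 T3 T4 T5 T6 algebra_simps)
qed

context smooth_constraint
begin

text \<open>On the line through \<open>\<xi>\<close> the representation \<open>(t K, t U)\<close> may be used for all \<open>t\<close> near 0, so the curve
  is an explicit expression in the polar factor \<open>W\<close> and the projection \<open>P\<close>, and its jet is computed with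
  the product rule.\<close>

lemma jet2_R_map:
  assumes \<omega>: "\<omega> > 0" and \<xi>: "\<xi> \<in> tangent_space (Mh h e) p"
  obtains c where "jet2 (\<lambda>t. R_map h e \<omega> (p, t *\<^sub>R \<xi>)) p \<xi> c"
    "\<And>\<tau>. \<tau> \<in> tangent_space (Mh h e) p \<Longrightarrow> weighted_inner \<omega> c \<tau> = 0"
proof -
  obtain H V where rep: "represents_point h e H V p"
    using represents_point_exists[OF tangent_space_base[OF \<xi>]] .
  have V: "V \<in> St" and H: "H \<in> Hr h e" and p: "p = (H ** transpose V, mat 1 - V ** transpose V)"
    using rep by (auto simp: represents_point_def)
  define K where "K = fst \<xi> ** V"
  define U where "U = - (snd \<xi> ** V)"
  have tan: "represents_tangent h e H V K U \<xi>" unfolding K_def U_def by (rule tangent_represents[OF rep \<xi>])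
  have K: "K \<in> tangent_space (Hr h e) H" and VU: "transpose V ** U = 0"
    and \<xi>_eq: "\<xi> = (K ** transpose V + H ** transpose U, - (U ** transpose V) - V ** transpose U)"
    using tan by (auto simp: represents_tangent_def)
  obtain P where P: "smooth_at H P"
    "\<forall>\<^sub>F z in nhds H. is_nearest (Hr h e) z (P z) \<and> (\<forall>y. is_nearest (Hr h e) z y \<longrightarrow> y = P z)"
    using Hr_projection[OF H] .
  define C where "C = transpose K ** H ** matrix_inv (Mmat \<omega> H)"
  have CM: "C ** Mmat \<omega> H = transpose K ** H"
    using matrix_inv_mult(2)[OF pos_def_imp_invertible[OF pos_def_Mmat[OF \<omega>]], of H]
    by (simp add: C_def flip: matrix_mul_assoc)
  let ?S = "transpose U ** U"
  define L where "L t = Lmat \<omega> H V (t *\<^sub>R K) (t *\<^sub>R U)" for t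
  define W where "W t = polar (L t)" for t
  define Z where "Z t = (fst p + t *\<^sub>R fst \<xi>) ** W t" for t
  define W2 where "W2 = - (2 *\<^sub>R (U ** C)) - V ** ?S"
  have zV: "A ** transpose V ** U = 0" for A :: "real^'r^'k"
    by (simp add: VU matrix_mult_algebra flip: matrix_mul_assoc)
  have L_eq: "L = (\<lambda>t. V + t *\<^sub>R U - t *\<^sub>R (t *\<^sub>R (U ** C)))"
    by (rule ext) (simp add: L_def Lmat_def C_def transpose_algebra matrix_mult_algebra matrix_mul_assoc algebra_simps)
  have sL: "smooth_at 0 L" unfolding L_eq by (intro smooth_at_intros)
  have jL: "jet2 L V U (- (2 *\<^sub>R (U ** C)))" unfolding L_eq
    using jet2_diff[OF jet2_add[OF jet2_const[of V] jet2_line[of U]]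
        jet2_bilinear[OF bounded_bilinear_scaleR jet2_ident jet2_line[of "U ** C"]]] by simp
  have L0: "L 0 = V" by (rule jet2_value[OF jL])
  have VL2: "transpose V ** - (2 *\<^sub>R (U ** C)) = 0" by (simp add: matrix_mult_algebra matrix_mul_assoc VU)
  have "transpose (transpose V ** - (2 *\<^sub>R (U ** C))) = 0" by (simp only: VL2 transpose_zero)
  then have L2V: "transpose (- (2 *\<^sub>R (U ** C))) ** V = 0" by (simp only: matrix_transpose_mul transpose_transpose)
  have jW: "jet2 W V U W2"
    using jet2_polar[OF sL jL V VU] unfolding W_def VL2 L2V W2_def by simp
  have W0: "W 0 = V" by (rule jet2_value[OF jW])
  have sW: "smooth_at 0 W" unfolding W_def
    by (rule smooth_at_compose[OF sL]) (simp add: L0 smooth_at_polar[OF V])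
  have sZ: "smooth_at 0 Z" unfolding Z_def by (intro smooth_at_matrix_mult smooth_at_intros sW)
  have "jet2 Z (fst p ** V) (fst p ** U + fst \<xi> ** V) (fst p ** W2 + 2 *\<^sub>R (fst \<xi> ** U))"
    using jet2_matrix_mult[OF jet2_add[OF jet2_const[of "fst p"] jet2_line[of "fst \<xi>"]] jW]
    unfolding Z_def by (simp add: matrix_mult_algebra)
  moreover have "fst p ** V = H" using represents_point_eq[OF rep] by simp
  moreover have "fst p ** U = 0" by (simp add: p zV)
  moreover have "fst p ** W2 + 2 *\<^sub>R (fst \<xi> ** U) = H ** ?S"
  proof -
    have "fst p ** W2 = - (H ** ?S)"
      by (simp only: p fst_conv W2_def matrix_mult_algebra matrix_mul_assoc zV St_cancel(2)[OF V]
          scaleR_zero_right minus_zero diff_0)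
    moreover have "fst \<xi> ** U = H ** ?S"
      by (simp only: \<xi>_eq fst_conv matrix_mult_algebra matrix_mul_assoc zV add_0)
    ultimately show ?thesis by (simp only: scaleR_2 minus_add_cancel)
  qed
  ultimately have jZ: "jet2 Z H K (H ** ?S)" by (simp add: K_def)
  have Z0: "Z 0 = H" by (rule jet2_value[OF jZ])
  obtain Y2 where jY: "jet2 (\<lambda>t. P (Z t)) H K Y2"
    and Y2: "\<And>K'. K' \<in> tangent_space (Hr h e) H \<Longrightarrow> Y2 \<bullet> K' = (H ** ?S) \<bullet> K'"
    using jet2_projection[OF P K sZ jZ] by blast
  let ?c = "(H ** transpose W2 + 2 *\<^sub>R (K ** transpose U) + Y2 ** transpose V,
      - (V ** transpose W2 + 2 *\<^sub>R (U ** transpose U) + W2 ** transpose V))"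
  have "jet2 (\<lambda>t. (P (Z t) ** transpose (W t), mat 1 - W t ** transpose (W t)))
     (H ** transpose V, mat 1 - V ** transpose V)
     (H ** transpose U + K ** transpose V, 0 - (V ** transpose U + U ** transpose V))
     (H ** transpose W2 + 2 *\<^sub>R (K ** transpose U) + Y2 ** transpose V,
      0 - (V ** transpose W2 + 2 *\<^sub>R (U ** transpose U) + W2 ** transpose V))"
    by (rule jet2_Pair[OF jet2_matrix_mult[OF jY jet2_transpose[OF jW]]
        jet2_diff[OF jet2_const jet2_matrix_mult[OF jW jet2_transpose[OF jW]]]])
  moreover have "(H ** transpose U + K ** transpose V, 0 - (V ** transpose U + U ** transpose V)) = \<xi>"
    by (simp add: \<xi>_eq add.commute)
  ultimately have j: "jet2 (\<lambda>t. (P (Z t) ** transpose (W t), mat 1 - W t ** transpose (W t))) p \<xi> ?c"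
    by (simp add: p)
  have ev1: "\<forall>\<^sub>F t in nhds 0. has_gram_root (L t)"
    using smooth_at_imp_eventually[OF sL, unfolded L0, OF smooth_at_gram_root(2)[OF V]] .
  have ev2: "\<forall>\<^sub>F t in nhds 0. is_nearest (Hr h e) (Z t) (P (Z t)) \<and>
      (\<forall>y. is_nearest (Hr h e) (Z t) y \<longrightarrow> y = P (Z t))"
    using smooth_at_imp_eventually[OF sZ, unfolded Z0, OF P(2)] .
  from ev1 ev2 have ev: "\<forall>\<^sub>F t in nhds 0. (P (Z t) ** transpose (W t), mat 1 - W t ** transpose (W t)) =
      R_map h e \<omega> (p, t *\<^sub>R \<xi>)"
  proof eventually_elim
    case (elim t)
    have t: "represents_tangent h e H V (t *\<^sub>R K) (t *\<^sub>R U) (t *\<^sub>R \<xi>)"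
      using tangent_represents[OF rep tangent_space_scaleR[OF \<xi>, of t]]
      by (simp add: K_def U_def matrix_mult_algebra)
    have Wt: "Wmat \<omega> H V (t *\<^sub>R K) (t *\<^sub>R U) = W t" by (simp add: Wmat_eq_polar W_def L_def)
    have Zt: "(fst p + fst (t *\<^sub>R \<xi>)) ** Wmat \<omega> H V (t *\<^sub>R K) (t *\<^sub>R U) = Z t"
      unfolding Wt by (simp add: Z_def)
    have root: "has_gram_root (Lmat \<omega> H V (t *\<^sub>R K) (t *\<^sub>R U))" using elim(1) by (simp add: L_def)
    have n: "is_nearest (Hr h e) ((fst p + fst (t *\<^sub>R \<xi>)) ** Wmat \<omega> H V (t *\<^sub>R K) (t *\<^sub>R U)) (P (Z t))"
      "\<forall>y. is_nearest (Hr h e) ((fst p + fst (t *\<^sub>R \<xi>)) ** Wmat \<omega> H V (t *\<^sub>R K) (t *\<^sub>R U)) y \<longrightarrow> y = P (Z t)"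
      unfolding Zt using elim(2) by auto
    show ?case
      unfolding R_map_eq_R_value(1)[OF \<omega> rep t root n] R_value_def Let_def closest_point_eq_unique_nearest[OF n]
      unfolding Wt ..
  qed
  show ?thesis
  proof (rule that[OF jet2_cong[OF j ev]])
    fix \<tau> assume "\<tau> \<in> tangent_space (Mh h e) p"
    from tangent_represents[OF rep this]
    obtain K' U' where "represents_tangent h e H V K' U' \<tau>" by blast
    then have K': "K' \<in> tangent_space (Hr h e) H" "transpose V ** U' = 0"
      and \<tau>: "\<tau> = (K' ** transpose V + H ** transpose U', - (U' ** transpose V) - V ** transpose U')"
      by (auto simp: represents_tangent_def)
    show "weighted_inner \<omega> ?c \<tau> = 0"
      unfolding \<tau> by (rule normal_acceleration[OF V VU K'(2) CM W2_def Y2[OF K'(1)]])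
  qed
qed

text \<open>The domain is the part of the tangent bundle covered by the open sets on which a local smooth formula is
  available.\<close>

theorem R_map_second_order_retraction:
  assumes \<omega>: "\<omega> > 0"
  shows "\<exists>U. (\<forall>(p, \<xi>)\<in>U. R_well_defined_at h e \<omega> p \<xi>) \<and>
             second_order_retraction_near_zero (weighted_inner \<omega>) (Mh h e) U (R_map h e \<omega>)"
proof -
  let ?M = "Mh h e" and ?R = "R_map h e \<omega>"
  let ?good = "\<lambda>N g. open N \<and> smooth_on N g \<and> (\<forall>p \<xi>. (p, \<xi>) \<in> N \<longrightarrow> \<xi> \<in> tangent_space ?M p \<longrightarrow>
       R_well_defined_at h e \<omega> p \<xi> \<and> g (p, \<xi>) = ?R (p, \<xi>) \<and> ?R (p, \<xi>) \<in> ?M)"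
  define Dom where "Dom = \<Union>{N. \<exists>g. ?good N g}"
  define U where "U = tangent_bundle ?M \<inter> Dom"
  have "open Dom" unfolding Dom_def by (intro open_Union) blast
  have good: "\<exists>N g. x \<in> N \<and> ?good N g" if "x \<in> U" for x using that by (auto simp: U_def Dom_def)
  have tan: "\<xi> \<in> tangent_space ?M p" if "(p, \<xi>) \<in> U" for p \<xi> using that by (simp add: U_def tangent_bundle_def)
  have inM: "R_well_defined_at h e \<omega> p \<xi> \<and> ?R (p, \<xi>) \<in> ?M" if "(p, \<xi>) \<in> U" for p \<xi>
    using good[OF that] tan[OF that] by blast
  have zero: "(p, 0) \<in> U" if p: "p \<in> ?M" for p
  proof -
    obtain N g where "open N" "(p, 0) \<in> N" "smooth_on N g"
      "\<And>p \<xi>. (p, \<xi>) \<in> N \<Longrightarrow> \<xi> \<in> tangent_space (Mh h e) p \<Longrightarrow>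
       R_well_defined_at h e \<omega> p \<xi> \<and> g (p, \<xi>) = ?R (p, \<xi>) \<and> ?R (p, \<xi>) \<in> Mh h e"
      using local_smooth_formula[OF \<omega> p] by blast
    then have "(p, 0) \<in> Dom" unfolding Dom_def by blast
    then show ?thesis using p zero_in_tangent_space[OF p] by (simp add: U_def tangent_bundle_def)
  qed
  have nbhd: "zero_section_neighborhood ?M U"
    using zero \<open>open Dom\<close> by (auto simp: zero_section_neighborhood_def U_def intro: openin_open_Int)
  have smooth: "smooth_map_on U ?R"
    unfolding smooth_map_on_def
  proof
    fix x assume "x \<in> U"
    then obtain N g where N: "x \<in> N" "?good N g" using good by blast
    have "g y = ?R y" if "y \<in> U \<inter> N" for y
      using that N(2) tan[of "fst y" "snd y"] by (metis IntD1 IntD2 prod.collapse)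
    then show "\<exists>N g. x \<in> N \<and> smooth_on N g \<and> (\<forall>y\<in>U \<inter> N. g y = ?R y)" using N by blast
  qed
  have curve: "?R (p, 0 *\<^sub>R \<xi>) = p \<and> ((\<lambda>t. ?R (p, t *\<^sub>R \<xi>)) has_vector_derivative \<xi>) (at 0) \<and>
      intrinsic_acceleration (weighted_inner \<omega>) ?M (\<lambda>t. ?R (p, t *\<^sub>R \<xi>)) 0 = 0"
    if \<xi>: "\<xi> \<in> tangent_space ?M p" for p \<xi>
  proof -
    obtain c where c: "jet2 (\<lambda>t. ?R (p, t *\<^sub>R \<xi>)) p \<xi> c"
      "\<And>\<tau>. \<tau> \<in> tangent_space ?M p \<Longrightarrow> weighted_inner \<omega> c \<tau> = 0"
      by (rule jet2_R_map[OF \<omega> \<xi>]) blast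
    have R0: "?R (p, 0 *\<^sub>R \<xi>) = p" using jet2_value[OF c(1)] .
    have "orth_proj (weighted_inner \<omega>) (tangent_space ?M p) c = 0"
      using c(2) zero_in_tangent_space[OF tangent_space_base[OF \<xi>]]
      by (intro orth_proj_weighted_inner_eq_0[OF \<omega>])
    then have "intrinsic_acceleration (weighted_inner \<omega>) ?M (\<lambda>t. ?R (p, t *\<^sub>R \<xi>)) 0 = 0"
      by (simp only: intrinsic_acceleration_def R0 jet2_imp_vector_derivative2[OF c(1)])
    then show ?thesis using R0 jet2_imp_has_vector_derivative[OF c(1)] by simp
  qed
  have "retraction_near_zero ?M U ?R"
    unfolding retraction_near_zero_def
  proof (intro conjI ballI nbhd smooth)
    show "?R ` U \<subseteq> ?M"
    proof
      fix y assume "y \<in> ?R ` U"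
      then obtain p \<xi> where "y = ?R (p, \<xi>)" "(p, \<xi>) \<in> U" by auto
      then show "y \<in> ?M" using inM by simp
    qed
  qed (use curve in blast)+
  then have "second_order_retraction_near_zero (weighted_inner \<omega>) ?M U ?R"
    unfolding second_order_retraction_near_zero_def using curve by (intro conjI ballI) blast+
  moreover have "\<forall>(p, \<xi>)\<in>U. R_well_defined_at h e \<omega> p \<xi>" by (simp add: Ball_def inM)
  ultimately show ?thesis by blast
qed

end

theorem proposition11:
  fixes h :: "real^'n^'m \<Rightarrow> real^'q"
    and e :: "'r::finite \<Rightarrow> 'n"
    and \<omega> :: real
  assumes "CARD('r) \<le> CARD('m)" and "inj e"
    and "smooth_on UNIV h"
    and "\<And>X Q. orthogonal_matrix Q \<Longrightarrow> h (X ** Q) = h X"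
    and "\<And>X. X \<in> Hset h \<Longrightarrow> dim (range (frechet_derivative h (at X))) = CARD('q)"
    and "\<omega> > 0"
  shows "\<exists>U. (\<forall>(p, \<xi>)\<in>U. R_well_defined_at h e \<omega> p \<xi>) \<and>
             second_order_retraction_near_zero (weighted_inner \<omega>) (Mh h e) U (R_map h e \<omega>)"
proof -
  interpret smooth_constraint h e
    by unfold_locales (use assms in auto)
  show ?thesis by (rule R_map_second_order_retraction[OF assms(6)])
qed

end
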